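(* Let $v_0 \in S^2$ be an arbitrary fixed unit vector in $\mathbb{R}^3$. Then there exist: (a) a body $\mathcal{B} \subset \mathbb{R}^3$ that has zero resistance in the direction $v_0$ but leaves a trace in the direction $v_0$ (i.e., it is not true that it leaves no trace in the direction $v_0$); (b) a body $\mathcal{B} \subset \mathbb{R}^3$ that leaves no trace in the direction $v_0$ but is not invisible in the direction $v_0$; (c) a body $\mathcal{B} \subset \mathbb{R}^3$ that is invisible in the direction $v_0$.
   Context: A body is a bounded connected set $\mathcal{B} \subset \mathbb{R}^3$ with piecewise smooth boundary and with positive volume. Consider the billiard in $\mathbb{R}^3 \setminus \mathcal{B}$: a point particle moves freely with constant velocity outside $\mathcal{B}$ and is reflected elastically (angle of incidence equals angle of reflection) at regular points of $\partial\mathcal{B}$. The scattering mapping $(x,v) \mapsto (x^+_{\mathcal{B}}(x,v), v^+_{\mathcal{B}}(x,v))$, from a full measure subset of $\mathbb{R}^3 \times S^2$ into $\mathbb{R}^3 \times S^2$, is defined as follows. Suppose the motion $x(t), v(t)$ of a billiard particle satisfies $x(t) = x + vt$, $v(t) = v$ for $t < t_1$, and $x(t) = x^+ + v^+ t$, $v(t) = v^+$ for $t > t_2$, where $t_1, t_2$ are real numbers depending on the particular motion. Then $x^+_{\mathcal{B}}(x,v) := x^+$ and $v^+_{\mathcal{B}}(x,v) := v^+$. Put $\tilde{x}^+_{\mathcal{B}}(x,v) := x^+ - \langle x^+, v^+\rangle v^+$, which is orthogonal to $v^+$. Let $\{v\}^\perp$ be the plane through the origin orthogonal to $v$. Definitions,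 for $v_0 \in S^2$: (D1) $\mathcal{B}$ has zero resistance in the direction $v_0$ if $v^+_{\mathcal{B}}(x,v_0) = v_0$ for almost every $x$. (D2) $\mathcal{B}$ leaves no trace in the direction $v_0$ if (D1) holds and, additionally, the mapping $x \mapsto \tilde{x}^+_{\mathcal{B}}(x,v_0)$ from a subset of $\{v_0\}^\perp$ into $\{v_0\}^\perp$ is defined almost everywhere in $\{v_0\}^\perp$ and preserves the two-dimensional Lebesgue measure. (D3) $\mathcal{B}$ is invisible in the direction $v_0$ if (D2) holds and, additionally, $\tilde{x}^+_{\mathcal{B}}(x,v_0) = x$ (for $x \in \{v_0\}^\perp$ where this mapping is defined). *)

theory Defs
  imports "HOL-Analysis.Analysis"
begin

section \<open>Bodies\<close>

primrec Ck_on :: "nat \<Rightarrow> ('a::euclidean_space \<Rightarrow> 'b::real_normed_vector) \<Rightarrow> 'a set \<Rightarrow> bool" where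
  "Ck_on 0 f U \<longleftrightarrow> continuous_on U f"
| "Ck_on (Suc k) f U \<longleftrightarrow>
     (\<forall>x\<in>U. f differentiable (at x)) \<and>
     (\<forall>b\<in>Basis. Ck_on k (\<lambda>x. frechet_derivative f (at x) b) U)"

text \<open>Used for open \<open>U\<close> only.\<close>

definition smooth_on :: "'a::euclidean_space set \<Rightarrow> ('a \<Rightarrow> 'b::real_normed_vector) \<Rightarrow> bool" where
  "smooth_on U f \<longleftrightarrow> (\<forall>k. Ck_on k f U)"

text \<open>
  A surface patch is parametrised by a convex polygon \<open>K\<close>. As usual for parametrised surfaces,
  the parametrisation is smooth up to the edges of \<open>K\<close>, but it has to be injective and regular
  only in the interior; so a sphere in spherical coordinates or a cone in polar coordinates is
  one patch.
\<close>

definition surface_patch :: "(real^2) set \<Rightarrow> (real^2 \<Rightarrow> real^3) \<Rightarrow> bool" where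
  "surface_patch K \<phi> \<longleftrightarrow>
     polytope K \<and> interior K \<noteq> {} \<and>
     (\<exists>U. open U \<and> K \<subseteq> U \<and> smooth_on U \<phi>) \<and>
     (\<forall>u\<in>interior K. \<forall>w\<in>K. \<phi> u = \<phi> w \<longrightarrow> u = w) \<and>
     (\<forall>u\<in>interior K. inj (frechet_derivative \<phi> (at u)))"

text \<open>
  Two distinct patches may only meet along the images of their edges.
\<close>

definition piecewise_smooth_surface :: "(real^3) set \<Rightarrow> bool" where
  "piecewise_smooth_surface S \<longleftrightarrow>
     (\<exists>P. finite P \<and> (\<forall>(K, \<phi>)\<in>P. surface_patch K \<phi>) \<and>
          S = (\<Union>(K, \<phi>)\<in>P. \<phi> ` K) \<and>
          (\<forall>(K, \<phi>)\<in>P. \<forall>(L, \<psi>)\<in>P. (K, \<phi>) \<noteq> (L, \<psi>) \<longrightarrow> \<phi> ` interior K \<inter> \<psi> ` L = {}))"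

definition body :: "(real^3) set \<Rightarrow> bool" where
  "body B \<longleftrightarrow>
     bounded B \<and> connected B \<and> piecewise_smooth_surface (frontier B) \<and> 0 < measure lebesgue B"

section \<open>The billiard outside a body\<close>

text \<open>
  \<open>unit_normal S p n\<close>: near \<open>p\<close>, the set \<open>S\<close> is a smooth surface, cut out by an equation
  \<open>g y = 0\<close> with non-vanishing gradient \<open>c *\<^sub>R n\<close> at \<open>p\<close>. A point of the boundary is regular if
  it has a unit normal in this sense; the normal is then unique up to sign
  (lemma \<open>unit_normal_unique\<close>).
\<close>

definition unit_normal :: "(real^3) set \<Rightarrow> real^3 \<Rightarrow> real^3 \<Rightarrow> bool" where
  "unit_normal S p n \<longleftrightarrow>
     p \<in> S \<and> norm n = 1 \<and>
     (\<exists>U (g :: real^3 \<Rightarrow> real) c. open U \<and> p \<in> U \<and> smooth_on U g \<and>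
        S \<inter> U = {y\<in>U. g y = 0} \<and>
        c \<noteq> 0 \<and> (g has_derivative (\<lambda>h. c * (n \<bullet> h))) (at p))"

definition elastic_reflection :: "real^3 \<Rightarrow> real^3 \<Rightarrow> real^3" where
  "elastic_reflection n u = u - (2 * (u \<bullet> n)) *\<^sub>R n"

text \<open>
  \<open>x t\<close> and \<open>v t\<close> are position and velocity at time \<open>t\<close>. Around every time \<open>t\<close> the motion is
  free with velocity \<open>u\<close> just before \<open>t\<close> and \<open>w\<close> just after \<open>t\<close>. It can be at the boundary only
  in regular points, at isolated times, where \<open>w\<close> is the reflection of \<open>u\<close>. So a particle that
  reaches a singular point, slides along the boundary, or has an accumulation of reflections does
  not have a motion defined for all times. The value of \<open>v\<close> at a time of reflection is irrelevant.
\<close>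

definition billiard_motion :: "(real^3) set \<Rightarrow> (real \<Rightarrow> real^3) \<Rightarrow> (real \<Rightarrow> real^3) \<Rightarrow> bool" where
  "billiard_motion B x v \<longleftrightarrow>
     (\<forall>t. x t \<notin> interior B \<and>
       (\<exists>e>0. \<exists>u w.
          (\<forall>s\<in>{t-e<..<t}. x s \<notin> closure B \<and> x s = x t + (s - t) *\<^sub>R u \<and> v s = u) \<and>
          (\<forall>s\<in>{t<..<t+e}. x s \<notin> closure B \<and> x s = x t + (s - t) *\<^sub>R w \<and> v s = w) \<and>
          (if x t \<in> frontier B
           then \<exists>n. unit_normal (frontier B) (x t) n \<and> w = elastic_reflection n u
           else v t = u \<and> w = u)))"

definition scatters :: "(real^3) set \<Rightarrow> real^3 \<Rightarrow> real^3 \<Rightarrow> real^3 \<Rightarrow> real^3 \<Rightarrow> bool" where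
  "scatters B x v x' v' \<longleftrightarrow>
     (\<exists>\<xi> \<nu> t1 t2. billiard_motion B \<xi> \<nu> \<and>
        (\<forall>t<t1. \<xi> t = x + t *\<^sub>R v \<and> \<nu> t = v) \<and>
        (\<forall>t>t2. \<xi> t = x' + t *\<^sub>R v' \<and> \<nu> t = v'))"

definition scattering_defined :: "(real^3) set \<Rightarrow> real^3 \<Rightarrow> real^3 \<Rightarrow> bool" where
  "scattering_defined B x v \<longleftrightarrow> (\<exists>x' v'. scatters B x v x' v')"

text \<open>
  The outgoing data are unique by lemma \<open>scatters_unique\<close>, so the following descriptions are
  meaningful whenever \<open>scattering_defined B x v\<close>.
\<close>

definition x_plus :: "(real^3) set \<Rightarrow> real^3 \<Rightarrow> real^3 \<Rightarrow> real^3" where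
  "x_plus B x v = (THE x'. \<exists>v'. scatters B x v x' v')"

definition v_plus :: "(real^3) set \<Rightarrow> real^3 \<Rightarrow> real^3 \<Rightarrow> real^3" where
  "v_plus B x v = (THE v'. \<exists>x'. scatters B x v x' v')"

definition x_tilde_plus :: "(real^3) set \<Rightarrow> real^3 \<Rightarrow> real^3 \<Rightarrow> real^3" where
  "x_tilde_plus B x v = x_plus B x v - (x_plus B x v \<bullet> v_plus B x v) *\<^sub>R v_plus B x v"

section \<open>Two-dimensional Lebesgue measure on a plane through the origin\<close>

text \<open>
  The measure is transported from \<open>real^2\<close> along a linear isometry. The choice of the isometry
  does not matter, because Lebesgue measure is invariant under orthogonal maps; for \<open>v \<noteq> 0\<close> one
  exists by lemma \<open>plane_chart_exists\<close>.
\<close>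

definition plane_chart :: "real^3 \<Rightarrow> real^2 \<Rightarrow> real^3" where
  "plane_chart v = (SOME L. linear L \<and> (\<forall>z. norm (L z) = norm z) \<and> range L = {v}\<^sup>\<bottom>)"

definition plane_lebesgue :: "real^3 \<Rightarrow> (real^3) measure" where
  "plane_lebesgue v = embed_measure lebesgue (plane_chart v)"

section \<open>Zero resistance, leaving no trace, invisibility\<close>

definition zero_resistance :: "(real^3) set \<Rightarrow> real^3 \<Rightarrow> bool" where
  "zero_resistance B v0 \<longleftrightarrow>
     (AE x in lebesgue. scattering_defined B x v0 \<and> v_plus B x v0 = v0)"

definition leaves_no_trace :: "(real^3) set \<Rightarrow> real^3 \<Rightarrow> bool" where
  "leaves_no_trace B v0 \<longleftrightarrow>
     zero_resistance B v0 \<and>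
     (AE x in plane_lebesgue v0. scattering_defined B x v0 \<and> x_tilde_plus B x v0 \<in> {v0}\<^sup>\<bottom>) \<and>
     (\<forall>A\<in>sets (plane_lebesgue v0).
        {x \<in> {v0}\<^sup>\<bottom>. scattering_defined B x v0 \<and> x_tilde_plus B x v0 \<in> A}
          \<in> sets (plane_lebesgue v0) \<and>
        emeasure (plane_lebesgue v0)
          {x \<in> {v0}\<^sup>\<bottom>. scattering_defined B x v0 \<and> x_tilde_plus B x v0 \<in> A}
          = emeasure (plane_lebesgue v0) A)"

definition invisible :: "(real^3) set \<Rightarrow> real^3 \<Rightarrow> bool" where
  "invisible B v0 \<longleftrightarrow>
     leaves_no_trace B v0 \<and>
     (\<forall>x\<in>{v0}\<^sup>\<bottom>. scattering_defined B x v0 \<longrightarrow> x_tilde_plus B x v0 = x)"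

section \<open>Well-definedness\<close>

lemma plane_chart_exists:
  fixes v :: "real^3"
  assumes "v \<noteq> 0"
  shows "\<exists>L :: real^2 \<Rightarrow> real^3. linear L \<and> (\<forall>z. norm (L z) = norm z) \<and> range L = {v}\<^sup>\<bottom>"
proof -
  have "{v}\<^sup>\<bottom> = {x. v \<bullet> x = 0}"
    by (auto simp: orthogonal_comp_def orthogonal_def)
  then have "dim (UNIV :: (real^2) set) = dim ({v}\<^sup>\<bottom>)"
    using assms by (simp add: dim_hyperplane)
  then obtain f :: "real^2 \<Rightarrow> real^3"
    where "linear f" "f ` UNIV = {v}\<^sup>\<bottom>" "\<And>x. x \<in> UNIV \<Longrightarrow> norm (f x) = norm x"
    using isometries_subspaces[of "UNIV :: (real^2) set" "{v}\<^sup>\<bottom>"]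
    by (metis subspace_UNIV subspace_orthogonal_comp)
  then show ?thesis by auto
qed

lemma unit_normal_tangent:
  assumes n: "unit_normal S p n" and m: "unit_normal S p m" and hn: "h \<bullet> n = 0"
  shows "h \<bullet> m = 0"
proof (rule ccontr)
  assume hm: "h \<bullet> m \<noteq> 0"
  obtain U and g :: "real^3 \<Rightarrow> real" and c where
    U: "open U" "p \<in> U" "smooth_on U g" "S \<inter> U = {y\<in>U. g y = 0}" "c \<noteq> 0"
       "(g has_derivative (\<lambda>h. c * (n \<bullet> h))) (at p)"
    and "p \<in> S" "norm n = 1"
    using n unfolding unit_normal_def by blast
  obtain V and f :: "real^3 \<Rightarrow> real" and d where
    V: "open V" "p \<in> V" "S \<inter> V = {y\<in>V. f y = 0}" "d \<noteq> 0"
       "(f has_derivative (\<lambda>h. d * (m \<bullet> h))) (at p)"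
    and "norm m = 1"
    using m unfolding unit_normal_def by blast
  have p0: "g p = 0" "f p = 0" using U V \<open>p \<in> S\<close> by blast+
  have nn: "n \<bullet> n = 1" using \<open>norm n = 1\<close> by (simp add: norm_eq_1)
  have gc: "continuous_on U g" using U(3) unfolding smooth_on_def by (metis Ck_on.simps(1))
  define e where "e = \<bar>h \<bullet> m\<bar> / 4"
  have e: "e > 0" using hm by (simp add: e_def)
  define R where "R = norm h + e"
  have R: "R > 0" using e by (simp add: R_def add_nonneg_pos)
  define a where "a = \<bar>c\<bar> * e / (2 * R)"
  define b where "b = \<bar>d\<bar> * e / R"
  have "a > 0" "b > 0" using U(5) V(4) e R by (auto simp: a_def b_def)
  obtain r1 where r1: "r1 > 0"
    "\<And>y. norm (y - p) < r1 \<Longrightarrow> norm (g y - g p - c * (n \<bullet> (y - p))) \<le> a * norm (y - p)"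
    using U(6) \<open>a > 0\<close> unfolding has_derivative_at_alt by blast
  obtain r2 where r2: "r2 > 0"
    "\<And>y. norm (y - p) < r2 \<Longrightarrow> norm (f y - f p - d * (m \<bullet> (y - p))) \<le> b * norm (y - p)"
    using V(5) \<open>b > 0\<close> unfolding has_derivative_at_alt by blast
  have "open (U \<inter> V)" "p \<in> U \<inter> V" using U V by auto
  then obtain r3 where r3: "r3 > 0" "ball p r3 \<subseteq> U \<inter> V"
    by (meson open_contains_ball)
  define t where "t = min r1 (min r2 r3) / (2 * R)"
  have t: "t > 0" using r1 r2 r3 R by (simp add: t_def)
  have tR: "t * R < r1" "t * R < r2" "t * R < r3"
    using R r1 r2 r3 by (auto simp: t_def)
  define q where "q s = p + t *\<^sub>R (h + s *\<^sub>R n)" for s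
  have q: "norm (q s - p) \<le> t * R" if "\<bar>s\<bar> \<le> e" for s
  proof -
    have "norm (h + s *\<^sub>R n) \<le> norm h + \<bar>s\<bar>"
      using norm_triangle_ineq[of h "s *\<^sub>R n"] \<open>norm n = 1\<close> by simp
    then have "norm (h + s *\<^sub>R n) \<le> R" using that by (simp add: R_def)
    then show ?thesis using t by (simp add: q_def)
  qed
  have qUV: "q s \<in> U \<inter> V" if "\<bar>s\<bar> \<le> e" for s
    using q[OF that] tR(3) r3(2) by (auto simp: dist_norm norm_minus_commute)
  have gq: "\<bar>g (q s) - c * t * s\<bar> < \<bar>c\<bar> * t * e" if "\<bar>s\<bar> \<le> e" for s
  proof -
    have "n \<bullet> (q s - p) = t * s"
      using hn nn by (simp add: q_def inner_add_right inner_commute)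
    then have "\<bar>g (q s) - c * t * s\<bar> \<le> a * norm (q s - p)"
      using r1(2)[of "q s"] q[OF that] tR p0 by (simp add: mult.assoc)
    also have "\<dots> \<le> a * (t * R)" using q[OF that] \<open>a > 0\<close> by simp
    also have "\<dots> = \<bar>c\<bar> * t * e / 2" using R by (simp add: a_def)
    also have "\<dots> < \<bar>c\<bar> * t * e" using U(5) t e by simp
    finally show ?thesis .
  qed
  have "continuous_on {-e..e} (\<lambda>s. c * g (q s))"
  proof (intro continuous_intros continuous_on_compose2[OF gc])
    show "continuous_on {-e..e} q" unfolding q_def by (intro continuous_intros)
    show "q ` {-e..e} \<subseteq> U" using qUV by (auto simp: abs_le_iff)
  qed
  moreover have "c * g (q e) \<ge> 0"
  proof -
    have "\<bar>c * g (q e) - c * (c * t * e)\<bar> = \<bar>c\<bar> * \<bar>g (q e) - c * t * e\<bar>"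
      by (simp add: abs_mult[symmetric] right_diff_distrib)
    also have "\<dots> \<le> \<bar>c\<bar> * (\<bar>c\<bar> * t * e)"
      using gq[of e] e by (intro mult_left_mono) auto
    also have "\<dots> = c * (c * t * e)" by (simp add: mult.assoc[symmetric])
    finally show ?thesis by linarith
  qed
  moreover have "c * g (q (-e)) \<le> 0"
  proof -
    have "\<bar>c * g (q (-e)) + c * (c * t * e)\<bar> = \<bar>c\<bar> * \<bar>g (q (-e)) - c * t * (-e)\<bar>"
      by (simp add: abs_mult[symmetric] distrib_left)
    also have "\<dots> \<le> \<bar>c\<bar> * (\<bar>c\<bar> * t * e)"
      using gq[of "-e"] e by (intro mult_left_mono) auto
    also have "\<dots> = c * (c * t * e)" by (simp add: mult.assoc[symmetric])
    finally show ?thesis by linarith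
  qed
  ultimately obtain s where s: "-e \<le> s" "s \<le> e" "c * g (q s) = 0"
    using IVT'[of "\<lambda>s. c * g (q s)" "-e" 0 e] e by auto
  then have se: "\<bar>s\<bar> \<le> e" and "g (q s) = 0" using U(5) by auto
  then have "f (q s) = 0" using qUV[OF se] U(4) V(3) by blast
  then have "\<bar>d * (m \<bullet> (q s - p))\<bar> \<le> b * norm (q s - p)"
    using r2(2)[of "q s"] q[OF se] tR p0 by simp
  also have "\<dots> \<le> b * (t * R)" using q[OF se] \<open>b > 0\<close> by simp
  also have "\<dots> = \<bar>d\<bar> * (t * e)" using R by (simp add: b_def)
  finally have "\<bar>m \<bullet> (q s - p)\<bar> \<le> t * e" using V(4) by (simp add: abs_mult)
  moreover have "m \<bullet> (q s - p) = t * (m \<bullet> h + s * (m \<bullet> n))"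
    by (simp add: q_def inner_add_right)
  ultimately have "\<bar>m \<bullet> h + s * (m \<bullet> n)\<bar> \<le> e" using t by (simp add: abs_mult)
  moreover have "\<bar>s * (m \<bullet> n)\<bar> \<le> e * 1"
    unfolding abs_mult using Cauchy_Schwarz_ineq2[of m n] \<open>norm n = 1\<close> \<open>norm m = 1\<close> se
    by (intro mult_mono) auto
  ultimately have "\<bar>m \<bullet> h\<bar> \<le> 2 * e" by linarith
  then show False using e unfolding e_def by (simp add: inner_commute)
qed

lemma unit_normal_unique:
  assumes n: "unit_normal S p n" and m: "unit_normal S p m"
  shows "m = n \<or> m = - n"
proof -
  have nn: "n \<bullet> n = 1" and mm: "m \<bullet> m = 1"
    using n m by (auto simp: unit_normal_def norm_eq_1)
  define h where "h = m - (m \<bullet> n) *\<^sub>R n"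
  have hn: "h \<bullet> n = 0" using nn by (simp add: h_def inner_diff_left)
  then have "h \<bullet> m = 0" using unit_normal_tangent[OF n m] by simp
  then have "h \<bullet> h = 0" using hn by (simp add: h_def inner_diff_right)
  then have eq: "m = (m \<bullet> n) *\<^sub>R n" by (simp add: h_def)
  then have "norm m = \<bar>m \<bullet> n\<bar> * norm n" by (metis norm_scaleR)
  then have "\<bar>m \<bullet> n\<bar> = 1" using n m by (simp add: unit_normal_def)
  then show ?thesis using eq by (metis abs_eq_iff abs_one scaleR_minus1_left scaleR_one)
qed

lemma billiard_motion_unique:
  assumes x: "billiard_motion B x v" and y: "billiard_motion B y w"
    and init: "\<And>t. t < t0 \<Longrightarrow> x t = y t"
  shows "x t = y t"
proof (rule ccontr)
  assume "x t \<noteq> y t"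
  define D where "D = {t. x t \<noteq> y t}"
  have "t \<in> D" using \<open>x t \<noteq> y t\<close> by (simp add: D_def)
  have low: "\<And>s. s \<in> D \<Longrightarrow> t0 \<le> s" using init unfolding D_def by force
  then have bdd: "bdd_below D" unfolding bdd_below_def by blast
  define T where "T = Inf D"
  have before: "x s = y s" if "s < T" for s
    using that cInf_lower[OF _ bdd, of s] unfolding T_def D_def by force
  obtain e u u' where e: "e > 0"
    "\<And>s. s \<in> {T-e<..<T} \<Longrightarrow> x s = x T + (s - T) *\<^sub>R u"
    "\<And>s. s \<in> {T<..<T+e} \<Longrightarrow> x s = x T + (s - T) *\<^sub>R u'"
    "if x T \<in> frontier B
     then \<exists>n. unit_normal (frontier B) (x T) n \<and> u' = elastic_reflection n u else u' = u"
    using x[unfolded billiard_motion_def, rule_format, of T] by (smt (verit))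
  obtain f z z' where f: "f > 0"
    "\<And>s. s \<in> {T-f<..<T} \<Longrightarrow> y s = y T + (s - T) *\<^sub>R z"
    "\<And>s. s \<in> {T<..<T+f} \<Longrightarrow> y s = y T + (s - T) *\<^sub>R z'"
    "if y T \<in> frontier B
     then \<exists>n. unit_normal (frontier B) (y T) n \<and> z' = elastic_reflection n z else z' = z"
    using y[unfolded billiard_motion_def, rule_format, of T] by (smt (verit))
  define r where "r = min e f"
  have r: "r > 0" "r \<le> e" "r \<le> f" using e f by (auto simp: r_def)
  have 1: "x T + (- (r/2)) *\<^sub>R u = y T + (- (r/2)) *\<^sub>R z"
    using before[of "T - r/2"] e(2)[of "T - r/2"] f(2)[of "T - r/2"] r by simp
  have 2: "x T + (- (r/4)) *\<^sub>R u = y T + (- (r/4)) *\<^sub>R z"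
    using before[of "T - r/4"] e(2)[of "T - r/4"] f(2)[of "T - r/4"] r by simp
  have "x T = 2 *\<^sub>R (x T + (- (r/4)) *\<^sub>R u) - (x T + (- (r/2)) *\<^sub>R u)"
    by (simp add: algebra_simps scaleR_2)
  also have "\<dots> = 2 *\<^sub>R (y T + (- (r/4)) *\<^sub>R z) - (y T + (- (r/2)) *\<^sub>R z)"
    by (simp only: 1 2)
  also have "\<dots> = y T" by (simp add: algebra_simps scaleR_2)
  finally have xy: "x T = y T" .
  then have uz: "u = z" using 1 r by simp
  have "u' = z'"
  proof (cases "x T \<in> frontier B")
    case True
    then obtain n m where "unit_normal (frontier B) (x T) n" "u' = elastic_reflection n u"
      "unit_normal (frontier B) (x T) m" "z' = elastic_reflection m u"
      using e(4) f(4) xy uz by auto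
    then show ?thesis
      using unit_normal_unique[of "frontier B" "x T" n m] by (auto simp: elastic_reflection_def)
  next
    case False
    then show ?thesis using e(4) f(4) xy uz by simp
  qed
  then have after: "x s = y s" if "s < T + r" for s
    using before[of s] xy e(3)[of s] f(3)[of s] that r by (cases "s < T"; cases "s = T") auto
  have "T + r \<le> Inf D"
    using \<open>t \<in> D\<close> after by (intro cInf_greatest) (auto simp: D_def not_less[symmetric])
  then show False using r by (simp add: T_def)
qed

lemma scatters_unique:
  assumes "scatters B x v x1 v1" and "scatters B x v x2 v2"
  shows "x1 = x2 \<and> v1 = v2"
proof -
  obtain \<xi> \<nu> t1 t2 where 1: "billiard_motion B \<xi> \<nu>"
    "\<And>t. t < t1 \<Longrightarrow> \<xi> t = x + t *\<^sub>R v" "\<And>t. t > t2 \<Longrightarrow> \<xi> t = x1 + t *\<^sub>R v1"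
    using assms(1) unfolding scatters_def by blast
  obtain \<eta> \<mu> s1 s2 where 2: "billiard_motion B \<eta> \<mu>"
    "\<And>t. t < s1 \<Longrightarrow> \<eta> t = x + t *\<^sub>R v" "\<And>t. t > s2 \<Longrightarrow> \<eta> t = x2 + t *\<^sub>R v2"
    using assms(2) unfolding scatters_def by blast
  have "\<xi> t = \<eta> t" for t
    by (rule billiard_motion_unique[OF 1(1) 2(1), where ?t0.0 = "min t1 s1"]) (simp add: 1 2)
  then have eq: "x1 + t *\<^sub>R v1 = x2 + t *\<^sub>R v2" if "t > max t2 s2" for t
    using 1(3)[of t] 2(3)[of t] that by simp
  define a where "a = max t2 s2 + 1"
  have a: "x1 + a *\<^sub>R v1 = x2 + a *\<^sub>R v2" and b: "x1 + (a + 1) *\<^sub>R v1 = x2 + (a + 1) *\<^sub>R v2"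
    by (rule eq; simp add: a_def)+
  have "v1 = (x1 + (a + 1) *\<^sub>R v1) - (x1 + a *\<^sub>R v1)" by (simp add: algebra_simps)
  also have "\<dots> = v2" unfolding a b by (simp add: algebra_simps)
  finally show ?thesis using a by simp
qed

end

theory Submission
  imports Defs
begin

text \<open>
  All three bodies are made of parabolic mirrors. Take coordinates \<open>x, y, z\<close> with the \<open>x\<close>-axis along
  \<open>v0\<close>, and describe a body by its section with the \<open>x, z\<close>-plane, thickened to \<open>0 \<le> y \<le> 1\<close>. A
  parabolic mirror with axis along \<open>x\<close> collects the beam of particles with \<open>2 < z < 3\<close> in its focus.
  Behind the focus, in the half-plane \<open>z < 0\<close>, a second parabola with the same focus and axis makes
  the beam parallel to \<open>v0\<close> again. The two mirrors are similar with respect to the focus, so the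
  height of a particle undergoes a homothety centred at the focus with a negative ratio \<open>- l\<close>. The
  beam with \<open>-3 < z < -2\<close> is treated symmetrically, and the second mirror of one beam stands in the
  shadow of the first mirror of the other beam. Filling the space between the first mirror of
  a beam and the mirror in its shadow gives solid pieces of positive volume. All particles leave with
  velocity \<open>v0\<close> (\<open>orbit_through_device\<close>).

  If the focus lies on the plane \<open>z = 0\<close> and \<open>l = 1\<close>, the two beams are interchanged by the reflection
  \<open>z \<mapsto> - z\<close>: no trace, but not invisible. Two such devices in a row restore every trajectory: invisible.
  If \<open>l = 1/2\<close>, and the focus of the upper beam is at height \<open>-1\<close>, the beam \<open>2 < z < 3\<close> is compressed to
  \<open>-3 < z < -5/2\<close>, so that no particle with \<open>0 < y < 1\<close> leaves with \<open>2 < z < 5/2\<close>: the device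
  leaves a trace (\<open>leaves_trace_if_gap\<close>).

  The pieces are joined by a thin plate in the plane \<open>y = 0\<close>. All velocities that occur are parallel to
  this plane, hence particles with \<open>y \<noteq> 0\<close> never meet the plate, and connectedness costs nothing.

  Invisibility is a claim about every particle for which the scattering is defined, also about those in
  the null set of particles that run into an edge. These have no motion at all: at such an edge
  the surface lies on one side of a plane that it leaves at a positive angle, and such a point has no unit
  normal (\<open>not_unit_normal_if_one_sided\<close>, \<open>exceptional_not_scattering_defined\<close>).
\<close>

section \<open>Polynomial maps are smooth\<close>

lemma real_polynomial_function_derivative:
  fixes p :: "'a::euclidean_space \<Rightarrow> real"
  assumes "real_polynomial_function p"
  shows "\<exists>D. (\<forall>x. (p has_derivative D x) (at x)) \<and> (\<forall>h. real_polynomial_function (\<lambda>x. D x h))"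
  using assms
proof induction
  case (linear f)
  then show ?case
    by (intro exI[of _ "\<lambda>x. f"]) (auto simp: bounded_linear_imp_has_derivative)
next
  case (const c)
  then show ?case by (intro exI[of _ "\<lambda>x h. 0"]) auto
next
  case (add f g)
  then obtain D E where
    "\<And>x. (f has_derivative D x) (at x)" "\<And>h. real_polynomial_function (\<lambda>x. D x h)"
    "\<And>x. (g has_derivative E x) (at x)" "\<And>h. real_polynomial_function (\<lambda>x. E x h)"
    by blast
  then show ?case
    by (intro exI[of _ "\<lambda>x h. D x h + E x h"]) (auto intro!: has_derivative_add)
next
  case (mult f g)
  then obtain D E where DE:
    "\<And>x. (f has_derivative D x) (at x)" "\<And>h. real_polynomial_function (\<lambda>x. D x h)"
    "\<And>x. (g has_derivative E x) (at x)" "\<And>h. real_polynomial_function (\<lambda>x. E x h)"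
    by blast
  have "real_polynomial_function (\<lambda>x. f x * E x h + D x h * g x)" for h
    by (intro real_polynomial_function.intros(3,4) mult.hyps DE)
  then show ?case
    by (intro exI[of _ "\<lambda>x h. f x * E x h + D x h * g x"]) (use DE in \<open>auto intro!: has_derivative_mult\<close>)
qed

lemma polynomial_function_derivative:
  fixes p :: "'a::euclidean_space \<Rightarrow> 'b::euclidean_space"
  assumes "polynomial_function p"
  shows "\<exists>D. (\<forall>x. (p has_derivative D x) (at x)) \<and> (\<forall>h. polynomial_function (\<lambda>x. D x h))"
proof -
  have "\<forall>b\<in>Basis. \<exists>D. (\<forall>x. ((\<lambda>x. p x \<bullet> b) has_derivative D x) (at x)) \<and>
      (\<forall>h. real_polynomial_function (\<lambda>x. D x h))"
    using assms unfolding polynomial_function_iff_Basis_inner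
    by (intro ballI real_polynomial_function_derivative) auto
  then obtain D where D: "\<And>b x. b \<in> Basis \<Longrightarrow> ((\<lambda>x. p x \<bullet> b) has_derivative D b x) (at x)"
    "\<And>b h. b \<in> Basis \<Longrightarrow> real_polynomial_function (\<lambda>x. D b x h)"
    by metis
  show ?thesis
  proof (intro exI[of _ "\<lambda>x h. \<Sum>b\<in>Basis. D b x h *\<^sub>R b"] conjI allI)
    show "(p has_derivative (\<lambda>h. \<Sum>b\<in>Basis. D b x h *\<^sub>R b)) (at x)" for x
      unfolding has_derivative_componentwise_within[of p _ x UNIV]
      using D(1) by (simp add: inner_sum_left inner_Basis if_distrib sum.delta cong: if_cong)
    show "polynomial_function (\<lambda>x. \<Sum>b\<in>Basis. D b x h *\<^sub>R b)" for h
      unfolding polynomial_function_iff_Basis_inner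
      using D(2) by (simp add: inner_sum_left inner_Basis if_distrib sum.delta cong: if_cong)
  qed
qed

text \<open>
  Directional derivatives of polynomial maps are polynomial again, so induction on the order of
  differentiability needs no estimate.
\<close>

lemma smooth_on_polynomial_function:
  fixes p :: "'a::euclidean_space \<Rightarrow> 'b::euclidean_space"
  assumes "polynomial_function p"
  shows "smooth_on U p"
proof -
  have "Ck_on k p U" for k
    using assms
  proof (induction k arbitrary: p)
    case 0
    then show ?case by (simp add: continuous_on_polymonial_function)
  next
    case (Suc k)
    obtain D where D: "\<And>x. (p has_derivative D x) (at x)" "\<And>h. polynomial_function (\<lambda>x. D x h)"
      using polynomial_function_derivative[OF Suc.prems] by blast
    then have "frechet_derivative p (at x) = D x" for x
      using frechet_derivative_at by metis
    with D Suc.IH show ?case by (auto simp: differentiable_def)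
  qed
  then show ?thesis by (simp add: smooth_on_def)
qed

section \<open>Regular and singular points of surfaces\<close>

text \<open>
  Every direction orthogonal to the normal is approximated by points of the surface: on a short segment
  parallel to the normal, across the tangent plane, the defining function changes its sign.
\<close>

lemma unit_normal_tangent_approx:
  assumes n: "unit_normal S p n" and hn: "h \<bullet> n = 0" and e: "e > 0" and d: "d > 0"
  shows "\<exists>t q. 0 < t \<and> q \<in> S \<and> norm (q - p) < d \<and> norm (q - p - t *\<^sub>R h) \<le> e * t"
proof -
  obtain U and g :: "real^3 \<Rightarrow> real" and c where
    U: "open U" "p \<in> U" "smooth_on U g" "S \<inter> U = {y\<in>U. g y = 0}" "c \<noteq> 0"
       "(g has_derivative (\<lambda>h. c * (n \<bullet> h))) (at p)"
    and "p \<in> S" "norm n = 1"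
    using n unfolding unit_normal_def by blast
  have p0: "g p = 0" using U \<open>p \<in> S\<close> by blast
  have nn: "n \<bullet> n = 1" using \<open>norm n = 1\<close> by (simp add: norm_eq_1)
  have gc: "continuous_on U g" using U(3) unfolding smooth_on_def by (metis Ck_on.simps(1))
  define R where "R = norm h + e"
  have R: "R > 0" using e by (simp add: R_def add_nonneg_pos)
  define a where "a = \<bar>c\<bar> * e / (2 * R)"
  (* With this tolerance the linearisation error at distance t * R from p is half of the value
     that the linear part takes at the ends of the segment. *)
  have "a > 0" using U(5) e R by (auto simp: a_def)
  obtain r1 where r1: "r1 > 0"
    "\<And>y. norm (y - p) < r1 \<Longrightarrow> norm (g y - g p - c * (n \<bullet> (y - p))) \<le> a * norm (y - p)"
    using U(6) \<open>a > 0\<close> unfolding has_derivative_at_alt by blast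
  obtain r3 where r3: "r3 > 0" "ball p r3 \<subseteq> U"
    using U by (meson open_contains_ball)
  define t where "t = min r1 (min d r3) / (2 * R)"
  have t: "t > 0" using r1 d r3 R by (simp add: t_def)
  have tR: "t * R < r1" "t * R < d" "t * R < r3"
    using R r1 d r3 by (auto simp: t_def)
  define q where "q s = p + t *\<^sub>R (h + s *\<^sub>R n)" for s
  have q: "norm (q s - p) \<le> t * R" if "\<bar>s\<bar> \<le> e" for s
  proof -
    have "norm (h + s *\<^sub>R n) \<le> norm h + \<bar>s\<bar>"
      using norm_triangle_ineq[of h "s *\<^sub>R n"] \<open>norm n = 1\<close> by simp
    then have "norm (h + s *\<^sub>R n) \<le> R" using that by (simp add: R_def)
    then show ?thesis using t by (simp add: q_def)
  qed
  have qU: "q s \<in> U" if "\<bar>s\<bar> \<le> e" for s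
    using q[OF that] tR(3) r3(2) by (auto simp: dist_norm norm_minus_commute)
  have gq: "\<bar>c * g (q s) - c * c * t * s\<bar> \<le> c * c * t * e" if "\<bar>s\<bar> \<le> e" for s
  proof -
    have "n \<bullet> (q s - p) = t * s"
      using hn nn by (simp add: q_def inner_add_right inner_commute)
    then have "\<bar>g (q s) - c * t * s\<bar> \<le> a * norm (q s - p)"
      using r1(2)[of "q s"] q[OF that] tR p0 by (simp add: mult.assoc)
    also have "\<dots> \<le> a * (t * R)" using q[OF that] \<open>a > 0\<close> by simp
    also have "\<dots> = \<bar>c\<bar> * t * e / 2" using R by (simp add: a_def)
    also have "\<dots> \<le> \<bar>c\<bar> * t * e" using t e by simp
    finally have "\<bar>c\<bar> * \<bar>g (q s) - c * t * s\<bar> \<le> \<bar>c\<bar> * (\<bar>c\<bar> * t * e)"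
      by (rule mult_left_mono) simp
    then show ?thesis
      by (simp add: abs_mult[symmetric] right_diff_distrib mult.assoc[symmetric])
  qed
  have "continuous_on {-e..e} (\<lambda>s. c * g (q s))"
  proof (intro continuous_intros continuous_on_compose2[OF gc])
    show "continuous_on {-e..e} q" unfolding q_def by (intro continuous_intros)
    show "q ` {-e..e} \<subseteq> U" using qU by (auto simp: abs_le_iff)
  qed
  moreover have "c * g (q e) \<ge> 0" "c * g (q (-e)) \<le> 0"
    using gq[of e] gq[of "-e"] e by auto
  ultimately obtain s where s: "-e \<le> s" "s \<le> e" "c * g (q s) = 0"
    using IVT'[of "\<lambda>s. c * g (q s)" "-e" 0 e] e by auto
  then have se: "\<bar>s\<bar> \<le> e" and "g (q s) = 0" using U(5) by auto
  then have "q s \<in> S" using qU[OF se] U(4) by blast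
  moreover have "norm (q s - p) < d" using q[OF se] tR by simp
  moreover have "q s - p - t *\<^sub>R h = (t * s) *\<^sub>R n" by (simp add: q_def algebra_simps)
  then have "norm (q s - p - t *\<^sub>R h) \<le> e * t" using t se \<open>norm n = 1\<close> by (simp add: abs_mult)
  ultimately show ?thesis using t by blast
qed

lemma unit_normal_first_order:
  assumes "unit_normal S p n" and e: "e > 0"
  shows "\<exists>d>0. \<forall>q\<in>S. norm (q - p) < d \<longrightarrow> \<bar>n \<bullet> (q - p)\<bar> \<le> e * norm (q - p)"
proof -
  obtain U and g :: "real^3 \<Rightarrow> real" and c where
    U: "open U" "p \<in> U" "S \<inter> U = {y\<in>U. g y = 0}" "c \<noteq> 0"
       "(g has_derivative (\<lambda>h. c * (n \<bullet> h))) (at p)" and "p \<in> S"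
    using assms unfolding unit_normal_def by blast
  have p0: "g p = 0" using U \<open>p \<in> S\<close> by blast
  have "\<bar>c\<bar> * e > 0" using U e by simp
  then obtain r1 where r1: "r1 > 0"
    "\<And>y. norm (y - p) < r1 \<Longrightarrow> norm (g y - g p - c * (n \<bullet> (y - p))) \<le> \<bar>c\<bar> * e * norm (y - p)"
    using U(5) unfolding has_derivative_at_alt by blast
  obtain r2 where r2: "r2 > 0" "ball p r2 \<subseteq> U" using U by (meson open_contains_ball)
  have "\<bar>n \<bullet> (q - p)\<bar> \<le> e * norm (q - p)" if "q \<in> S" "norm (q - p) < min r1 r2" for q
  proof -
    have "q \<in> U" using that r2 by (auto simp: dist_norm norm_minus_commute)
    then have "g q = 0" using that U by blast
    then have "\<bar>c\<bar> * \<bar>n \<bullet> (q - p)\<bar> \<le> \<bar>c\<bar> * (e * norm (q - p))"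
      using r1(2)[of q] that p0 by (simp add: abs_mult mult.assoc)
    then show ?thesis using U(4) by simp
  qed
  then show ?thesis using r1 r2 by (intro exI[of _ "min r1 r2"]) auto
qed

text \<open>
  A criterion for singular points. At a regular point the tangent directions form a full plane; if the
  surface stays in the half-space given by \<open>m\<close>, this plane must be orthogonal to \<open>m\<close>. But then no points of
  the surface can leave the plane at a positive rate.
\<close>

lemma not_unit_normal_if_one_sided:
  assumes d: "d > 0" and side: "\<And>q. q \<in> S \<Longrightarrow> norm (q - p) < d \<Longrightarrow> 0 \<le> m \<bullet> (q - p)"
    and C: "C > 0"
    and leave: "\<And>d'. d' > 0 \<Longrightarrow> \<exists>q\<in>S. 0 < norm (q - p) \<and> norm (q - p) < d' \<and> C * norm (q - p) \<le> m \<bullet> (q - p)"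
  shows "\<not> unit_normal S p n"
proof
  assume n: "unit_normal S p n"
  have nn: "n \<bullet> n = 1" using n by (auto simp: unit_normal_def norm_eq_1)
  have nonneg: "0 \<le> m \<bullet> h" if h: "h \<bullet> n = 0" for h
  proof (rule ccontr)
    assume neg: "\<not> 0 \<le> m \<bullet> h"
    define e where "e = - (m \<bullet> h) / (2 * (norm m + 1))"
    have nm: "norm m + 1 > 0" by (simp add: add_nonneg_pos)
    have e: "e > 0" using neg nm unfolding e_def by (intro divide_pos_pos) auto
    obtain t q where tq: "0 < t" "q \<in> S" "norm (q - p) < d" "norm (q - p - t *\<^sub>R h) \<le> e * t"
      using unit_normal_tangent_approx[OF n h e d] by blast
    have "m \<bullet> (q - p - t *\<^sub>R h) \<le> norm m * norm (q - p - t *\<^sub>R h)" by (rule norm_cauchy_schwarz)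
    also have "\<dots> \<le> (norm m + 1) * (e * t)" using tq e by (intro mult_mono) auto
    also have "\<dots> = - (m \<bullet> h) * t / 2" using nm by (simp add: e_def field_simps)
    finally have "m \<bullet> (q - p) - t * (m \<bullet> h) \<le> - (m \<bullet> h) * t / 2" by (simp add: inner_diff_right)
    moreover have "t * (m \<bullet> h) < 0" using tq neg by (simp add: mult_pos_neg)
    ultimately have "m \<bullet> (q - p) < 0" by (simp add: mult.commute)
    then show False using side[OF tq(2,3)] by simp
  qed
  (* Both h and -h are tangent directions, so the part of m orthogonal to n vanishes. *)
  define h where "h = m - (m \<bullet> n) *\<^sub>R n"
  have hn: "h \<bullet> n = 0" using nn by (simp add: h_def inner_diff_left)
  then have "m \<bullet> h = 0" using nonneg[of h] nonneg[of "-h"] by simp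
  then have "h \<bullet> h = 0" using hn by (simp add: h_def inner_diff_left inner_diff_right inner_commute)
  then have m: "m = (m \<bullet> n) *\<^sub>R n" by (simp add: h_def)
  define e where "e = C / (2 * (\<bar>m \<bullet> n\<bar> + 1))"
  have e: "e > 0" using C by (simp add: e_def)
  obtain d' where d': "d' > 0" "\<And>q. q \<in> S \<Longrightarrow> norm (q - p) < d' \<Longrightarrow> \<bar>n \<bullet> (q - p)\<bar> \<le> e * norm (q - p)"
    using unit_normal_first_order[OF n e] by blast
  obtain q where q: "q \<in> S" "0 < norm (q - p)" "norm (q - p) < d'" "C * norm (q - p) \<le> m \<bullet> (q - p)"
    using leave[OF d'(1)] by blast
  have "m \<bullet> (q - p) = (m \<bullet> n) * (n \<bullet> (q - p))" by (subst m) simp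
  also have "\<dots> \<le> \<bar>m \<bullet> n\<bar> * \<bar>n \<bullet> (q - p)\<bar>" by (metis abs_ge_self abs_mult)
  also have "\<dots> \<le> (\<bar>m \<bullet> n\<bar> + 1) * (e * norm (q - p))" using d'(2)[OF q(1,3)] by (intro mult_mono) auto
  also have "\<dots> = C / 2 * norm (q - p)" by (simp add: e_def field_simps)
  finally have "C * norm (q - p) \<le> C / 2 * norm (q - p)" using q(4) by linarith
  then show False using C q(2) by simp
qed

section \<open>Billiard orbits\<close>

text \<open>
  The condition that a billiard motion has to satisfy at a single time. It is local in time, which allows
  motions to be glued together.
\<close>

definition moves_at :: "(real^3) set \<Rightarrow> (real \<Rightarrow> real^3) \<Rightarrow> (real \<Rightarrow> real^3) \<Rightarrow> real \<Rightarrow> bool" where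
  "moves_at B x v t \<longleftrightarrow> x t \<notin> interior B \<and>
       (\<exists>e>0. \<exists>u w.
          (\<forall>s\<in>{t-e<..<t}. x s \<notin> closure B \<and> x s = x t + (s - t) *\<^sub>R u \<and> v s = u) \<and>
          (\<forall>s\<in>{t<..<t+e}. x s \<notin> closure B \<and> x s = x t + (s - t) *\<^sub>R w \<and> v s = w) \<and>
          (if x t \<in> frontier B
           then \<exists>n. unit_normal (frontier B) (x t) n \<and> w = elastic_reflection n u
           else v t = u \<and> w = u))"

lemma billiard_motion_iff_moves_at: "billiard_motion B x v \<longleftrightarrow> (\<forall>t. moves_at B x v t)"
  by (simp add: billiard_motion_def moves_at_def)

lemma moves_atI_free:
  assumes r: "r > 0" and eq: "\<And>s. \<bar>s - t\<bar> < r \<Longrightarrow> x s = p + (s - a) *\<^sub>R u \<and> v s = u"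
    and out: "\<And>s. \<bar>s - t\<bar> < r \<Longrightarrow> p + (s - a) *\<^sub>R u \<notin> closure B"
  shows "moves_at B x v t"
proof -
  have t: "x t = p + (t - a) *\<^sub>R u" "v t = u" "x t \<notin> closure B"
    using eq[of t] out[of t] r by auto
  have s: "x s \<notin> closure B \<and> x s = x t + (s - t) *\<^sub>R u \<and> v s = u" if "\<bar>s - t\<bar> < r" for s
    using eq[OF that] out[OF that] t by (simp add: algebra_simps(1-5) scaleR_diff_left)
  have "x t \<notin> interior B" "x t \<notin> frontier B"
    using t(3) interior_subset closure_subset by (auto simp: frontier_def)
  have near: "\<forall>q\<in>I. x q \<notin> closure B \<and> x q = x t + (q - t) *\<^sub>R u \<and> v q = u"
    if "\<And>q. q \<in> I \<Longrightarrow> \<bar>q - t\<bar> < r" for I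
    using s that by blast
  show ?thesis
    unfolding moves_at_def
    by (intro conjI exI[of _ r] exI[of _ u] near) (use r \<open>x t \<notin> interior B\<close> \<open>x t \<notin> frontier B\<close> t(2) in auto)
qed

lemma moves_at_shift:
  assumes "moves_at B x' v' (t - a)" and r: "r > 0"
    and eq: "\<And>s. \<bar>s - t\<bar> < r \<Longrightarrow> x s = x' (s - a) \<and> v s = v' (s - a)"
  shows "moves_at B x v t"
proof -
  obtain e u w where e: "e > 0" 
    "\<forall>s\<in>{t-a-e<..<t-a}. x' s \<notin> closure B \<and> x' s = x' (t-a) + (s - (t-a)) *\<^sub>R u \<and> v' s = u"
    "\<forall>s\<in>{t-a<..<t-a+e}. x' s \<notin> closure B \<and> x' s = x' (t-a) + (s - (t-a)) *\<^sub>R w \<and> v' s = w"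
    "(if x' (t-a) \<in> frontier B
           then \<exists>n. unit_normal (frontier B) (x' (t-a)) n \<and> w = elastic_reflection n u
           else v' (t-a) = u \<and> w = u)" "x' (t-a) \<notin> interior B"
    using assms(1) unfolding moves_at_def by (elim exE conjE) (rule that)
  have t: "x t = x' (t - a)" "v t = v' (t - a)" using eq[of t] r by auto
  have 1: "x s \<notin> closure B \<and> x s = x t + (s - t) *\<^sub>R u \<and> v s = u" if "s \<in> {t - min e r<..<t}" for s
  proof -
    have "x s = x' (s - a) \<and> v s = v' (s - a)" using eq[of s] that by auto
    then show ?thesis using bspec[OF e(2), of "s - a"] that t by (auto simp: min_def split: if_splits)
  qed
  have 2: "x s \<notin> closure B \<and> x s = x t + (s - t) *\<^sub>R w \<and> v s = w" if "s \<in> {t<..<t + min e r}" for s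
  proof -
    have "x s = x' (s - a) \<and> v s = v' (s - a)" using eq[of s] that by auto
    then show ?thesis using bspec[OF e(3), of "s - a"] that t by (auto simp: min_def split: if_splits)
  qed
  show ?thesis
    unfolding moves_at_def
    by (intro conjI exI[of _ "min e r"] exI[of _ u] exI[of _ w] ballI 1 2) (use e(1,4,5) r t in simp_all)
qed

text \<open>
  \<open>orbit B p u p' v'\<close>: a particle that starts at \<open>p\<close> with velocity \<open>u\<close> undergoes finitely many
  reflections and then moves freely along the ray from \<open>p'\<close> with velocity \<open>v'\<close>. After a reflection the
  description resumes a little later, after a time \<open>\<sigma>\<close>, because orbits start off the body.
\<close>

inductive orbit :: "(real^3) set \<Rightarrow> real^3 \<Rightarrow> real^3 \<Rightarrow> real^3 \<Rightarrow> real^3 \<Rightarrow> bool" for B where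
  escape: "(\<forall>t\<ge>0. p + t *\<^sub>R u \<notin> closure B) \<Longrightarrow> orbit B p u p u"
| bounce: "0 < \<tau> \<Longrightarrow> (\<forall>t\<in>{0..<\<tau>}. p + t *\<^sub>R u \<notin> closure B) \<Longrightarrow>
    p + \<tau> *\<^sub>R u \<in> frontier B \<Longrightarrow>
    unit_normal (frontier B) (p + \<tau> *\<^sub>R u) n \<Longrightarrow> w = elastic_reflection n u \<Longrightarrow>
    0 < \<sigma> \<Longrightarrow> (\<forall>t\<in>{0<..\<sigma>}. p + \<tau> *\<^sub>R u + t *\<^sub>R w \<notin> closure B) \<Longrightarrow>
    orbit B (p + \<tau> *\<^sub>R u + \<sigma> *\<^sub>R w) w p' v' \<Longrightarrow> orbit B p u p' v'"

lemma orbit_start_outside: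
  assumes "orbit B p u p' v'"
  shows "p \<notin> closure B"
proof -
  have "p + 0 *\<^sub>R u \<notin> closure B"
    using assms
  proof (rule orbit.cases)
    fix q w assume "p = q" "u = w" "\<forall>t\<ge>0. q + t *\<^sub>R w \<notin> closure B"
    then show ?thesis by (metis order_refl)
  next
    fix \<tau> q w assume "p = q" "u = w" "0 < \<tau>" "\<forall>t\<in>{0..<\<tau>}. q + t *\<^sub>R w \<notin> closure B"
    then show ?thesis by (metis atLeastLessThan_iff order_refl)
  qed
  then show ?thesis by simp
qed

lemma exists_free_interval:
  fixes p u :: "real^3"
  assumes "p \<notin> closure B"
  shows "\<exists>r>0. \<forall>t. \<bar>t\<bar> < r \<longrightarrow> p + t *\<^sub>R u \<notin> closure B"
proof -
  have "open ((\<lambda>t. p + t *\<^sub>R u) -` (- closure B))"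
    by (intro open_vimage open_Compl closed_closure continuous_on_add continuous_on_scaleR
        continuous_on_const continuous_on_id)
  moreover have "0 \<in> (\<lambda>t. p + t *\<^sub>R u) -` (- closure B)" using assms by simp
  ultimately obtain r where "r > 0" "ball 0 r \<subseteq> (\<lambda>t. p + t *\<^sub>R u) -` (- closure B)"
    by (meson open_contains_ball)
  then show ?thesis by (intro exI[of _ r]) (auto simp: subset_iff)
qed

text \<open>
  An orbit is realised by a motion for all positive times, with the first segment prolonged to negative
  times. The motion after a reflection, shifted in time, is glued to the segment before it; its
  prolonged first segment covers the time between the reflection and the resumption of the orbit.
\<close>

lemma orbit_motion:
  assumes "orbit B p u p' v'"
  shows "\<exists>x v d a T. d > 0 \<and> (\<forall>t<d. x t = p + t *\<^sub>R u \<and> v t = u) \<and> (\<forall>t>0. moves_at B x v t) \<and>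
           (\<forall>t>T. x t = p' + (t - a) *\<^sub>R v' \<and> v t = v')"
  using assms
proof induction
  case (escape p u)
  have "moves_at B (\<lambda>t. p + t *\<^sub>R u) (\<lambda>_. u) t" if "t > 0" for t
    by (rule moves_atI_free[where r=t and p=p and a=0 and u=u]) (use that escape in \<open>auto simp: abs_less_iff\<close>)
  then show ?case
    by (intro exI[of _ "\<lambda>t. p + t *\<^sub>R u"] exI[of _ "\<lambda>_. u"] exI[of _ 1] exI[of _ 0] exI[of _ 0]) auto
next
  case (bounce \<tau> p u n w \<sigma> p' v')
  obtain y z d b T where yz: "d > 0" "\<And>t. t < d \<Longrightarrow> y t = p + \<tau> *\<^sub>R u + \<sigma> *\<^sub>R w + t *\<^sub>R w \<and> z t = w"
    "\<And>t. t > 0 \<Longrightarrow> moves_at B y z t" "\<And>t. t > T \<Longrightarrow> y t = p' + (t - b) *\<^sub>R v' \<and> z t = v'"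
    using bounce.IH by blast
  define a where "a = \<tau> + \<sigma>"
  define x where "x t = (if t < \<tau> then p + t *\<^sub>R u else y (t - a))" for t
  define v where "v t = (if t < \<tau> then u else z (t - a))" for t
  have early: "x t = p + t *\<^sub>R u \<and> v t = u" if "t < \<tau>" for t
    using that by (simp add: x_def v_def)
  have mid: "x t = p + \<tau> *\<^sub>R u + (t - \<tau>) *\<^sub>R w \<and> v t = w" if "\<tau> \<le> t" "t < a + d" for t
    using that yz(2)[of "t - a"] by (simp add: x_def v_def a_def algebra_simps)
  have late: "x t = y (t - a) \<and> v t = z (t - a)" if "\<tau> \<le> t" for t
    using that by (simp add: x_def v_def)
  have mv: "moves_at B x v t" if "t > 0" for t
  proof -
    consider "t < \<tau>" | "t = \<tau>" | "\<tau> < t" "t \<le> a" | "a < t" by linarith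
    then show ?thesis
    proof cases
      case 1
      show ?thesis
        by (rule moves_atI_free[where r="min t (\<tau> - t)" and p=p and a=0 and u=u])
           (use 1 that bspec[OF bounce.hyps(2)] early in \<open>auto simp: abs_less_iff\<close>)
    next
      case 2
      have xt: "x t = p + \<tau> *\<^sub>R u" using mid[of t] 2 bounce.hyps(1,6) yz(1) by (simp add: a_def)
      have l: "x s \<notin> closure B \<and> x s = x t + (s - t) *\<^sub>R u \<and> v s = u"
        if "s \<in> {t - \<tau><..<t}" for s
        using that early[of s] bspec[OF bounce.hyps(2), of s] xt 2 by (auto simp: algebra_simps)
      have r: "x s \<notin> closure B \<and> x s = x t + (s - t) *\<^sub>R w \<and> v s = w"
        if "s \<in> {t<..<t + \<sigma>}" for s
        using that mid[of s] bspec[OF bounce.hyps(7), of "s - \<tau>"] xt 2 yz(1) by (auto simp: a_def)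
      show ?thesis unfolding moves_at_def
        by (intro conjI exI[of _ "min \<tau> \<sigma>"] exI[of _ u] exI[of _ w] ballI l r)
           (use xt bounce.hyps(1,3-6) in \<open>auto simp: frontier_def\<close>)
    next
      case 3
      obtain r where r: "r > 0" "\<And>t. \<bar>t\<bar> < r \<Longrightarrow> p + \<tau> *\<^sub>R u + \<sigma> *\<^sub>R w + t *\<^sub>R w \<notin> closure B"
        using exists_free_interval[OF orbit_start_outside[OF bounce.hyps(8)]] by blast
      have out: "p + \<tau> *\<^sub>R u + (s - \<tau>) *\<^sub>R w \<notin> closure B" if "\<tau> < s" "s < a + r" for s
      proof (cases "s \<le> a")
        case True
        then show ?thesis using bspec[OF bounce.hyps(7), of "s - \<tau>"] that by (simp add: a_def)
      next
        case False
        have "(s - \<tau>) *\<^sub>R w = \<sigma> *\<^sub>R w + (s - a) *\<^sub>R w"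
          by (simp add: scaleR_add_left[symmetric] a_def)
        then show ?thesis using r(2)[of "s - a"] that False by (simp add: add.assoc)
      qed
      show ?thesis
        by (rule moves_atI_free[where r="min (t - \<tau>) (min r d)" and p="p + \<tau> *\<^sub>R u" and a=\<tau> and u=w])
           (use 3 out r mid yz(1) in \<open>auto simp: abs_less_iff\<close>)
    next
      case 4
      show ?thesis
        by (rule moves_at_shift[where r="t - \<tau>" and a=a, OF yz(3)])
           (use 4 late bounce.hyps(1,6) in \<open>auto simp: a_def abs_less_iff\<close>)
    qed
  qed
  have fin: "x t = p' + (t - (a + b)) *\<^sub>R v' \<and> v t = v'" if "t > max (T + a) \<tau>" for t
    using late[of t] yz(4)[of "t - a"] that by (auto simp: algebra_simps)
  show ?case
    by (intro exI[of _ x] exI[of _ v] exI[of _ \<tau>] exI[of _ "a + b"] exI[of _ "max (T + a) \<tau>"])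
       (use early mv fin bounce.hyps(1) in auto)
qed

lemma orbit_scatters:
  assumes o: "orbit B (x + t0 *\<^sub>R v) v p' v'" and out: "\<And>t. t \<le> t0 \<Longrightarrow> x + t *\<^sub>R v \<notin> closure B"
  shows "\<exists>T. scatters B x v (p' - T *\<^sub>R v') v'"
proof -
  obtain y z d a T where yz: "d > 0" "\<forall>t<d. y t = x + t0 *\<^sub>R v + t *\<^sub>R v \<and> z t = v"
    "\<forall>t>0. moves_at B y z t" "\<forall>t>T. y t = p' + (t - a) *\<^sub>R v' \<and> z t = v'"
    using orbit_motion[OF o] by (elim exE conjE) (rule that)
  obtain r where r: "r > 0" "\<And>t. \<bar>t\<bar> < r \<Longrightarrow> x + t0 *\<^sub>R v + t *\<^sub>R v \<notin> closure B"
    using exists_free_interval[OF orbit_start_outside[OF o]] by blast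
  have out': "x + t *\<^sub>R v \<notin> closure B" if "t < t0 + r" for t
    using out[of t] r(2)[of "t - t0"] that by (cases "t \<le> t0") (auto simp: scaleR_diff_left)
  have early: "y (t - t0) = x + t *\<^sub>R v \<and> z (t - t0) = v" if "t < t0 + d" for t
    using yz(2)[rule_format, of "t - t0"] that by (simp add: scaleR_diff_left)
  have "moves_at B (\<lambda>t. y (t - t0)) (\<lambda>t. z (t - t0)) t" for t
  proof (cases "t \<le> t0")
    case True
    show ?thesis
      by (rule moves_atI_free[where r="min r d" and p=x and a=0 and u=v])
         (use True early out' r yz(1) in \<open>auto simp: abs_less_iff\<close>)
  next
    case False
    show ?thesis
      by (rule moves_at_shift[where r=1 and a=t0, OF yz(3)[rule_format]]) (use False in auto)
  qed
  moreover have "y (t - t0) = p' - (t0 + a) *\<^sub>R v' + t *\<^sub>R v' \<and> z (t - t0) = v'" if "t > T + t0" for t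
    using yz(4)[rule_format, of "t - t0"] that by (simp add: algebra_simps)
  ultimately show ?thesis
    unfolding scatters_def billiard_motion_iff_moves_at
    using early by (intro exI[of _ "t0 + a"] exI[of _ "\<lambda>t. y (t - t0)"] exI[of _ "\<lambda>t. z (t - t0)"]
      exI[of _ "t0 + d"] exI[of _ "T + t0"]) auto
qed

text \<open>
  If the motion has followed a line before time \<open>T\<close>, continuity determines its position and incoming
  velocity at \<open>T\<close>.
\<close>

lemma moves_at_incoming:
  assumes "moves_at B \<xi> \<nu> T" and line: "\<And>s. s < T \<Longrightarrow> \<xi> s = x + s *\<^sub>R v"
  shows "\<xi> T = x + T *\<^sub>R v"
    and "\<xi> T \<in> frontier B \<Longrightarrow> \<exists>n. unit_normal (frontier B) (\<xi> T) n"
    and "\<xi> T \<notin> frontier B \<Longrightarrow> \<exists>r>0. \<forall>s<T + r. \<xi> s = x + s *\<^sub>R v"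
proof -
  obtain e u w where e0: "e > 0" and
    e1: "\<forall>s\<in>{T-e<..<T}. \<xi> s \<notin> closure B \<and> \<xi> s = \<xi> T + (s - T) *\<^sub>R u \<and> \<nu> s = u" and
    e2: "\<forall>s\<in>{T<..<T+e}. \<xi> s \<notin> closure B \<and> \<xi> s = \<xi> T + (s - T) *\<^sub>R w \<and> \<nu> s = w" and
    e3: "if \<xi> T \<in> frontier B
     then \<exists>n. unit_normal (frontier B) (\<xi> T) n \<and> w = elastic_reflection n u else \<nu> T = u \<and> w = u"
    using assms(1) unfolding moves_at_def by (elim exE conjE) (rule that)
  have e: "e > 0" "\<And>s. s \<in> {T-e<..<T} \<Longrightarrow> \<xi> s = \<xi> T + (s - T) *\<^sub>R u"
    "\<And>s. s \<in> {T<..<T+e} \<Longrightarrow> \<xi> s = \<xi> T + (s - T) *\<^sub>R w"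
    "\<xi> T \<notin> frontier B \<Longrightarrow> w = u"
    "\<xi> T \<in> frontier B \<Longrightarrow> \<exists>n. unit_normal (frontier B) (\<xi> T) n"
    using e0 e1 e2 e3 by auto
  have key: "\<xi> T - r *\<^sub>R u = x + T *\<^sub>R v - r *\<^sub>R v" if "0 < r" "r < e" for r
  proof -
    have "\<xi> T - r *\<^sub>R u = \<xi> (T - r)" using e(2)[of "T - r"] that by simp
    also have "\<dots> = x + (T - r) *\<^sub>R v" using line[of "T - r"] that by simp
    also have "\<dots> = x + T *\<^sub>R v - r *\<^sub>R v" by (simp add: scaleR_diff_left)
    finally show ?thesis .
  qed
  define y where "y = x + T *\<^sub>R v"
  have 1: "\<xi> T - (e/2) *\<^sub>R u = y - (e/2) *\<^sub>R v" and 2: "\<xi> T - (e/4) *\<^sub>R u = y - (e/4) *\<^sub>R v"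
    using key[of "e/2"] key[of "e/4"] e(1) by (simp_all add: y_def)
  have double: "2 *\<^sub>R (p - (e/4) *\<^sub>R q) - (p - (e/2) *\<^sub>R q) = p" for p q :: "real^3"
    by (simp add: scaleR_diff_right scaleR_2)
  have "\<xi> T = 2 *\<^sub>R (\<xi> T - (e/4) *\<^sub>R u) - (\<xi> T - (e/2) *\<^sub>R u)"
    by (rule double[symmetric])
  also have "\<dots> = y" unfolding 1 2 by (rule double)
  finally have *: "\<xi> T = y" .
  then show "\<xi> T = x + T *\<^sub>R v" by (simp add: y_def)
  have uv: "u = v" using 1 e(1) * by simp
  show "\<exists>n. unit_normal (frontier B) (\<xi> T) n" if "\<xi> T \<in> frontier B" using e(5) that by auto
  assume "\<xi> T \<notin> frontier B"
  then have w: "w = v" using e(4) uv by simp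
  have "\<xi> s = x + s *\<^sub>R v" if "s < T + e" for s
  proof (cases "s \<le> T")
    case True
    then show ?thesis using line[of s] * by (cases "s = T") (auto simp: y_def)
  next
    case False
    then show ?thesis using e(3)[of s] that w * by (simp add: y_def scaleR_diff_left)
  qed
  then show "\<exists>r>0. \<forall>s<T + r. \<xi> s = x + s *\<^sub>R v" using e(1) by blast
qed

text \<open>
  A particle whose first contact with the body is a singular point has no motion: up to the contact every
  motion has to follow the incoming line.
\<close>

lemma not_scattering_defined_if_singular_hit:
  assumes out: "\<And>t. t < \<tau> \<Longrightarrow> x + t *\<^sub>R v \<notin> closure B"
    and hit: "x + \<tau> *\<^sub>R v \<in> frontier B" and sing: "\<And>n. \<not> unit_normal (frontier B) (x + \<tau> *\<^sub>R v) n"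
  shows "\<not> scattering_defined B x v"
proof
  assume "scattering_defined B x v"
  then obtain x' v' where "scatters B x v x' v'" unfolding scattering_defined_def by blast
  then obtain \<xi> \<nu> t1 t2 where "\<forall>t. moves_at B \<xi> \<nu> t" "\<forall>t<t1. \<xi> t = x + t *\<^sub>R v \<and> \<nu> t = v"
      "\<forall>t>t2. \<xi> t = x' + t *\<^sub>R v' \<and> \<nu> t = v'"
    unfolding scatters_def billiard_motion_iff_moves_at by (elim exE conjE) (rule that)
  then have mv: "moves_at B \<xi> \<nu> t" and init: "t < t1 \<Longrightarrow> \<xi> t = x + t *\<^sub>R v" for t
    by simp_all
  have line: "\<xi> t = x + t *\<^sub>R v" if "t < \<tau>" for t
  proof (rule ccontr)
    assume ne: "\<xi> t \<noteq> x + t *\<^sub>R v"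
    (* The motion is on the line up to the infimum T of D, and by moves_at_incoming beyond T. *)
    define D where "D = {t. t < \<tau> \<and> \<xi> t \<noteq> x + t *\<^sub>R v}"
    have tD: "t \<in> D" using ne that by (simp add: D_def)
    have bdd: "bdd_below D"
      unfolding bdd_below_def using init by (intro exI[of _ t1]) (force simp: D_def)
    define T where "T = Inf D"
    have T: "T < \<tau>" using cInf_lower[OF tD bdd] that by (simp add: T_def)
    have before: "\<xi> s = x + s *\<^sub>R v" if "s < T" for s
      using that T cInf_lower[OF _ bdd, of s] unfolding T_def D_def by force
    have "\<xi> T \<notin> frontier B"
      using out[OF T] moves_at_incoming(1)[OF mv before] by (simp add: frontier_def)
    then obtain r where r: "r > 0" "\<And>s. s < T + r \<Longrightarrow> \<xi> s = x + s *\<^sub>R v"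
      using moves_at_incoming(3)[OF mv before] by blast
    have "T + r \<le> Inf D"
      using tD r(2) by (intro cInf_greatest) (auto simp: D_def not_less[symmetric])
    then show False using r by (simp add: T_def)
  qed
  then show False
    using moves_at_incoming(1,2)[OF mv line] hit sing by metis
qed

section \<open>Surfaces assembled from patches\<close>

lemma polynomial_function_componentwise:
  fixes f :: "'a::euclidean_space \<Rightarrow> real^'n"
  assumes "\<And>j. real_polynomial_function (\<lambda>x. f x $ j)"
  shows "polynomial_function f"
  unfolding polynomial_function_iff_Basis_inner
  using assms by (auto simp: Basis_vec_def inner_axis)

lemma real_polynomial_function_nth: "real_polynomial_function (\<lambda>x::real^'n. x $ i)"
  by (intro real_polynomial_function.intros(1) bounded_linear_vec_nth)

lemma surface_patch_if_embedding:
  assumes "polytope K" "interior K \<noteq> {}" and poly: "polynomial_function \<phi>" and inj: "inj_on \<phi> K"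
    and der: "\<And>u. u \<in> K \<Longrightarrow> \<exists>D. (\<phi> has_derivative D) (at u) \<and> inj D"
  shows "surface_patch K \<phi>"
proof -
  have "inj (frechet_derivative \<phi> (at u))" if "u \<in> interior K" for u
    using der[of u] that interior_subset frechet_derivative_at by (metis subsetD)
  moreover have "u = w" if "u \<in> interior K" "w \<in> K" "\<phi> u = \<phi> w" for u w
    using inj_onD[OF inj] that interior_subset by blast
  ultimately show ?thesis
    unfolding surface_patch_def using assms(1,2) smooth_on_polynomial_function[OF poly]
    by (intro conjI exI[of _ UNIV]) auto
qed

text \<open>
  A piecewise smooth surface \<open>S\<close> together with the union \<open>R\<close> of the images of the patch interiors. Keeping
  track of \<open>R\<close> makes it possible to join surfaces that touch along edges.
\<close>

definition tiled_surface :: "(real^3) set \<Rightarrow> (real^3) set \<Rightarrow> bool" where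
  "tiled_surface S R \<longleftrightarrow>
     (\<exists>P. finite P \<and> (\<forall>(K, \<phi>)\<in>P. surface_patch K \<phi>) \<and>
          S = (\<Union>(K, \<phi>)\<in>P. \<phi> ` K) \<and> R = (\<Union>(K, \<phi>)\<in>P. \<phi> ` interior K) \<and>
          (\<forall>(K, \<phi>)\<in>P. \<forall>(L, \<psi>)\<in>P. (K, \<phi>) \<noteq> (L, \<psi>) \<longrightarrow> \<phi> ` interior K \<inter> \<psi> ` L = {}))"

lemma piecewise_smooth_surface_if_tiled: "tiled_surface S R \<Longrightarrow> piecewise_smooth_surface S"
  unfolding tiled_surface_def piecewise_smooth_surface_def by (elim exE conjE) (intro exI conjI)

lemma tiled_surface_subset: "tiled_surface S R \<Longrightarrow> R \<subseteq> S"
  unfolding tiled_surface_def using interior_subset by fastforce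

lemma tiled_surface_single:
  assumes "surface_patch K \<phi>" shows "tiled_surface (\<phi> ` K) (\<phi> ` interior K)"
  unfolding tiled_surface_def by (intro exI[of _ "{(K, \<phi>)}"]) (use assms in auto)

lemma tiled_surface_Un:
  assumes "tiled_surface S R" "tiled_surface S' R'" "R \<inter> S' = {}" "R' \<inter> S = {}"
  shows "tiled_surface (S \<union> S') (R \<union> R')"
proof -
  obtain P where P: "finite P" "\<forall>(K, \<phi>)\<in>P. surface_patch K \<phi>"
    "S = (\<Union>(K, \<phi>)\<in>P. \<phi> ` K)" "R = (\<Union>(K, \<phi>)\<in>P. \<phi> ` interior K)"
    "\<forall>(K, \<phi>)\<in>P. \<forall>(L, \<psi>)\<in>P. (K, \<phi>) \<noteq> (L, \<psi>) \<longrightarrow> \<phi> ` interior K \<inter> \<psi> ` L = {}"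
    using assms(1) unfolding tiled_surface_def by (elim exE conjE) (rule that)
  obtain Q where Q: "finite Q" "\<forall>(K, \<phi>)\<in>Q. surface_patch K \<phi>"
    "S' = (\<Union>(K, \<phi>)\<in>Q. \<phi> ` K)" "R' = (\<Union>(K, \<phi>)\<in>Q. \<phi> ` interior K)"
    "\<forall>(K, \<phi>)\<in>Q. \<forall>(L, \<psi>)\<in>Q. (K, \<phi>) \<noteq> (L, \<psi>) \<longrightarrow> \<phi> ` interior K \<inter> \<psi> ` L = {}"
    using assms(2) unfolding tiled_surface_def by (elim exE conjE) (rule that)
  have PP: "\<phi> ` interior K \<inter> \<psi> ` L = {}"
    if "(K, \<phi>) \<in> P" "(L, \<psi>) \<in> P" "(K, \<phi>) \<noteq> (L, \<psi>)" for K \<phi> L \<psi>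
    using bspec[OF bspec[OF P(5) that(1), unfolded prod.case] that(2)] that(3) by simp
  have QQ: "\<phi> ` interior K \<inter> \<psi> ` L = {}"
    if "(K, \<phi>) \<in> Q" "(L, \<psi>) \<in> Q" "(K, \<phi>) \<noteq> (L, \<psi>)" for K \<phi> L \<psi>
    using bspec[OF bspec[OF Q(5) that(1), unfolded prod.case] that(2)] that(3) by simp
  have PQ: "\<phi> ` interior K \<inter> \<psi> ` L = {}" if "(K, \<phi>) \<in> P" "(L, \<psi>) \<in> Q" for K \<phi> L \<psi>
  proof -
    have "\<phi> ` interior K \<subseteq> R" "\<psi> ` L \<subseteq> S'" using that P(4) Q(3) by force+
    then show ?thesis using assms(3) by blast
  qed
  have QP: "\<phi> ` interior K \<inter> \<psi> ` L = {}" if "(K, \<phi>) \<in> Q" "(L, \<psi>) \<in> P" for K \<phi> L \<psi>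
  proof -
    have "\<phi> ` interior K \<subseteq> R'" "\<psi> ` L \<subseteq> S" using that Q(4) P(3) by force+
    then show ?thesis using assms(4) by blast
  qed
  have sep: "\<phi> ` interior K \<inter> \<psi> ` L = {}"
    if "(K, \<phi>) \<in> P \<union> Q" "(L, \<psi>) \<in> P \<union> Q" "(K, \<phi>) \<noteq> (L, \<psi>)" for K \<phi> L \<psi>
    using that(1,2) PP[OF _ _ that(3)] PQ QP QQ[OF _ _ that(3)] by blast
  show ?thesis
    unfolding tiled_surface_def
  proof (intro exI[of _ "P \<union> Q"] conjI)
    show "\<forall>(K, \<phi>)\<in>P \<union> Q. \<forall>(L, \<psi>)\<in>P \<union> Q. (K, \<phi>) \<noteq> (L, \<psi>) \<longrightarrow> \<phi> ` interior K \<inter> \<psi> ` L = {}"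
      using sep by (intro ballI case_prodI2 impI) blast
  qed (use P(1-4) Q(1-4) in auto)
qed

lemma tiled_surface_UN:
  assumes "finite I" "\<And>i. i \<in> I \<Longrightarrow> tiled_surface (S i) (R i)"
    "\<And>i j. i \<in> I \<Longrightarrow> j \<in> I \<Longrightarrow> i \<noteq> j \<Longrightarrow> S i \<inter> S j = {}"
  shows "tiled_surface (\<Union>i\<in>I. S i) (\<Union>i\<in>I. R i)"
  using assms
proof (induction I)
  case empty
  show ?case unfolding tiled_surface_def by (intro exI[of _ "{}"]) auto
next
  case (insert i I)
  have "R j \<subseteq> S j" if "j \<in> insert i I" for j
    using tiled_surface_subset insert.prems(1)[OF that] .
  moreover have "S i \<inter> S j = {}" if "j \<in> I" for j
    using insert.prems(2)[of i j] that insert.hyps by auto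
  ultimately have "tiled_surface (S i \<union> (\<Union>i\<in>I. S i)) (R i \<union> (\<Union>i\<in>I. R i))"
    using insert by (intro tiled_surface_Un insert.IH insert.prems) blast+
  then show ?case by simp
qed

text \<open>
  The unit square as the face of the unit cube where the \<open>i\<close>-th coordinate is \<open>c\<close>; the other two
  coordinates are taken in increasing order.
\<close>

definition square_to_face :: "3 \<Rightarrow> real \<Rightarrow> real^2 \<Rightarrow> real^3" where
  "square_to_face i c u = (\<chi> j. if j = i then c else if j = (if i = 1 then 2 else 1) then u $ 1 else u $ 2)"

lemma square_to_face_simps:
  "square_to_face 1 c u = vector [c, u $ 1, u $ 2]"
  "square_to_face 2 c u = vector [u $ 1, c, u $ 2]"
  "square_to_face 3 c u = vector [u $ 1, u $ 2, c]"
  by (simp_all add: square_to_face_def vec_eq_iff forall_3)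

lemma mem_unit_cube: "w \<in> cbox 0 (1::real^'n) \<longleftrightarrow> (\<forall>i. 0 \<le> w $ i \<and> w $ i \<le> 1)"
  by (simp add: mem_box_cart)

lemma square_to_face_nth [simp]: "square_to_face i c u $ i = c"
  by (simp add: square_to_face_def)

lemma image_square_to_face:
  assumes "c = 0 \<or> c = 1"
  shows "square_to_face i c ` cbox 0 1 = {w \<in> cbox 0 1. w $ i = c}" (is "?L = ?R")
proof
  show "?L \<subseteq> ?R"
    using assms by (auto simp: mem_unit_cube square_to_face_def)
  show "?R \<subseteq> ?L"
  proof
    fix w assume w: "w \<in> ?R"
    define a where "a = (if i = 1 then 2 else 1 :: 3)"
    define b where "b = (if i = 3 then 2 else 3 :: 3)"
    have "w = square_to_face i c (vector [w $ a, w $ b])"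
      using exhaust_3[of i] w by (auto simp: a_def b_def square_to_face_simps vec_eq_iff forall_3)
    moreover have "vector [w $ a, w $ b] \<in> cbox 0 (1::real^2)"
      using w by (simp add: mem_unit_cube forall_2)
    ultimately show "w \<in> ?L" by blast
  qed
qed

lemma square_to_face_interior:
  assumes "u \<in> interior (cbox 0 1)" "j \<noteq> i"
  shows "0 < square_to_face i c u $ j \<and> square_to_face i c u $ j < 1"
  using assms by (auto simp: square_to_face_def interior_cbox mem_box_cart)

lemma inj_square_to_face: "inj (square_to_face i c)"
  using exhaust_3[of i]
  by (auto intro!: injI simp: square_to_face_simps vec_eq_iff forall_2 forall_3)

lemma polynomial_function_square_to_face: "polynomial_function (square_to_face i c)"
proof (rule polynomial_function_componentwise)
  show "real_polynomial_function (\<lambda>u. square_to_face i c u $ j)" for j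
    by (cases "j = i"; cases "j = (if i = 1 then 2 else 1)")
       (simp_all add: square_to_face_def real_polynomial_function_nth real_polynomial_function.intros(2))
qed

lemma has_derivative_square_to_face: "(square_to_face i c has_derivative square_to_face i 0) (at u)"
proof -
  have "linear (square_to_face i 0)"
    by (rule linearI) (auto simp: square_to_face_def vec_eq_iff)
  then have "(square_to_face i 0 has_derivative square_to_face i 0) (at u)"
    by (rule linear_imp_has_derivative)
  then have "((\<lambda>u. axis i c + square_to_face i 0 u) has_derivative square_to_face i 0) (at u)"
    using has_derivative_add[OF has_derivative_const] by fastforce
  moreover have "(\<lambda>u. axis i c + square_to_face i 0 u) = square_to_face i c"
    by (auto simp: square_to_face_def axis_def vec_eq_iff fun_eq_iff)
  ultimately show ?thesis by simp
qed

text \<open>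
  The boundary of a curved cube is tiled by the images of the six faces. A point in the interior of a
  face has only one extreme coordinate, therefore it lies on no other face.
\<close>

lemma tiled_surface_cube_image:
  fixes \<Phi> :: "real^3 \<Rightarrow> real^3"
  assumes poly: "polynomial_function \<Phi>" and inj: "inj_on \<Phi> (cbox 0 1)"
    and der: "\<And>w. w \<in> cbox 0 1 \<Longrightarrow> \<exists>D. (\<Phi> has_derivative D) (at w) \<and> inj D"
  shows "tiled_surface (\<Phi> ` {w \<in> cbox 0 1. \<exists>i. w $ i = 0 \<or> w $ i = 1})
           (\<Phi> ` {w \<in> cbox 0 1. \<exists>i. (w $ i = 0 \<or> w $ i = 1) \<and> (\<forall>j. j \<noteq> i \<longrightarrow> 0 < w $ j \<and> w $ j < 1)})"
    (is "tiled_surface ?S ?R")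
proof -
  let ?sq = "cbox 0 1 :: (real^2) set"
  let ?I = "UNIV \<times> {0, 1} :: (3 \<times> real) set"
  define f where "f = (\<lambda>(i, c) u. \<Phi> (square_to_face i c u))"
  define P where "P = (\<lambda>q. (?sq, f q)) ` ?I"
  have cube: "square_to_face i c u \<in> cbox 0 1" if "u \<in> ?sq" "(i, c) \<in> ?I" for i c u
    using image_square_to_face[of c i] that by blast
  have sub: "interior ?sq \<subseteq> ?sq" by (rule interior_subset)
  have patch: "surface_patch ?sq (f (i, c))" if ic: "(i, c) \<in> ?I" for i c
  proof (rule surface_patch_if_embedding)
    have "(1/2) *\<^sub>R 1 \<in> box 0 (1::real^2)" by (simp add: mem_box_cart)
    then show "interior ?sq \<noteq> {}" by (metis empty_iff interior_cbox)
    show "polynomial_function (f (i, c))"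
      using polynomial_function_compose[OF polynomial_function_square_to_face poly, of i c]
      by (simp add: f_def comp_def)
    show "inj_on (f (i, c)) ?sq"
    proof (rule inj_onI)
      fix u v assume "u \<in> ?sq" "v \<in> ?sq" "f (i, c) u = f (i, c) v"
      then have "square_to_face i c u = square_to_face i c v"
        using inj_onD[OF inj] cube ic by (simp add: f_def)
      then show "u = v" by (rule injD[OF inj_square_to_face])
    qed
    show "\<exists>D. (f (i, c) has_derivative D) (at u) \<and> inj D" if u: "u \<in> ?sq" for u
    proof -
      obtain D where D: "(\<Phi> has_derivative D) (at (square_to_face i c u))" "inj D"
        using der[OF cube[OF u ic]] by blast
      have "(f (i, c) has_derivative (\<lambda>h. D (square_to_face i 0 h))) (at u)"
        unfolding f_def using has_derivative_compose[OF has_derivative_square_to_face D(1)] by simp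
      moreover have "inj (\<lambda>h. D (square_to_face i 0 h))"
        using inj_compose[OF D(2) inj_square_to_face] by (simp add: comp_def)
      ultimately show ?thesis by blast
    qed
  qed (rule polytope_interval)
  have S: "?S = (\<Union>q\<in>?I. f q ` ?sq)"
  proof -
    have "(\<Union>q\<in>?I. f q ` ?sq) = \<Phi> ` (\<Union>(i, c)\<in>?I. square_to_face i c ` ?sq)"
      by (auto simp: f_def)
    also have "(\<Union>(i, c)\<in>?I. square_to_face i c ` ?sq) = {w \<in> cbox 0 1. \<exists>i. w $ i = 0 \<or> w $ i = 1}"
    proof -
      have "(\<Union>(i, c)\<in>?I. square_to_face i c ` ?sq) =
          (\<Union>i. square_to_face i 0 ` ?sq) \<union> (\<Union>i. square_to_face i 1 ` ?sq)"
        by auto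
      also have "\<dots> = (\<Union>i. {w \<in> cbox 0 1. w $ i = 0}) \<union> (\<Union>i. {w \<in> cbox 0 1. w $ i = 1})"
        by (simp only: image_square_to_face simp_thms)
      finally show ?thesis by auto
    qed
    finally show ?thesis by simp
  qed
  have edge: "w = square_to_face j d u \<Longrightarrow> (i, c) = (j, d)"
    if "(i, c) \<in> ?I" "(j, d) \<in> ?I" "w = square_to_face i c v" "v \<in> interior ?sq" for i c j d u v w
    using that square_to_face_interior[OF that(4), of j i c] square_to_face_nth[of i c v]
      square_to_face_nth[of j d u] by (cases "j = i") (auto split: if_splits)
  have R: "?R = (\<Union>q\<in>?I. f q ` interior ?sq)"
  proof -
    have "(\<Union>q\<in>?I. f q ` interior ?sq) = \<Phi> ` (\<Union>(i, c)\<in>?I. square_to_face i c ` interior ?sq)"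
      by (auto simp: f_def)
    also have "(\<Union>(i, c)\<in>?I. square_to_face i c ` interior ?sq) =
        {w \<in> cbox 0 1. \<exists>i. (w $ i = 0 \<or> w $ i = 1) \<and> (\<forall>j. j \<noteq> i \<longrightarrow> 0 < w $ j \<and> w $ j < 1)}" (is "?A = ?B")
    proof
      show "?A \<subseteq> ?B"
      proof
        fix w assume "w \<in> ?A"
        then obtain i c v where ic: "(i, c) \<in> ?I" "v \<in> interior ?sq" "w = square_to_face i c v" by blast
        then show "w \<in> ?B"
          using cube[of v i c] sub square_to_face_interior[OF ic(2), of _ i c]
          by (intro CollectI conjI exI[of _ i]) auto
      qed
      show "?B \<subseteq> ?A"
      proof
        fix w assume "w \<in> ?B"
        then obtain i c where w: "w \<in> cbox 0 1" "w $ i = c" "(i, c) \<in> ?I"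
          "\<And>j. j \<noteq> i \<Longrightarrow> 0 < w $ j \<and> w $ j < 1" by force
        then obtain v where v: "v \<in> ?sq" "w = square_to_face i c v"
          using image_square_to_face[of c i] by blast
        define a where "a = (if i = 1 then 2 else 1 :: 3)"
        define b where "b = (if i = 3 then 2 else 3 :: 3)"
        have "v $ 1 = w $ a" "v $ 2 = w $ b" "a \<noteq> i" "b \<noteq> i"
          using exhaust_3[of i] unfolding v(2) by (auto simp: a_def b_def square_to_face_simps)
        then have "v \<in> interior ?sq"
          using w(4)[of a] w(4)[of b] by (simp add: interior_cbox mem_box_cart forall_2)
        then show "w \<in> ?A" using v w by blast
      qed
    qed
    finally show ?thesis by simp
  qed
  show ?thesis
    unfolding tiled_surface_def
  proof (intro exI[of _ P] conjI)
    show "finite P" by (simp add: P_def)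
    show "\<forall>(K, \<phi>)\<in>P. surface_patch K \<phi>" using patch by (auto simp: P_def)
    show "?S = (\<Union>(K, \<phi>)\<in>P. \<phi> ` K)" unfolding S P_def by simp
    show "?R = (\<Union>(K, \<phi>)\<in>P. \<phi> ` interior K)" unfolding R P_def by simp
    have disj: "f (i, c) ` interior ?sq \<inter> f (j, d) ` ?sq = {}"
      if ic: "(i, c) \<in> ?I" "(j, d) \<in> ?I" "(i, c) \<noteq> (j, d)" for i c j d
    proof (rule ccontr)
      assume "f (i, c) ` interior ?sq \<inter> f (j, d) ` ?sq \<noteq> {}"
      then obtain v u where vu: "v \<in> interior ?sq" "u \<in> ?sq"
        "\<Phi> (square_to_face i c v) = \<Phi> (square_to_face j d u)" by (auto simp: f_def)
      then have "square_to_face i c v = square_to_face j d u"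
        using inj_onD[OF inj] cube ic sub by blast
      then show False using edge[OF ic(1,2) refl vu(1)] ic(3) by simp
    qed
    have "\<phi> ` interior K \<inter> \<psi> ` L = {}"
      if P: "(K, \<phi>) \<in> P" "(L, \<psi>) \<in> P" "(K, \<phi>) \<noteq> (L, \<psi>)" for K \<phi> L \<psi>
    proof -
      obtain i c where 1: "(i, c) \<in> ?I" "K = ?sq" "\<phi> = f (i, c)" using P(1) unfolding P_def by blast
      obtain j d where 2: "(j, d) \<in> ?I" "L = ?sq" "\<psi> = f (j, d)" using P(2) unfolding P_def by blast
      have "(i, c) \<noteq> (j, d)" using P(3) 1 2 by auto
      then show ?thesis using disj[OF 1(1) 2(1)] 1 2 by simp
    qed
    then show "\<forall>(K, \<phi>)\<in>P. \<forall>(L, \<psi>)\<in>P. (K, \<phi>) \<noteq> (L, \<psi>) \<longrightarrow> \<phi> ` interior K \<inter> \<psi> ` L = {}"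
      by (intro ballI case_prodI2 impI) blast
  qed
qed

section \<open>The body\<close>

lemma interior_Un_disjoint_closed:
  fixes S T :: "'a::topological_space set"
  assumes "closed S" "closed T" "S \<inter> T = {}"
  shows "interior (S \<union> T) = interior S \<union> interior T"
proof
  show "interior S \<union> interior T \<subseteq> interior (S \<union> T)" by (simp add: interior_mono)
  have "interior (S \<union> T) \<inter> - T \<subseteq> interior S" "interior (S \<union> T) \<inter> - S \<subseteq> interior T"
    using assms interior_subset by (intro interior_maximal; force)+
  then show "interior (S \<union> T) \<subseteq> interior S \<union> interior T"
    using assms(3) by blast
qed

lemma interior_UN_disjoint_closed:
  fixes S :: "'i \<Rightarrow> 'a::topological_space set"
  assumes "finite I" "\<And>i. i \<in> I \<Longrightarrow> closed (S i)"
    "\<And>i j. i \<in> I \<Longrightarrow> j \<in> I \<Longrightarrow> i \<noteq> j \<Longrightarrow> S i \<inter> S j = {}"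
  shows "interior (\<Union>i\<in>I. S i) = (\<Union>i\<in>I. interior (S i))"
  using assms
proof (induction I)
  case (insert i I)
  have "S i \<inter> (\<Union>j\<in>I. S j) = {}" using insert.prems(2)[of i] insert.hyps by auto
  moreover have "closed (\<Union>j\<in>I. S j)" using insert by auto
  ultimately show ?case using insert interior_Un_disjoint_closed[of "S i" "\<Union>j\<in>I. S j"] by auto
qed simp

lemma not_interior_if_ray_outside:
  fixes p m :: "'a::real_normed_vector"
  assumes "\<And>s. s > 0 \<Longrightarrow> p + s *\<^sub>R m \<notin> S"
  shows "p \<notin> interior S"
proof
  assume "p \<in> interior S"
  then obtain r where r: "r > 0" "ball p r \<subseteq> S" by (meson mem_interior)
  define N where "N = norm m + 1"
  define s where "s = r / (2 * N)"
  have "N > 0" by (simp add: N_def add_nonneg_pos)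
  then have s: "s > 0" "s * N = r / 2" using r(1) by (simp_all add: s_def)
  then have "s * norm m < r" using r(1) by (simp add: N_def distrib_left)
  then have "p + s *\<^sub>R m \<in> ball p r" using s(1) by (simp add: dist_norm)
  then show False using assms[OF s(1)] r by blast
qed

lemma elastic_reflection_involution:
  assumes "norm n = 1" shows "elastic_reflection n (elastic_reflection n v) = v"
  using assms by (simp add: elastic_reflection_def inner_diff_left norm_eq_1 algebra_simps)

text \<open>
  Orthonormal coordinates. The particles arrive with velocity \<open>e\<close>.
\<close>

locale frame =
  fixes e f k :: "real^3"
  assumes unit [simp]: "e \<bullet> e = 1" "f \<bullet> f = 1" "k \<bullet> k = 1"
    and orth [simp]: "e \<bullet> f = 0" "e \<bullet> k = 0" "f \<bullet> e = 0" "f \<bullet> k = 0" "k \<bullet> e = 0" "k \<bullet> f = 0"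
    and expand: "p = (p \<bullet> e) *\<^sub>R e + (p \<bullet> f) *\<^sub>R f + (p \<bullet> k) *\<^sub>R k"
begin

definition pt :: "real \<Rightarrow> real \<Rightarrow> real \<Rightarrow> real^3" where
  "pt x y z = x *\<^sub>R e + y *\<^sub>R f + z *\<^sub>R k"

lemma pt_inner [simp]: "pt x y z \<bullet> e = x" "pt x y z \<bullet> f = y" "pt x y z \<bullet> k = z"
  by (simp_all add: pt_def inner_add_left)

lemma pt_coords [simp]: "pt (p \<bullet> e) (p \<bullet> f) (p \<bullet> k) = p"
  using expand[of p] by (simp add: pt_def)

lemma pt_cases: obtains x y z where "p = pt x y z"
  using pt_coords by metis

lemma pt_eq_iff [simp]: "pt x y z = pt x' y' z' \<longleftrightarrow> x = x' \<and> y = y' \<and> z = z'"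
  by (metis pt_inner)

lemma pt_add: "pt x y z + pt x' y' z' = pt (x + x') (y + y') (z + z')"
  by (simp add: pt_def scaleR_add_left)

lemma pt_diff: "pt x y z - pt x' y' z' = pt (x - x') (y - y') (z - z')"
  by (simp add: pt_def scaleR_diff_left)

lemma pt_scaleR: "t *\<^sub>R pt x y z = pt (t * x) (t * y) (t * z)"
  by (simp add: pt_def scaleR_add_right)

lemma e_eq_pt: "e = pt 1 0 0"
  by (simp add: pt_def)

lemma pt_add_e: "pt x y z + t *\<^sub>R e = pt (x + t) y z"
  by (simp add: pt_def scaleR_add_left)

lemma inner_pt: "pt x y z \<bullet> pt x' y' z' = x * x' + y * y' + z * z'"
  by (simp add: pt_def[of x'] inner_add_right)

lemma norm_pt: "norm (pt x y z) = sqrt (x\<^sup>2 + y\<^sup>2 + z\<^sup>2)"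
  by (simp add: norm_eq_sqrt_inner inner_pt power2_eq_square)

lemma norm_pt_le: "norm (pt x y z) \<le> \<bar>x\<bar> + \<bar>y\<bar> + \<bar>z\<bar>"
proof -
  have "norm e = 1" "norm f = 1" "norm k = 1" by (simp_all add: norm_eq_1)
  then show ?thesis
    unfolding pt_def by (intro norm_triangle_le add_mono) auto
qed

lemma coord_le_norm: "\<bar>p \<bullet> e\<bar> \<le> norm p" "\<bar>p \<bullet> f\<bar> \<le> norm p" "\<bar>p \<bullet> k\<bar> \<le> norm p"
proof -
  have "norm e = 1" "norm f = 1" "norm k = 1" by (simp_all add: norm_eq_1)
  then show "\<bar>p \<bullet> e\<bar> \<le> norm p" "\<bar>p \<bullet> f\<bar> \<le> norm p" "\<bar>p \<bullet> k\<bar> \<le> norm p"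
    using Cauchy_Schwarz_ineq2[of p] by (metis mult.right_neutral)+
qed

lemma polynomial_function_pt:
  assumes "real_polynomial_function a" "real_polynomial_function b" "real_polynomial_function c"
  shows "polynomial_function (\<lambda>x. pt (a x) (b x) (c x))"
  unfolding pt_def
  using assms by (intro polynomial_function_add polynomial_function_mult)
    (auto simp: real_polynomial_function_eq)

end

text \<open>
  The parameters of the mirrors: for the beam with \<open>2 < z < 3\<close> the focus is at height \<open>- c\<close>, and \<open>- l\<close> is
  the ratio of the homothety. The set \<open>D\<close> contains the \<open>x\<close>-coordinates of the foci of the copies
  of the device. The condition \<open>cl\<close> makes the second mirrors lie behind the foci, \<open>image_low\<close> and
  \<open>image_high\<close> keep the outgoing beam within the second mirror, and \<open>depth\<close> bounds the extent of that
  mirror. A copy stays within distance 8 of its focus in the \<open>x\<close>-direction, so \<open>gap\<close> separates the copies.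
\<close>

locale mirror_device = frame +
  fixes c l :: real and D :: "real set"
  assumes c: "0 \<le> c" "c \<le> 1" and l: "0 < l" and cl: "c + l < 2"
    and image_low: "2 \<le> c + l * (2 + c)" and image_high: "c + l * (3 + c) \<le> 3"
    and depth: "(3 - c)\<^sup>2 \<le> 9 * l"
    and D: "finite D" "0 \<in> D" "D \<subseteq> {0..20}"
    and gap: "\<And>d d'. d \<in> D \<Longrightarrow> d' \<in> D \<Longrightarrow> d < d' \<Longrightarrow> d + 16 \<le> d'"
begin

text \<open>
  The parabolas \<open>x = front z\<close> and \<open>x = rear (- z)\<close> both have their focus at \<open>x = 0\<close>, \<open>z = - c\<close>, and they
  have the directrices \<open>x = 1\<close> and \<open>x = - l\<close>. So these are the first and the second mirror of the upper
  beam; in terms of \<open>\<zeta> = \<bar>z\<bar>\<close> the lower beam has the same pair.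
\<close>

definition front :: "real \<Rightarrow> real" where "front \<zeta> = (1 - (\<zeta> + c)\<^sup>2) / 2"

definition rear :: "real \<Rightarrow> real" where "rear \<zeta> = ((\<zeta> - c)\<^sup>2 / l - l) / 2"

lemma front_bounds:
  assumes "2 \<le> \<zeta>" "\<zeta> \<le> 3"
  shows "front \<zeta> \<le> - 3/2" "- 15/2 \<le> front \<zeta>"
proof -
  have "2\<^sup>2 \<le> (\<zeta> + c)\<^sup>2" "(\<zeta> + c)\<^sup>2 \<le> 4\<^sup>2" using assms c by (intro power_mono; simp)+
  then show "front \<zeta> \<le> - 3/2" "- 15/2 \<le> front \<zeta>" by (simp_all add: front_def)
qed

lemma rear_bounds:
  assumes "2 \<le> \<zeta>" "\<zeta> \<le> 3"
  shows "0 < rear \<zeta>" "rear \<zeta> \<le> 9/2"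
proof -
  have "l\<^sup>2 < (\<zeta> - c)\<^sup>2" using assms cl l by (intro power_strict_mono) auto
  then have "l < (\<zeta> - c)\<^sup>2 / l" using l by (simp add: field_simps power2_eq_square)
  then show "0 < rear \<zeta>" by (simp add: rear_def)
  have "(\<zeta> - c)\<^sup>2 \<le> (3 - c)\<^sup>2" using assms c by (intro power_mono) auto
  then have "(\<zeta> - c)\<^sup>2 / l \<le> 9" using depth l by (simp add: field_simps)
  moreover have "(a - l) / 2 \<le> 9/2" if "a \<le> 9" for a using l that by simp
  ultimately have "((\<zeta> - c)\<^sup>2 / l - l) / 2 \<le> 9/2" by blast
  then show "rear \<zeta> \<le> 9/2" by (simp only: rear_def)
qed

lemma polynomial_front: "real_polynomial_function g \<Longrightarrow> real_polynomial_function (\<lambda>x. front (g x))"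
  unfolding front_def
  by (intro real_polynomial_function_divide real_polynomial_function_diff real_polynomial_function_power
      real_polynomial_function.intros(2,3))

lemma polynomial_rear: "real_polynomial_function g \<Longrightarrow> real_polynomial_function (\<lambda>x. rear (g x))"
  unfolding rear_def
  by (intro real_polynomial_function_divide real_polynomial_function_diff real_polynomial_function_power
      real_polynomial_function.intros(2,3))

lemma front_has_derivative: "(front has_real_derivative - (\<zeta> + c)) (at \<zeta>)"
  unfolding front_def by (auto intro!: derivative_eq_intros)

lemma rear_has_derivative: "(rear has_real_derivative (\<zeta> - c) / l) (at \<zeta>)"
  unfolding rear_def using l by (auto intro!: derivative_eq_intros simp: field_simps)

text \<open>
  The piece in the half-space \<open>\<sigma> z > 0\<close>. Its front is the first mirror of the beam that arrives there;
  its rear contains the second mirror of the beam from the opposite half-space.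
\<close>

definition solid :: "real \<Rightarrow> real \<Rightarrow> (real^3) set" where
  "solid \<sigma> d = {p. 0 \<le> p \<bullet> f \<and> p \<bullet> f \<le> 1 \<and> 2 \<le> \<sigma> * (p \<bullet> k) \<and> \<sigma> * (p \<bullet> k) \<le> 3 \<and>
     d + front (\<sigma> * (p \<bullet> k)) \<le> p \<bullet> e \<and> p \<bullet> e \<le> d + rear (\<sigma> * (p \<bullet> k))}"

definition core :: "real \<Rightarrow> real \<Rightarrow> (real^3) set" where
  "core \<sigma> d = {p. 0 < p \<bullet> f \<and> p \<bullet> f < 1 \<and> 2 < \<sigma> * (p \<bullet> k) \<and> \<sigma> * (p \<bullet> k) < 3 \<and>
     d + front (\<sigma> * (p \<bullet> k)) < p \<bullet> e \<and> p \<bullet> e < d + rear (\<sigma> * (p \<bullet> k))}"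

text \<open>
  A thin sheet, which meets the solids only in edges, along \<open>\<bar>z\<bar> = 2\<close>. The length suffices for all
  offsets in \<open>D\<close>.
\<close>

definition plate :: "(real^3) set" where
  "plate = {p. p \<bullet> f = 0 \<and> - 1 \<le> p \<bullet> e \<and> p \<bullet> e \<le> 20 \<and> \<bar>p \<bullet> k\<bar> \<le> 2}"

abbreviation "pieces \<equiv> {1, - 1 :: real} \<times> D"

definition device :: "(real^3) set" where
  "device = (\<Union>(\<sigma>, d)\<in>pieces. solid \<sigma> d) \<union> plate"

text \<open>
  The solid as a curved unit cube: the first coordinate interpolates between the two mirrors.
\<close>

definition chart :: "real \<Rightarrow> real \<Rightarrow> real^3 \<Rightarrow> real^3" where
  "chart \<sigma> d w = pt (d + front (2 + w $ 3) + w $ 1 * (rear (2 + w $ 3) - front (2 + w $ 3)))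
     (w $ 2) (\<sigma> * (2 + w $ 3))"

lemma continuous_on_front [continuous_intros]:
  "continuous_on S g \<Longrightarrow> continuous_on S (\<lambda>x. front (g x))"
  unfolding front_def by (intro continuous_intros) auto

lemma continuous_on_rear [continuous_intros]:
  "continuous_on S g \<Longrightarrow> continuous_on S (\<lambda>x. rear (g x))"
  unfolding rear_def using l by (intro continuous_intros) auto

lemma closed_solid: "closed (solid \<sigma> d)"
  unfolding solid_def by (intro closed_Collect_conj closed_Collect_le continuous_intros)

lemma open_core: "open (core \<sigma> d)"
  unfolding core_def by (intro open_Collect_conj open_Collect_less continuous_intros)

lemma interior_solid:
  assumes "\<sigma> = 1 \<or> \<sigma> = - 1"
  shows "interior (solid \<sigma> d) = core \<sigma> d"
proof
  show "core \<sigma> d \<subseteq> interior (solid \<sigma> d)"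
    by (intro interior_maximal open_core) (auto simp: core_def solid_def)
  show "interior (solid \<sigma> d) \<subseteq> core \<sigma> d"
  proof
    fix p assume p: "p \<in> interior (solid \<sigma> d)"
    then have ps: "p \<in> solid \<sigma> d" using interior_subset by blast
    have ss: "\<sigma> * \<sigma> = 1" using assms by auto
    (* From a point where one of the inequalities is an equality, a coordinate direction leads out of the solid. *)
    have out: "p \<bullet> f \<noteq> 0" "p \<bullet> f \<noteq> 1" "\<sigma> * (p \<bullet> k) \<noteq> 2" "\<sigma> * (p \<bullet> k) \<noteq> 3"
      "d + front (\<sigma> * (p \<bullet> k)) \<noteq> p \<bullet> e" "p \<bullet> e \<noteq> d + rear (\<sigma> * (p \<bullet> k))"
      using p not_interior_if_ray_outside[of p "- f" "solid \<sigma> d"] not_interior_if_ray_outside[of p f "solid \<sigma> d"]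
        not_interior_if_ray_outside[of p "- (\<sigma> *\<^sub>R k)" "solid \<sigma> d"] not_interior_if_ray_outside[of p "\<sigma> *\<^sub>R k" "solid \<sigma> d"]
        not_interior_if_ray_outside[of p "- e" "solid \<sigma> d"] not_interior_if_ray_outside[of p e "solid \<sigma> d"]
      by (auto simp: solid_def inner_add_left inner_diff_left algebra_simps ss)
    show "p \<in> core \<sigma> d" using ps out by (auto simp: solid_def core_def less_le)
  qed
qed

lemma chart_image:
  assumes "\<sigma> = 1 \<or> \<sigma> = - 1"
  shows "chart \<sigma> d ` cbox 0 1 = solid \<sigma> d"
    and "chart \<sigma> d ` {w \<in> cbox 0 1. \<exists>i. w $ i = 0 \<or> w $ i = 1} = solid \<sigma> d - core \<sigma> d"
    and "inj_on (chart \<sigma> d) (cbox 0 1)"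
proof -
  have ss: "\<sigma> * (\<sigma> * s) = s" for s using assms by auto
  (* g is the inverse of the chart. *)
  define g where "g p = (let \<zeta> = \<sigma> * (p \<bullet> k) in
      vector [(p \<bullet> e - d - front \<zeta>) / (rear \<zeta> - front \<zeta>), p \<bullet> f, \<zeta> - 2] :: real^3)" for p
  have pos: "rear (2 + s) - front (2 + s) > 0" if "0 \<le> s" "s \<le> 1" for s
    using front_bounds[of "2 + s"] rear_bounds[of "2 + s"] that by simp
  have inv: "g (chart \<sigma> d w) = w" if "w \<in> cbox 0 1" for w
    using that pos[of "w $ 3"] by (simp add: g_def chart_def ss vec_eq_iff forall_3 mem_unit_cube)
  then show "inj_on (chart \<sigma> d) (cbox 0 1)" by (metis inj_onI)
  have inv': "chart \<sigma> d (g p) = p" "g p \<in> cbox 0 1" if "p \<in> solid \<sigma> d" for p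
  proof -
    define \<zeta> where "\<zeta> = \<sigma> * (p \<bullet> k)"
    have z: "2 \<le> \<zeta>" "\<zeta> \<le> 3" "p \<bullet> k = \<sigma> * \<zeta>" using that ss by (auto simp: solid_def \<zeta>_def)
    then have "rear \<zeta> - front \<zeta> > 0" using front_bounds rear_bounds by force
    then show "chart \<sigma> d (g p) = p" "g p \<in> cbox 0 1"
      using that z(1,2) unfolding solid_def \<zeta>_def[symmetric]
      by (auto simp: g_def chart_def \<zeta>_def[symmetric] Let_def z(3)[symmetric] mem_unit_cube forall_3)
  qed
  have mem: "chart \<sigma> d w \<in> solid \<sigma> d" and bd: "chart \<sigma> d w \<in> core \<sigma> d \<longleftrightarrow> (\<forall>i. w $ i \<noteq> 0 \<and> w $ i \<noteq> 1)"
    if w: "w \<in> cbox 0 1" for w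
  proof -
    define \<zeta> where "\<zeta> = 2 + w $ 3"
    define h where "h = rear \<zeta> - front \<zeta>"
    have w': "0 \<le> w $ i" "w $ i \<le> 1" for i using w by (auto simp: mem_unit_cube)
    have h: "h > 0" using pos[of "w $ 3"] w' by (simp add: h_def \<zeta>_def)
    have b: "rear \<zeta> = front \<zeta> + h" by (simp add: h_def)
    have "w $ 1 * h \<le> 1 * h" using w'[of 1] h by (intro mult_right_mono) auto
    moreover have "w $ 1 * h < h \<longleftrightarrow> w $ 1 < 1" "0 < w $ 1 * h \<longleftrightarrow> 0 < w $ 1"
      using h by (auto simp: zero_less_mult_iff)
    moreover have "0 \<le> w $ 1 * h" using w'[of 1] h by simp
    ultimately show "chart \<sigma> d w \<in> solid \<sigma> d"
      "chart \<sigma> d w \<in> core \<sigma> d \<longleftrightarrow> (\<forall>i. w $ i \<noteq> 0 \<and> w $ i \<noteq> 1)"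
      using w'[of 1] w'[of 2] w'[of 3]
      unfolding chart_def \<zeta>_def[symmetric] h_def[symmetric] solid_def core_def
      by (auto simp: ss b[unfolded \<zeta>_def] forall_3 \<zeta>_def less_le)
  qed
  show "chart \<sigma> d ` cbox 0 1 = solid \<sigma> d" using mem inv' by force
  show "chart \<sigma> d ` {w \<in> cbox 0 1. \<exists>i. w $ i = 0 \<or> w $ i = 1} = solid \<sigma> d - core \<sigma> d" (is "?L = ?R")
  proof
    show "?L \<subseteq> ?R" using mem bd by blast
    show "?R \<subseteq> ?L"
    proof
      fix p assume p: "p \<in> ?R"
      then have "\<exists>i. g p $ i = 0 \<or> g p $ i = 1" using bd[of "g p"] inv'[of p] by auto
      then show "p \<in> ?L" using inv'[of p] p by (metis (mono_tags, lifting) DiffD1 imageI mem_Collect_eq)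
    qed
  qed
qed

lemma chart_has_derivative:
  assumes "\<sigma> = 1 \<or> \<sigma> = - 1" and w: "w \<in> cbox 0 1"
  shows "\<exists>D. (chart \<sigma> d has_derivative D) (at w) \<and> inj D"
proof -
  define \<zeta> where "\<zeta> = 2 + w $ 3"
  define h where "h = rear \<zeta> - front \<zeta>"
  define s where "s = - (\<zeta> + c) + w $ 1 * ((\<zeta> - c) / l + (\<zeta> + c))"
  define A where "A v = pt (s * v $ 3 + h * v $ 1) (v $ 2) (\<sigma> * v $ 3)" for v :: "real^3"
  have "0 \<le> w $ 3" "w $ 3 \<le> 1" using w by (auto simp: mem_unit_cube)
  then have h: "h > 0" using front_bounds[of \<zeta>] rear_bounds[of \<zeta>] by (simp add: h_def \<zeta>_def)
  have nth: "((\<lambda>w. w $ i) has_derivative (\<lambda>v. v $ i)) (at w)" for i :: 3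
    by (intro bounded_linear_imp_has_derivative bounded_linear_vec_nth)
  have z: "((\<lambda>w. 2 + w $ 3) has_derivative (\<lambda>v. v $ 3)) (at w)"
    using has_derivative_add[OF has_derivative_const nth] by fastforce
  have fr: "((\<lambda>w. front (2 + w $ 3)) has_derivative (\<lambda>v. - (\<zeta> + c) * v $ 3)) (at w)"
    using has_derivative_compose[OF z front_has_derivative[unfolded has_field_derivative_def]]
    by (simp add: \<zeta>_def)
  have ba: "((\<lambda>w. rear (2 + w $ 3)) has_derivative (\<lambda>v. (\<zeta> - c) / l * v $ 3)) (at w)"
    using has_derivative_compose[OF z rear_has_derivative[unfolded has_field_derivative_def]]
    by (simp add: \<zeta>_def)
  have x: "((\<lambda>w. d + front (2 + w $ 3) + w $ 1 * (rear (2 + w $ 3) - front (2 + w $ 3)))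
      has_derivative (\<lambda>v. s * v $ 3 + h * v $ 1)) (at w)"
    by (rule derivative_eq_intros nth fr ba refl)+
       (auto simp: fun_eq_iff s_def h_def \<zeta>_def algebra_simps)
  have "(chart \<sigma> d has_derivative A) (at w)"
    unfolding chart_def A_def pt_def
    by (rule derivative_eq_intros nth x refl)+ (auto simp: fun_eq_iff)
  moreover have "inj A"
  proof (rule injI)
    fix x y assume "A x = A y"
    then have "x $ 3 = y $ 3" "x $ 2 = y $ 2" "s * x $ 3 + h * x $ 1 = s * y $ 3 + h * y $ 1"
      using assms(1) unfolding A_def pt_eq_iff by auto
    then show "x = y" using h by (simp add: vec_eq_iff forall_3)
  qed
  ultimately show ?thesis by blast
qed

lemma polynomial_chart: "polynomial_function (chart \<sigma> d)"
  unfolding chart_def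
  by (intro polynomial_function_pt real_polynomial_function_diff polynomial_front polynomial_rear
      real_polynomial_function.intros(2-4) real_polynomial_function_nth)

lemma gap_abs:
  assumes "d \<in> D" "d' \<in> D" "d \<noteq> d'" shows "16 \<le> \<bar>d - d'\<bar>"
  using gap[of d d'] gap[of d' d] assms by (cases "d < d'") auto

lemma solid_bounds:
  assumes "p \<in> solid \<sigma> d"
  shows "d - 15/2 \<le> p \<bullet> e" "p \<bullet> e \<le> d + 9/2" "2 \<le> \<sigma> * (p \<bullet> k)" "\<sigma> * (p \<bullet> k) \<le> 3" "0 \<le> p \<bullet> f" "p \<bullet> f \<le> 1"
  using assms front_bounds[of "\<sigma> * (p \<bullet> k)"] rear_bounds[of "\<sigma> * (p \<bullet> k)"] by (auto simp: solid_def)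

lemma solids_disjoint:
  assumes "(\<sigma>, d) \<in> pieces" "(\<sigma>', d') \<in> pieces" "(\<sigma>, d) \<noteq> (\<sigma>', d')"
  shows "solid \<sigma> d \<inter> solid \<sigma>' d' = {}"
proof (rule ccontr)
  assume "solid \<sigma> d \<inter> solid \<sigma>' d' \<noteq> {}"
  then obtain p where p: "p \<in> solid \<sigma> d" "p \<in> solid \<sigma>' d'" by blast
  then have "\<sigma> = \<sigma>'" using assms solid_bounds(3)[OF p(1)] solid_bounds(3)[OF p(2)] by auto
  then have "16 \<le> \<bar>d - d'\<bar>" using assms gap_abs by auto
  then show False
    using solid_bounds(1,2)[OF p(1)] solid_bounds(1,2)[OF p(2)] by linarith
qed

lemma closed_plate: "closed plate"
  unfolding plate_def by (intro closed_Collect_conj closed_Collect_le closed_Collect_eq continuous_intros)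

lemma interior_plate: "interior plate = {}"
proof -
  have "p \<notin> interior plate" for p
  proof (cases "p \<in> plate")
    case True
    then show ?thesis
      by (intro not_interior_if_ray_outside[of p f]) (auto simp: plate_def inner_add_left)
  qed (use interior_subset in blast)
  then show ?thesis by blast
qed

lemma closed_device: "closed device"
  unfolding device_def using D(1) closed_solid closed_plate by (auto intro!: closed_Un closed_UN)

lemma interior_device: "interior device = (\<Union>(\<sigma>, d)\<in>pieces. core \<sigma> d)"
proof -
  have "interior device = interior (\<Union>(\<sigma>, d)\<in>pieces. solid \<sigma> d)"
    unfolding device_def using D(1) closed_solid interior_plate
    by (intro interior_closed_Un_empty_interior closed_UN) auto
  also have "\<dots> = interior (\<Union>q\<in>pieces. solid (fst q) (snd q))"
    by (simp add: case_prod_unfold)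
  also have "\<dots> = (\<Union>q\<in>pieces. interior (solid (fst q) (snd q)))"
  proof (rule interior_UN_disjoint_closed)
    show "finite pieces" using D(1) by simp
    show "solid (fst q) (snd q) \<inter> solid (fst q') (snd q') = {}"
      if "q \<in> pieces" "q' \<in> pieces" "q \<noteq> q'" for q q'
      using solids_disjoint[of "fst q" "snd q" "fst q'" "snd q'"] that by simp
  qed (rule closed_solid)
  also have "\<dots> = (\<Union>(\<sigma>, d)\<in>pieces. core \<sigma> d)"
    using interior_solid by (intro SUP_cong) (auto simp: case_prod_unfold)
  finally show ?thesis .
qed

lemma core_subset: "core \<sigma> d \<subseteq> solid \<sigma> d"
  by (auto simp: core_def solid_def)

lemma frontier_device: "frontier device = (\<Union>(\<sigma>, d)\<in>pieces. solid \<sigma> d - core \<sigma> d) \<union> plate"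
proof -
  have core_plate: "p \<notin> core \<sigma> d" if "p \<in> plate" "(\<sigma>, d) \<in> pieces" for p \<sigma> d
    using that by (auto simp: core_def plate_def)
  have core_solid: "p \<notin> core \<sigma> d" if p: "p \<in> solid \<sigma>' d' - core \<sigma>' d'" and
    q: "(\<sigma>, d) \<in> pieces" "(\<sigma>', d') \<in> pieces" for p \<sigma> d \<sigma>' d'
    using solids_disjoint[OF q] core_subset p by blast
  have "device - interior device = (\<Union>(\<sigma>, d)\<in>pieces. solid \<sigma> d - core \<sigma> d) \<union> plate" (is "?L = ?R")
  proof
    show "?L \<subseteq> ?R" unfolding interior_device unfolding device_def by auto
    show "?R \<subseteq> ?L"
    proof
      fix p assume p: "p \<in> ?R"
      have "p \<notin> interior device"
      proof
        assume "p \<in> interior device"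
        then obtain \<sigma> d where q: "(\<sigma>, d) \<in> pieces" "p \<in> core \<sigma> d" unfolding interior_device by auto
        from p consider "p \<in> plate" | \<sigma>' d' where "(\<sigma>', d') \<in> pieces" "p \<in> solid \<sigma>' d' - core \<sigma>' d'"
          by auto
        then show False
        proof cases
          case 1
          then show False using core_plate q by simp
        next
          case 2
          then show False using core_solid[OF 2(2) q(1) 2(1)] q(2) by simp
        qed
      qed
      moreover have "p \<in> device" using p unfolding device_def by auto
      ultimately show "p \<in> ?L" by blast
    qed
  qed
  then show ?thesis by (simp add: frontier_def closed_device)
qed

lemma pt_mem_device:
  "pt x y z \<in> device \<longleftrightarrow>
     0 \<le> y \<and> y \<le> 1 \<and> 2 \<le> \<bar>z\<bar> \<and> \<bar>z\<bar> \<le> 3 \<and> (\<exists>d\<in>D. d + front \<bar>z\<bar> \<le> x \<and> x \<le> d + rear \<bar>z\<bar>) \<or>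
     y = 0 \<and> - 1 \<le> x \<and> x \<le> 20 \<and> \<bar>z\<bar> \<le> 2"
proof -
  have "(\<exists>(\<sigma>, d)\<in>pieces. pt x y z \<in> solid \<sigma> d) \<longleftrightarrow>
     0 \<le> y \<and> y \<le> 1 \<and> 2 \<le> \<bar>z\<bar> \<and> \<bar>z\<bar> \<le> 3 \<and> (\<exists>d\<in>D. d + front \<bar>z\<bar> \<le> x \<and> x \<le> d + rear \<bar>z\<bar>)"
    by (cases "0 \<le> z") (auto simp: solid_def)
  moreover have "pt x y z \<in> plate \<longleftrightarrow> y = 0 \<and> - 1 \<le> x \<and> x \<le> 20 \<and> \<bar>z\<bar> \<le> 2"
    by (simp add: plate_def)
  ultimately show ?thesis unfolding device_def by auto
qed

lemma closure_device [simp]: "closure device = device"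
  by (simp add: closed_device)

lemma frontier_subset_device: "frontier device \<subseteq> device"
  using frontier_subset_closed closed_device by blast

lemma tiled_plate: "tiled_surface plate {p. p \<bullet> f = 0 \<and> - 1 < p \<bullet> e \<and> p \<bullet> e < 20 \<and> \<bar>p \<bullet> k\<bar> < 2}"
proof -
  define \<phi> where "\<phi> u = pt (21 * u $ 1 - 1) 0 (4 * u $ 2 - 2)" for u :: "real^2"
  define g :: "real^3 \<Rightarrow> real^2" where "g p = vector [(p \<bullet> e + 1) / 21, (p \<bullet> k + 2) / 4]" for p
  have g: "g (\<phi> u) = u" for u by (simp add: g_def \<phi>_def vec_eq_iff forall_2)
  have g': "\<phi> (g p) = p" if "p \<bullet> f = 0" for p
  proof -
    have "\<phi> (g p) = pt (p \<bullet> e) (p \<bullet> f) (p \<bullet> k)"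
      unfolding \<phi>_def pt_eq_iff using that by (simp add: g_def field_simps)
    then show ?thesis by simp
  qed
  have "surface_patch (cbox 0 1) \<phi>"
  proof (rule surface_patch_if_embedding)
    have "(1/2) *\<^sub>R 1 \<in> box 0 (1::real^2)" by (simp add: mem_box_cart)
    then show "interior (cbox 0 1 :: (real^2) set) \<noteq> {}" by (metis empty_iff interior_cbox)
    show "polynomial_function \<phi>" unfolding \<phi>_def
      by (intro polynomial_function_pt real_polynomial_function_diff real_polynomial_function.intros(2-4)
          real_polynomial_function_nth)
    show "inj_on \<phi> (cbox 0 1)" using g by (metis inj_onI)
    show "\<exists>D. (\<phi> has_derivative D) (at u) \<and> inj D" for u
    proof -
      have nth: "((\<lambda>w. w $ i) has_derivative (\<lambda>v. v $ i)) (at u)" for i :: 2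
        by (intro bounded_linear_imp_has_derivative bounded_linear_vec_nth)
      have "(\<phi> has_derivative (\<lambda>v. pt (21 * v $ 1) 0 (4 * v $ 2))) (at u)"
        unfolding \<phi>_def pt_def by (rule derivative_eq_intros nth refl)+ (auto simp: fun_eq_iff)
      moreover have "inj (\<lambda>v :: real^2. pt (21 * v $ 1) 0 (4 * v $ 2))"
      proof (rule injI)
        fix x y :: "real^2" assume "pt (21 * x $ 1) 0 (4 * x $ 2) = pt (21 * y $ 1) 0 (4 * y $ 2)"
        then have "x $ 1 = y $ 1" "x $ 2 = y $ 2" unfolding pt_eq_iff by auto
        then show "x = y" by (simp add: vec_eq_iff forall_2)
      qed
      ultimately show ?thesis by blast
    qed
  qed (rule polytope_interval)
  moreover have "\<phi> ` cbox 0 1 = plate"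
  proof
    show "\<phi> ` cbox 0 1 \<subseteq> plate" by (auto simp: \<phi>_def plate_def mem_unit_cube forall_2)
    show "plate \<subseteq> \<phi> ` cbox 0 1"
    proof
      fix p assume p: "p \<in> plate"
      then have "g p \<in> cbox 0 1" by (auto simp: plate_def g_def mem_unit_cube forall_2)
      then show "p \<in> \<phi> ` cbox 0 1" using g'[of p] p by (metis (mono_tags, lifting) imageI mem_Collect_eq plate_def)
    qed
  qed
  moreover have "\<phi> ` interior (cbox 0 1) = {p. p \<bullet> f = 0 \<and> - 1 < p \<bullet> e \<and> p \<bullet> e < 20 \<and> \<bar>p \<bullet> k\<bar> < 2}" (is "?L = ?R")
  proof
    show "?L \<subseteq> ?R" by (auto simp: \<phi>_def interior_cbox mem_box_cart forall_2)
    show "?R \<subseteq> ?L"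
    proof
      fix p assume p: "p \<in> ?R"
      then have "g p \<in> interior (cbox 0 1)" by (auto simp: g_def interior_cbox mem_box_cart forall_2)
      then show "p \<in> ?L" using g'[of p] p by (metis (mono_tags, lifting) imageI mem_Collect_eq)
    qed
  qed
  ultimately show ?thesis using tiled_surface_single by metis
qed

text \<open>
  Plate and solids touch only where \<open>y = 0\<close> and \<open>\<bar>z\<bar> = 2\<close>; there two coordinates of the curved cube are
  extreme, so the contact is along edges of the patches.
\<close>

lemma piecewise_smooth_frontier_device: "piecewise_smooth_surface (frontier device)"
proof -
  let ?F = "{w \<in> cbox 0 (1::real^3). \<exists>i. (w $ i = 0 \<or> w $ i = 1) \<and> (\<forall>j. j \<noteq> i \<longrightarrow> 0 < w $ j \<and> w $ j < 1)}"
  have piece: "tiled_surface (solid \<sigma> d - core \<sigma> d) (chart \<sigma> d ` ?F)" if "(\<sigma>, d) \<in> pieces" for \<sigma> d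
  proof -
    have s: "\<sigma> = 1 \<or> \<sigma> = - 1" using that by auto
    show ?thesis
      using tiled_surface_cube_image[OF polynomial_chart chart_image(3)[OF s] chart_has_derivative[OF s]]
      unfolding chart_image(2)[OF s] .
  qed
  have F_plate: "chart \<sigma> d ` ?F \<inter> plate = {}" if "(\<sigma>, d) \<in> pieces" for \<sigma> d
  proof -
    have "chart \<sigma> d w \<notin> plate" if w: "w \<in> ?F" for w
    proof
      assume "chart \<sigma> d w \<in> plate"
      moreover have "\<bar>\<sigma>\<bar> = 1" using \<open>(\<sigma>, d) \<in> pieces\<close> by auto
      ultimately have *: "w $ 2 = 0" "\<bar>2 + w $ 3\<bar> \<le> 2" by (auto simp: chart_def plate_def abs_mult)
      obtain i where "\<And>j. j \<noteq> i \<Longrightarrow> 0 < w $ j \<and> w $ j < 1" using w by blast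
      from this[of 2] this[of 3] * show False by (cases "i = 2") auto
    qed
    then show ?thesis by blast
  qed
  have *: "tiled_surface (\<Union>q\<in>pieces. solid (fst q) (snd q) - core (fst q) (snd q))
      (\<Union>q\<in>pieces. chart (fst q) (snd q) ` ?F)"
  proof (rule tiled_surface_UN)
    show "finite pieces" using D(1) by simp
    show "tiled_surface (solid (fst q) (snd q) - core (fst q) (snd q)) (chart (fst q) (snd q) ` ?F)"
      if "q \<in> pieces" for q
      by (rule piece) (use that in simp)
    show "(solid (fst q) (snd q) - core (fst q) (snd q)) \<inter> (solid (fst r) (snd r) - core (fst r) (snd r)) = {}"
      if "q \<in> pieces" "r \<in> pieces" "q \<noteq> r" for q r
    proof -
      have "solid (fst q) (snd q) \<inter> solid (fst r) (snd r) = {}"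
        by (rule solids_disjoint) (use that in simp_all)
      then show ?thesis by blast
    qed
  qed
  have UN_disjoint: "(\<Union>q\<in>I. X q) \<inter> S = {}" if "\<And>q. q \<in> I \<Longrightarrow> X q \<inter> S = {}"
    for I and X :: "real \<times> real \<Rightarrow> (real^3) set" and S
    using that by blast
  from * have "tiled_surface ((\<Union>q\<in>pieces. solid (fst q) (snd q) - core (fst q) (snd q)) \<union> plate)
      ((\<Union>q\<in>pieces. chart (fst q) (snd q) ` ?F) \<union> {p. p \<bullet> f = 0 \<and> - 1 < p \<bullet> e \<and> p \<bullet> e < 20 \<and> \<bar>p \<bullet> k\<bar> < 2})"
  proof (rule tiled_surface_Un[OF _ tiled_plate])
    show "(\<Union>q\<in>pieces. chart (fst q) (snd q) ` ?F) \<inter> plate = {}"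
    proof -
      have "chart (fst q) (snd q) ` ?F \<inter> plate = {}" if "q \<in> pieces" for q
        by (rule F_plate) (use that in simp)
      then show ?thesis by (rule UN_disjoint)
    qed
    show "{p. p \<bullet> f = 0 \<and> - 1 < p \<bullet> e \<and> p \<bullet> e < 20 \<and> \<bar>p \<bullet> k\<bar> < 2} \<inter>
        (\<Union>q\<in>pieces. solid (fst q) (snd q) - core (fst q) (snd q)) = {}"
      by (auto simp: solid_def)
  qed
  then show ?thesis
    unfolding frontier_device case_prod_unfold by (rule piecewise_smooth_surface_if_tiled)
qed

lemma bounded_device: "bounded device"
proof -
  have "norm p \<le> 33" if "p \<in> device" for p
  proof -
    obtain x y z where p: "p = pt x y z" by (rule pt_cases)
    have "\<bar>x\<bar> \<le> 25 \<and> \<bar>y\<bar> \<le> 1 \<and> \<bar>z\<bar> \<le> 3"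
      using that D(3) front_bounds[of "\<bar>z\<bar>"] rear_bounds[of "\<bar>z\<bar>"] unfolding p pt_mem_device by force
    then show ?thesis using norm_pt_le[of x y z] unfolding p by linarith
  qed
  then show ?thesis unfolding bounded_iff by blast
qed

lemma connected_device: "connected device"
proof -
  have plate: "connected plate"
  proof (intro convex_connected)
    have "plate = {p. f \<bullet> p = 0} \<inter> {p. e \<bullet> p \<ge> - 1} \<inter> {p. e \<bullet> p \<le> 20} \<inter> {p. k \<bullet> p \<le> 2} \<inter> {p. k \<bullet> p \<ge> - 2}"
      by (auto simp: plate_def inner_commute abs_le_iff)
    then show "convex plate"
      by (simp add: convex_Int convex_hyperplane convex_halfspace_le convex_halfspace_ge)
  qed
  have solid: "connected (solid \<sigma> d)" if "(\<sigma>, d) \<in> pieces" for \<sigma> d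
    using that chart_image(1)[of \<sigma> d] polynomial_chart[of \<sigma> d]
    by (metis SigmaD1 connected_continuous_image continuous_on_polymonial_function convex_box(1)
        convex_connected insertE singletonD)
  have meet: "solid \<sigma> d \<inter> plate \<noteq> {}" if "(\<sigma>, d) \<in> pieces" for \<sigma> d
  proof -
    (* The focal plane x = d passes between the front and the rear of the solid. *)
    have "pt d 0 (\<sigma> * 2) \<in> solid \<sigma> d \<inter> plate"
      using that D(3) front_bounds[of 2] rear_bounds[of 2] by (auto simp: solid_def plate_def)
    then show ?thesis by blast
  qed
  have "connected (\<Union>q\<in>pieces. solid (fst q) (snd q) \<union> plate)"
  proof (rule connected_Union)
    show "connected S" if "S \<in> (\<lambda>q. solid (fst q) (snd q) \<union> plate) ` pieces" for S
      using that solid meet plate by (auto intro!: connected_Un)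
    have "pt 0 0 0 \<in> plate" by (simp add: plate_def)
    then show "\<Inter> ((\<lambda>q. solid (fst q) (snd q) \<union> plate) ` pieces) \<noteq> {}" by blast
  qed
  moreover have "device = (\<Union>q\<in>pieces. solid (fst q) (snd q) \<union> plate)"
    using D(2) unfolding device_def case_prod_unfold by blast
  ultimately show ?thesis by simp
qed

lemma body_device: "body device"
proof -
  have "compact device" by (simp add: compact_eq_bounded_closed closed_device bounded_device)
  then have lm: "device \<in> lmeasurable" by (rule lmeasurable_compact)
  have "pt 0 (1/2) (5/2) \<in> core 1 0"
    using front_bounds[of "5/2"] rear_bounds[of "5/2"] by (simp add: core_def)
  then have "interior device \<noteq> {}" unfolding interior_device using D(2) by fastforce
  then have "\<not> negligible device"
    using open_not_negligible negligible_subset interior_subset open_interior by metis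
  then have "measure lebesgue device \<noteq> 0" using lm negligible_iff_measure0 by blast
  then show ?thesis
    unfolding body_def using bounded_device connected_device piecewise_smooth_frontier_device
    by (simp add: zero_less_measure_iff measure_nonneg less_le)
qed

section \<open>Reflection at the confocal mirrors\<close>

lemma pt_mem_interior:
  "pt x y z \<in> interior device \<longleftrightarrow>
     0 < y \<and> y < 1 \<and> 2 < \<bar>z\<bar> \<and> \<bar>z\<bar> < 3 \<and> (\<exists>d\<in>D. d + front \<bar>z\<bar> < x \<and> x < d + rear \<bar>z\<bar>)"
  unfolding interior_device by (cases "0 \<le> z") (auto simp: core_def)

lemma pt_mem_frontier: "pt x y z \<in> frontier device \<longleftrightarrow> pt x y z \<in> device \<and> pt x y z \<notin> interior device"
  by (simp add: frontier_def)

text \<open>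
  Near the focus \<open>d\<close> all other copies of the device can be ignored.
\<close>

lemma only_near_piece:
  assumes d: "d \<in> D" "\<bar>x - d\<bar> \<le> 8" and \<zeta>: "2 \<le> \<zeta>" "\<zeta> \<le> 3"
  shows "(\<exists>d'\<in>D. d' + front \<zeta> \<le> x \<and> x \<le> d' + rear \<zeta>) \<longleftrightarrow> d + front \<zeta> \<le> x \<and> x \<le> d + rear \<zeta>"
    and "(\<exists>d'\<in>D. d' + front \<zeta> < x \<and> x < d' + rear \<zeta>) \<longleftrightarrow> d + front \<zeta> < x \<and> x < d + rear \<zeta>"
proof -
  have "d' = d" if "d' \<in> D" "d' + front \<zeta> \<le> x" "x \<le> d' + rear \<zeta>" for d'
    using gap_abs[OF that(1) d(1)] that(2,3) d(2) front_bounds[OF \<zeta>] rear_bounds[OF \<zeta>] by linarith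
  then show "(\<exists>d'\<in>D. d' + front \<zeta> \<le> x \<and> x \<le> d' + rear \<zeta>) \<longleftrightarrow> d + front \<zeta> \<le> x \<and> x \<le> d + rear \<zeta>"
    and "(\<exists>d'\<in>D. d' + front \<zeta> < x \<and> x < d' + rear \<zeta>) \<longleftrightarrow> d + front \<zeta> < x \<and> x < d + rear \<zeta>"
    using d(1) less_imp_le by metis+
qed

lemma device_near:
  assumes "d \<in> D" "\<bar>x - d\<bar> \<le> 8" "0 < y" "y < 1"
  shows "pt x y z \<in> device \<longleftrightarrow> 2 \<le> \<bar>z\<bar> \<and> \<bar>z\<bar> \<le> 3 \<and> d + front \<bar>z\<bar> \<le> x \<and> x \<le> d + rear \<bar>z\<bar>"
  unfolding pt_mem_device using only_near_piece(1)[OF assms(1,2), of "\<bar>z\<bar>"] assms(3,4) by auto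

lemma frontier_near:
  assumes "d \<in> D" "\<bar>x - d\<bar> \<le> 8" "0 < y" "y < 1" "2 < \<bar>z\<bar>" "\<bar>z\<bar> < 3"
  shows "pt x y z \<in> frontier device \<longleftrightarrow> x = d + front \<bar>z\<bar> \<or> x = d + rear \<bar>z\<bar>"
  unfolding pt_mem_frontier device_near[OF assms(1-4)] pt_mem_interior
  using only_near_piece(2)[OF assms(1,2), of "\<bar>z\<bar>"] assms(3-6)
    front_bounds[of "\<bar>z\<bar>"] rear_bounds[of "\<bar>z\<bar>"] by auto

text \<open>
  Where the frontier is the graph of a polynomial \<open>h\<close> over the height, the normal is read off from the
  slope.
\<close>

lemma unit_normal_graph:
  assumes \<sigma>: "\<sigma> = 1 \<or> \<sigma> = - 1" and W: "open W" "pt (d + h \<zeta>) y (\<sigma> * \<zeta>) \<in> W"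
    and h: "\<And>g :: real^3 \<Rightarrow> real. real_polynomial_function g \<Longrightarrow> real_polynomial_function (\<lambda>x. h (g x))"
    and der: "(h has_real_derivative s) (at \<zeta>)"
    and eq: "\<And>q. q \<in> W \<Longrightarrow> q \<in> frontier device \<longleftrightarrow> q \<bullet> e = d + h (\<sigma> * (q \<bullet> k))"
  shows "unit_normal (frontier device) (pt (d + h \<zeta>) y (\<sigma> * \<zeta>)) ((1 / sqrt (1 + s\<^sup>2)) *\<^sub>R pt 1 0 (- \<sigma> * s))"
proof -
  let ?p = "pt (d + h \<zeta>) y (\<sigma> * \<zeta>)" and ?N = "sqrt (1 + s\<^sup>2)"
  let ?g = "\<lambda>q. q \<bullet> e - d - h (\<sigma> * (q \<bullet> k))"
  have \<sigma>2: "\<sigma> * (\<sigma> * t) = t" "\<sigma>\<^sup>2 = 1" for t using \<sigma> by auto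
  have N: "?N > 0" by (simp add: add_pos_nonneg)
  have inner: "real_polynomial_function (\<lambda>q. q \<bullet> v)" for v :: "real^3"
    by (intro real_polynomial_function.intros(1) bounded_linear_inner_left)
  have "real_polynomial_function ?g"
    by (intro real_polynomial_function_diff h inner real_polynomial_function.intros(2,4))
  then have "smooth_on W ?g"
    using smooth_on_polynomial_function real_polynomial_function_eq by blast
  moreover have "(?g has_derivative (\<lambda>v. ?N * (((1 / ?N) *\<^sub>R pt 1 0 (- \<sigma> * s)) \<bullet> v))) (at ?p)"
  proof -
    have "((\<lambda>q. \<sigma> * (q \<bullet> k)) has_derivative (\<lambda>v. \<sigma> * (v \<bullet> k))) (at ?p)"
      by (intro derivative_intros)
    moreover have "(h has_derivative (*) s) (at (\<sigma> * (?p \<bullet> k)))"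
      using der by (simp add: \<sigma>2 has_field_derivative_def)
    ultimately have "((\<lambda>q. h (\<sigma> * (q \<bullet> k))) has_derivative (\<lambda>v. s * (\<sigma> * (v \<bullet> k)))) (at ?p)"
      by (rule has_derivative_compose)
    then have "(?g has_derivative (\<lambda>v. v \<bullet> e - 0 - s * (\<sigma> * (v \<bullet> k)))) (at ?p)"
      by (intro has_derivative_diff has_derivative_const) (auto intro!: derivative_intros)
    moreover have "?N * (((1 / ?N) *\<^sub>R pt 1 0 (- \<sigma> * s)) \<bullet> v) = v \<bullet> e - 0 - s * (\<sigma> * (v \<bullet> k))" for v
      using N by (simp add: pt_def inner_diff_left inner_commute[of v])
    ultimately show ?thesis by simp
  qed
  moreover have "norm ((1 / ?N) *\<^sub>R pt 1 0 (- \<sigma> * s)) = 1"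
    using N by (simp add: norm_pt power_mult_distrib \<sigma>2)
  moreover have "?p \<in> frontier device" using eq[OF W(2)] by (simp add: \<sigma>2)
  moreover have "frontier device \<inter> W = {q \<in> W. ?g q = 0}" using eq by auto
  ultimately show ?thesis
    unfolding unit_normal_def using W N
    by (intro conjI exI[of _ W] exI[of _ ?g] exI[of _ ?N]) simp_all
qed

lemma near_open: "open {q. 0 < q \<bullet> f \<and> q \<bullet> f < 1 \<and> 2 < \<sigma> * (q \<bullet> k) \<and> \<sigma> * (q \<bullet> k) < 3 \<and> a < q \<bullet> e \<and> q \<bullet> e < b}"
  by (intro open_Collect_conj open_Collect_less continuous_intros)

lemma unit_normal_front:
  assumes d: "d \<in> D" and \<sigma>: "\<sigma> = 1 \<or> \<sigma> = - 1" and y: "0 < y" "y < 1" and \<zeta>: "2 < \<zeta>" "\<zeta> < 3"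
  shows "unit_normal (frontier device) (pt (d + front \<zeta>) y (\<sigma> * \<zeta>))
    ((1 / sqrt (1 + (\<zeta> + c)\<^sup>2)) *\<^sub>R pt 1 0 (\<sigma> * (\<zeta> + c)))"
proof -
  let ?W = "{q. 0 < q \<bullet> f \<and> q \<bullet> f < 1 \<and> 2 < \<sigma> * (q \<bullet> k) \<and> \<sigma> * (q \<bullet> k) < 3 \<and> d - 8 < q \<bullet> e \<and> q \<bullet> e < d}"
  have ss: "\<sigma> * (\<sigma> * t) = t" for t using \<sigma> by auto
  have "q \<in> frontier device \<longleftrightarrow> q \<bullet> e = d + front (\<sigma> * (q \<bullet> k))" if "q \<in> ?W" for q
  proof -
    have "\<bar>q \<bullet> k\<bar> = \<sigma> * (q \<bullet> k)" using \<sigma> that by auto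
    then show ?thesis
      using that frontier_near[OF d, of "q \<bullet> e" "q \<bullet> f" "q \<bullet> k"] rear_bounds[of "\<sigma> * (q \<bullet> k)"] by auto
  qed
  moreover have "pt (d + front \<zeta>) y (\<sigma> * \<zeta>) \<in> ?W" using y \<zeta> front_bounds[of \<zeta>] by (simp add: ss)
  ultimately have "unit_normal (frontier device) (pt (d + front \<zeta>) y (\<sigma> * \<zeta>))
      ((1 / sqrt (1 + (- (\<zeta> + c))\<^sup>2)) *\<^sub>R pt 1 0 (- \<sigma> * - (\<zeta> + c)))"
    by (intro unit_normal_graph[OF \<sigma>, where W="?W"] near_open polynomial_front front_has_derivative)
  then show ?thesis by (simp only: power2_minus minus_mult_minus)
qed

lemma unit_normal_rear:
  assumes d: "d \<in> D" and \<sigma>: "\<sigma> = 1 \<or> \<sigma> = - 1" and y: "0 < y" "y < 1" and \<zeta>: "2 < \<zeta>" "\<zeta> < 3"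
  shows "unit_normal (frontier device) (pt (d + rear \<zeta>) y (\<sigma> * \<zeta>))
    ((1 / sqrt (1 + ((\<zeta> - c) / l)\<^sup>2)) *\<^sub>R pt 1 0 (- \<sigma> * ((\<zeta> - c) / l)))"
proof -
  let ?W = "{q. 0 < q \<bullet> f \<and> q \<bullet> f < 1 \<and> 2 < \<sigma> * (q \<bullet> k) \<and> \<sigma> * (q \<bullet> k) < 3 \<and> d < q \<bullet> e \<and> q \<bullet> e < d + 8}"
  have ss: "\<sigma> * (\<sigma> * t) = t" for t using \<sigma> by auto
  have "q \<in> frontier device \<longleftrightarrow> q \<bullet> e = d + rear (\<sigma> * (q \<bullet> k))" if "q \<in> ?W" for q
  proof -
    have "\<bar>q \<bullet> k\<bar> = \<sigma> * (q \<bullet> k)" using \<sigma> that by auto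
    then show ?thesis
      using that frontier_near[OF d, of "q \<bullet> e" "q \<bullet> f" "q \<bullet> k"] front_bounds[of "\<sigma> * (q \<bullet> k)"] by auto
  qed
  moreover have "pt (d + rear \<zeta>) y (\<sigma> * \<zeta>) \<in> ?W" using y \<zeta> rear_bounds[of \<zeta>] by (simp add: ss)
  ultimately show ?thesis
    by (intro unit_normal_graph[OF \<sigma>, where W="?W"] near_open polynomial_rear rear_has_derivative)
qed

text \<open>
  The flight from the first to the second mirror misses the solids. The ray from the mirror point at
  height \<open>\<zeta>\<close> through the focus is parametrised by \<open>\<theta>\<close>, which is 1 at the focus and \<open>1 + l\<close> at the
  second mirror. Both parts of the ray lie strictly inside the corresponding parabola; the
  differences of the two sides factor, which makes their sign visible.
\<close>

lemma confocal_flight: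
  assumes \<zeta>: "2 < \<zeta>" "\<zeta> < 3" and \<theta>: "0 < \<theta>" "\<theta> < 1 + l"
  defines "Z \<equiv> \<zeta> + c"
  shows "2 \<le> \<zeta> - \<theta> * Z \<Longrightarrow> (1 - \<theta>) * front \<zeta> < front (\<zeta> - \<theta> * Z)"
    and "\<zeta> - \<theta> * Z \<le> - 2 \<Longrightarrow> rear (- (\<zeta> - \<theta> * Z)) < (1 - \<theta>) * front \<zeta>"
proof -
  have Z: "Z > 0" using \<zeta> c by (simp add: Z_def)
  show "(1 - \<theta>) * front \<zeta> < front (\<zeta> - \<theta> * Z)" if "2 \<le> \<zeta> - \<theta> * Z"
  proof -
    define m where "m = 1 - \<theta>"
    have mZ: "\<zeta> - \<theta> * Z + c = m * Z" by (simp add: m_def Z_def algebra_simps)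
    then have "m * Z > 0" using that c by linarith
    then have m: "0 < m" "m < 1" using Z \<theta> by (auto simp: m_def zero_less_mult_iff)
    have "m * (1 - Z\<^sup>2) < 1 - (m * Z)\<^sup>2"
    proof -
      have "1 - (m * Z)\<^sup>2 - m * (1 - Z\<^sup>2) = (1 - m) * (1 + m * Z\<^sup>2)"
        by (simp add: power2_eq_square algebra_simps)
      also have "\<dots> > 0" using m by (intro mult_pos_pos add_pos_nonneg) auto
      finally show ?thesis by simp
    qed
    then show ?thesis unfolding front_def mZ m_def[symmetric] Z_def[symmetric] by simp
  qed
  show "rear (- (\<zeta> - \<theta> * Z)) < (1 - \<theta>) * front \<zeta>" if "\<zeta> - \<theta> * Z \<le> - 2"
  proof -
    define m where "m = \<theta> - 1"
    have mZ: "- (\<zeta> - \<theta> * Z) - c = m * Z" by (simp add: m_def Z_def algebra_simps)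
    then have "m * Z > 0" using that c by linarith
    then have m: "0 < m" "m < l" using Z \<theta> by (auto simp: m_def zero_less_mult_iff)
    have "(m * Z)\<^sup>2 / l - l < m * (Z\<^sup>2 - 1)"
    proof -
      have "m * (Z\<^sup>2 - 1) - ((m * Z)\<^sup>2 / l - l) = (l - m) * (1 + m * Z\<^sup>2 / l)"
        using l by (simp add: power2_eq_square field_simps)
      also have "\<dots> > 0" using m l by (intro mult_pos_pos add_pos_nonneg) auto
      finally show ?thesis by simp
    qed
    moreover have "(1 - \<theta>) * front \<zeta> = m * (Z\<^sup>2 - 1) / 2"
      by (simp add: front_def m_def Z_def[symmetric] field_simps)
    ultimately show ?thesis unfolding rear_def mZ by simp
  qed
qed

text \<open>
  The effect of one device: a particle at height \<open>\<sigma> * \<zeta>\<close> is taken to height \<open>- \<sigma> * (c + l * (\<zeta> + c))\<close> and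
  continues with velocity \<open>e\<close>. The first reflection turns \<open>e\<close> into the direction \<open>u\<close> towards the focus. The two
  mirror points correspond under a homothety, so they have the same normal, and the second reflection
  undoes the first. The orbit is assembled backwards, from the given continuation.
\<close>

lemma orbit_through_device:
  assumes d: "d \<in> D" and \<sigma>: "\<sigma> = 1 \<or> \<sigma> = - 1" and y: "0 < y" "y < 1" and \<zeta>: "2 < \<zeta>" "\<zeta> < 3"
    and next_orbit: "orbit device (pt (d + 8) y (- \<sigma> * (c + l * (\<zeta> + c)))) e p' v'"
  shows "orbit device (pt (d - 8) y (\<sigma> * \<zeta>)) e p' v'"
proof -
  define Z where "Z = \<zeta> + c"
  (* Z is the distance in height from the focus, r the distance from the first mirror to the
     focus, T the length of the flight between the mirrors, eta the height after the flight. *)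
  define \<eta> where "\<eta> = c + l * Z"
  define r where "r = (1 + Z\<^sup>2) / 2"
  define u where "u = pt (- front \<zeta> / r) 0 (- \<sigma> * Z / r)"
  define n where "n = (1 / sqrt (1 + Z\<^sup>2)) *\<^sub>R pt 1 0 (\<sigma> * Z)"
  define T where "T = (1 + l) * r"
  have ss: "\<sigma> * (\<sigma> * t) = t" "\<sigma> * \<sigma> = 1" for t using \<sigma> by auto
  have abs\<sigma>: "\<bar>\<sigma> * t\<bar> = \<bar>t\<bar>" for t using \<sigma> by auto
  have Z: "Z > 0" using \<zeta> c by (simp add: Z_def)
  have r: "r > 0" by (simp add: r_def add_pos_nonneg)
  have T: "T > 0" using r l by (simp add: T_def)
  have \<eta>: "2 < \<eta>" "\<eta> < 3"
  proof -
    have "l * (2 + c) < l * Z" "l * Z < l * (3 + c)" using \<zeta> l by (auto simp: Z_def)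
    then show "2 < \<eta>" "\<eta> < 3" using image_low image_high by (auto simp: \<eta>_def)
  qed
  have rear\<eta>: "rear \<eta> = - l * front \<zeta>"
    using l by (simp add: rear_def front_def \<eta>_def Z_def[symmetric] power2_eq_square field_simps)
  have fb: "front \<zeta> \<le> - 3/2" "- 15/2 \<le> front \<zeta>" and rb: "0 < rear \<eta>" "rear \<eta> \<le> 9/2"
    using front_bounds[of \<zeta>] rear_bounds[of \<eta>] \<zeta> \<eta> by auto
  have along: "pt (d + front \<zeta>) y (\<sigma> * \<zeta>) + t *\<^sub>R u =
      pt (d + (1 - t / r) * front \<zeta>) y (\<sigma> * (\<zeta> - (t / r) * Z))" for t
    unfolding u_def pt_scaleR pt_add pt_eq_iff by (simp add: algebra_simps)
  have "T / r = 1 + l" using r by (simp add: T_def)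
  then have hit: "pt (d + front \<zeta>) y (\<sigma> * \<zeta>) + T *\<^sub>R u = pt (d + rear \<eta>) y (- \<sigma> * \<eta>)"
    unfolding along pt_eq_iff rear\<eta> by (simp add: \<eta>_def Z_def algebra_simps)
  have fly: "pt (d + front \<zeta>) y (\<sigma> * \<zeta>) + t *\<^sub>R u \<notin> device" if "0 < t" "t < T" for t
  proof -
    define \<theta> where "\<theta> = t / r"
    have \<theta>: "0 < \<theta>" "\<theta> < 1 + l" using that r by (auto simp: \<theta>_def T_def field_simps)
    have "\<bar>(1 - \<theta>) * front \<zeta>\<bar> \<le> 8"
    proof (cases "\<theta> \<le> 1")
      case True
      then have "\<bar>(1 - \<theta>) * front \<zeta>\<bar> \<le> 1 * (15/2)"
        unfolding abs_mult using \<theta> fb by (intro mult_mono) auto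
      then show ?thesis by simp
    next
      case False
      have "(\<theta> - 1) * (- front \<zeta>) \<le> l * (- front \<zeta>)"
        using \<theta> fb by (intro mult_right_mono) auto
      moreover have "0 \<le> (\<theta> - 1) * (- front \<zeta>)"
        using False fb by (intro mult_nonneg_nonneg) auto
      moreover have "(\<theta> - 1) * (- front \<zeta>) = (1 - \<theta>) * front \<zeta>" by (simp add: algebra_simps)
      ultimately show ?thesis using rb rear\<eta> by (simp add: abs_le_iff)
    qed
    then have near: "\<bar>d + (1 - \<theta>) * front \<zeta> - d\<bar> \<le> 8" by simp
    show ?thesis
      unfolding along \<theta>_def[symmetric] device_near[OF d near y] abs\<sigma>
      using confocal_flight[OF \<zeta> \<theta>] unfolding Z_def[symmetric]
      by (cases "0 \<le> \<zeta> - \<theta> * Z") (auto simp: not_le)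
  qed
  have n1: "norm n = 1"
    using unit_normal_front[OF d \<sigma> y \<zeta>] unfolding n_def Z_def unit_normal_def by blast
  have u: "u = elastic_reflection n e"
  proof -
    have en: "e \<bullet> n = 1 / sqrt (1 + Z\<^sup>2)" by (simp add: n_def inner_commute[of e])
    have "elastic_reflection n e = pt 1 0 0 - (2 / (1 + Z\<^sup>2)) *\<^sub>R pt 1 0 (\<sigma> * Z)"
      unfolding elastic_reflection_def en by (simp add: n_def e_eq_pt[symmetric] power2_eq_square[symmetric])
    also have "\<dots> = pt 1 0 0 - (1 / r) *\<^sub>R pt 1 0 (\<sigma> * Z)" by (simp add: r_def)
    also have "\<dots> = u"
      using r unfolding u_def pt_scaleR pt_diff pt_eq_iff
      by (simp add: front_def Z_def[symmetric] r_def field_simps)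
    finally show ?thesis ..
  qed
  have e: "e = elastic_reflection n u"
    unfolding u elastic_reflection_involution[OF n1] ..
  have P1: "pt (d - 8) y (\<sigma> * \<zeta>) + (8 + front \<zeta>) *\<^sub>R e = pt (d + front \<zeta>) y (\<sigma> * \<zeta>)"
    unfolding pt_add_e by simp
  have mid: "pt (d + front \<zeta>) y (\<sigma> * \<zeta>) + (T / 2) *\<^sub>R u + t *\<^sub>R u =
      pt (d + front \<zeta>) y (\<sigma> * \<zeta>) + (T / 2 + t) *\<^sub>R u" for t
    by (simp add: scaleR_add_left)
  have P3: "pt (d + rear \<eta>) y (- \<sigma> * \<eta>) + (8 - rear \<eta>) *\<^sub>R e = pt (d + 8) y (- \<sigma> * \<eta>)"
    unfolding pt_add_e by simp
  have normal2: "unit_normal (frontier device) (pt (d + rear \<eta>) y (- \<sigma> * \<eta>)) n"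
  proof -
    have "- \<sigma> = 1 \<or> - \<sigma> = - 1" using \<sigma> by auto
    from unit_normal_rear[OF d this y \<eta>] show ?thesis using l by (simp add: \<eta>_def n_def)
  qed
  have normal1: "unit_normal (frontier device) (pt (d + front \<zeta>) y (\<sigma> * \<zeta>)) n"
    using unit_normal_front[OF d \<sigma> y \<zeta>] by (simp add: n_def Z_def)
  have out1: "pt (d - 8) y (\<sigma> * \<zeta>) + t *\<^sub>R e \<notin> device" if "0 \<le> t" "t < 8 + front \<zeta>" for t
  proof -
    have "\<bar>d - 8 + t - d\<bar> \<le> 8" using that fb by simp
    then show ?thesis
      unfolding pt_add_e using that \<zeta> by (simp add: device_near[OF d _ y] abs\<sigma>)
  qed
  have out2: "pt (d + rear \<eta>) y (- \<sigma> * \<eta>) + t *\<^sub>R e \<notin> device" if "0 < t" "t \<le> 8 - rear \<eta>" for t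
  proof -
    have "\<bar>d + rear \<eta> + t - d\<bar> \<le> 8" using that rb by simp
    then show ?thesis
      unfolding pt_add_e using that \<eta> by (simp add: device_near[OF d _ y] abs\<sigma>)
  qed
  have "orbit device (pt (d + front \<zeta>) y (\<sigma> * \<zeta>) + (T / 2) *\<^sub>R u) u p' v'"
  proof (rule orbit.bounce[where \<tau>="T / 2" and n=n and w=e and \<sigma>="8 - rear \<eta>"])
    show "orbit device (pt (d + front \<zeta>) y (\<sigma> * \<zeta>) + (T / 2) *\<^sub>R u + (T / 2) *\<^sub>R u + (8 - rear \<eta>) *\<^sub>R e) e p' v'"
      unfolding mid field_sum_of_halves hit P3 using next_orbit by (simp only: \<eta>_def Z_def)
    show "0 < T / 2" "0 < 8 - rear \<eta>" using T rb by auto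
    show "\<forall>t\<in>{0..<T / 2}. pt (d + front \<zeta>) y (\<sigma> * \<zeta>) + (T / 2) *\<^sub>R u + t *\<^sub>R u \<notin> closure device"
      unfolding mid using fly T by simp
    show "unit_normal (frontier device) (pt (d + front \<zeta>) y (\<sigma> * \<zeta>) + (T / 2) *\<^sub>R u + (T / 2) *\<^sub>R u) n"
      unfolding mid field_sum_of_halves hit by (rule normal2)
    then show "pt (d + front \<zeta>) y (\<sigma> * \<zeta>) + (T / 2) *\<^sub>R u + (T / 2) *\<^sub>R u \<in> frontier device"
      by (simp add: unit_normal_def)
    show "\<forall>t\<in>{0<..8 - rear \<eta>}.
        pt (d + front \<zeta>) y (\<sigma> * \<zeta>) + (T / 2) *\<^sub>R u + (T / 2) *\<^sub>R u + t *\<^sub>R e \<notin> closure device"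
      unfolding mid field_sum_of_halves hit using out2 by simp
  qed (rule e)
  then have start2: "orbit device (pt (d - 8) y (\<sigma> * \<zeta>) + (8 + front \<zeta>) *\<^sub>R e + (T / 2) *\<^sub>R u) u p' v'"
    unfolding P1 .
  show ?thesis
  proof (rule orbit.bounce[OF _ _ _ _ u _ _ start2])
    show "0 < 8 + front \<zeta>" "0 < T / 2" using T fb by auto
    show "\<forall>t\<in>{0..<8 + front \<zeta>}. pt (d - 8) y (\<sigma> * \<zeta>) + t *\<^sub>R e \<notin> closure device"
      using out1 by simp
    show "unit_normal (frontier device) (pt (d - 8) y (\<sigma> * \<zeta>) + (8 + front \<zeta>) *\<^sub>R e) n"
      unfolding P1 by (rule normal1)
    then show "pt (d - 8) y (\<sigma> * \<zeta>) + (8 + front \<zeta>) *\<^sub>R e \<in> frontier device"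
      by (simp add: unit_normal_def)
    show "\<forall>t\<in>{0<..T / 2}. pt (d - 8) y (\<sigma> * \<zeta>) + (8 + front \<zeta>) *\<^sub>R e + t *\<^sub>R u \<notin> closure device"
      unfolding P1 using fly T by simp
  qed
qed

section \<open>The outcome for all incoming particles\<close>

lemma outside_left: "x < - 15/2 \<Longrightarrow> pt x y z \<notin> device"
  using D(3) front_bounds[of "\<bar>z\<bar>"] unfolding pt_mem_device by force

lemma outside_right:
  assumes "y \<noteq> 0" "\<And>d. d \<in> D \<Longrightarrow> d + 8 \<le> x" shows "pt x y z \<notin> device"
  using assms rear_bounds[of "\<bar>z\<bar>"] unfolding pt_mem_device by force

lemma outside_beside:
  assumes "y < 0 \<or> 1 < y \<or> 3 < \<bar>z\<bar> \<or> y \<noteq> 0 \<and> \<bar>z\<bar> < 2" shows "pt x y z \<notin> device"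
  using assms unfolding pt_mem_device by auto

text \<open>
  All particles arriving at \<open>(y, z)\<close> leave with velocity \<open>e\<close> at \<open>(y, z')\<close>. The starting position along the line
  only shifts the time.
\<close>

definition passes :: "real \<Rightarrow> real \<Rightarrow> real \<Rightarrow> bool" where
  "passes y z z' \<longleftrightarrow> (\<forall>a. \<exists>T. scatters device (pt a y z) e (pt T y z') e)"

lemma passes_if_orbit:
  assumes "orbit device (pt (- 8) y z) e (pt b y z') e" shows "passes y z z'"
  unfolding passes_def
proof
  fix a
  have "pt a y z + (- 8 - a) *\<^sub>R e = pt (- 8) y z" unfolding pt_add_e by simp
  then have "\<exists>T. scatters device (pt a y z) e (pt b y z' - T *\<^sub>R e) e"
    using orbit_scatters[of device "pt a y z" "- 8 - a" e "pt b y z'" e] assms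
    by (simp add: pt_add_e outside_left)
  then obtain T where "scatters device (pt a y z) e (pt b y z' - T *\<^sub>R e) e" by blast
  moreover have "pt b y z' - T *\<^sub>R e = pt (b - T) y z'" using pt_add_e[of b y z' "- T"] by simp
  ultimately show "\<exists>T. scatters device (pt a y z) e (pt T y z') e" by metis
qed

lemma passes_straight:
  assumes "y < 0 \<or> 1 < y \<or> 3 < \<bar>z\<bar> \<or> y \<noteq> 0 \<and> \<bar>z\<bar> < 2" shows "passes y z z"
  using outside_beside[OF assms] by (intro passes_if_orbit[where b = "- 8"] orbit.escape) (simp add: pt_add_e)

lemma orbit_leaves:
  assumes "0 < y" "\<And>d. d \<in> D \<Longrightarrow> d + 8 \<le> x"
  shows "orbit device (pt x y z) e (pt x y z) e"
proof (intro orbit.escape allI impI)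
  fix t :: real assume "0 \<le> t"
  then have "d + 8 \<le> x + t" if "d \<in> D" for d using assms(2)[OF that] by simp
  then show "pt x y z + t *\<^sub>R e \<notin> closure device"
    using outside_right[of y "x + t" z] assms(1) by (simp add: pt_add_e)
qed

lemma passes_one_piece:
  assumes "D = {0}" "\<sigma> = 1 \<or> \<sigma> = - 1" "0 < y" "y < 1" "2 < \<zeta>" "\<zeta> < 3"
  shows "passes y (\<sigma> * \<zeta>) (- \<sigma> * (c + l * (\<zeta> + c)))"
  using orbit_through_device[OF D(2) assms(2-6) orbit_leaves] assms(1,3)
  by (intro passes_if_orbit[where b = 8]) simp

lemma passes_two_pieces:
  assumes "D = {0, 16}" "\<sigma> = 1 \<or> \<sigma> = - 1" "0 < y" "y < 1" "2 < \<zeta>" "\<zeta> < 3" and cl01: "c = 0" "l = 1"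
  shows "passes y (\<sigma> * \<zeta>) (\<sigma> * \<zeta>)"
proof (rule passes_if_orbit)
  have \<sigma>': "- \<sigma> = 1 \<or> - \<sigma> = - 1" using assms(2) by auto
  have "orbit device (pt 24 y (\<sigma> * \<zeta>)) e (pt 24 y (\<sigma> * \<zeta>)) e"
    using assms by (intro orbit_leaves) auto
  then have "orbit device (pt 8 y (- \<sigma> * \<zeta>)) e (pt 24 y (\<sigma> * \<zeta>)) e"
    using orbit_through_device[of 16 "- \<sigma>" y \<zeta>] \<sigma>' assms by simp
  then show "orbit device (pt (- 8) y (\<sigma> * \<zeta>)) e (pt 24 y (\<sigma> * \<zeta>)) e"
    using orbit_through_device[OF D(2) assms(2-6)] cl01 by simp
qed

lemma passes_outcome:
  assumes "passes y z z'"
  shows "scattering_defined device (pt a y z) e" "v_plus device (pt a y z) e = e"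
    "x_tilde_plus device (pt a y z) e = pt 0 y z'"
proof -
  obtain T where T: "scatters device (pt a y z) e (pt T y z') e"
    using assms unfolding passes_def by blast
  then show "scattering_defined device (pt a y z) e" unfolding scattering_defined_def by blast
  show v: "v_plus device (pt a y z) e = e"
    unfolding v_plus_def using T scatters_unique by (intro the_equality) blast+
  have x: "x_plus device (pt a y z) e = pt T y z'"
    unfolding x_plus_def using T scatters_unique by (intro the_equality) blast+
  show "x_tilde_plus device (pt a y z) e = pt 0 y z'"
    unfolding x_tilde_plus_def v x using pt_add_e[of T y z' "- T"] by simp
qed

text \<open>
  The particles whose first contact with the body is on an edge.
\<close>

definition exceptional :: "real \<Rightarrow> real \<Rightarrow> bool" where
  "exceptional y z \<longleftrightarrow> y = 0 \<and> \<bar>z\<bar> \<le> 3 \<or> y = 1 \<and> 2 \<le> \<bar>z\<bar> \<and> \<bar>z\<bar> \<le> 3 \<or> 0 < y \<and> y < 1 \<and> (\<bar>z\<bar> = 2 \<or> \<bar>z\<bar> = 3)"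

lemma not_exceptional_cases:
  assumes "\<not> exceptional y z"
  obtains "y < 0 \<or> 1 < y \<or> 3 < \<bar>z\<bar> \<or> y \<noteq> 0 \<and> \<bar>z\<bar> < 2"
  | \<sigma> \<zeta> where "\<sigma> = 1 \<or> \<sigma> = - 1" "z = \<sigma> * \<zeta>" "0 < y" "y < 1" "2 < \<zeta>" "\<zeta> < 3"
proof (cases "0 < y \<and> y < 1 \<and> 2 < \<bar>z\<bar> \<and> \<bar>z\<bar> < 3")
  case True
  then show ?thesis using that(2)[of "sgn z" "\<bar>z\<bar>"] by (cases "z > 0") (auto simp: sgn_if)
next
  case False
  then show ?thesis using that(1) assms unfolding exceptional_def by linarith
qed

text \<open>
  The criterion for singular points in the form in which it is applied: a curve \<open>\<gamma>\<close> in the surface starts at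
  \<open>p\<close> and leaves the half-space boundary at a positive rate.
\<close>

lemma singular_if_leaves_to_one_side:
  assumes "0 < r" and side: "\<And>q. q \<in> device \<Longrightarrow> norm (q - p) < r \<Longrightarrow> 0 \<le> m \<bullet> (q - p)"
    and "0 < C" "0 < M"
    and curve: "\<And>s. 0 < s \<Longrightarrow> s < 1 \<Longrightarrow> \<gamma> s \<in> frontier device"
      "\<And>s. 0 < s \<Longrightarrow> s < 1 \<Longrightarrow> C * s \<le> m \<bullet> (\<gamma> s - p)"
      "\<And>s. 0 < s \<Longrightarrow> s < 1 \<Longrightarrow> norm (\<gamma> s - p) \<le> M * s"
  shows "\<not> unit_normal (frontier device) p n"
proof (rule not_unit_normal_if_one_sided[where m = m and d = r and C = "C / M"])
  show "0 \<le> m \<bullet> (q - p)" if "q \<in> frontier device" "norm (q - p) < r" for q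
    using side that frontier_subset_device by blast
  show "\<exists>q\<in>frontier device. 0 < norm (q - p) \<and> norm (q - p) < d' \<and> C / M * norm (q - p) \<le> m \<bullet> (q - p)"
    if "0 < d'" for d'
  proof -
    define s where "s = min (1/2) (d' / (2 * M))"
    have s: "0 < s" "s < 1" "M * s < d'"
      using that assms(4) by (auto simp: s_def min_def field_simps)
    have Cs: "0 < C * s" using s assms(3) by simp
    then have "\<gamma> s \<noteq> p" using curve(2)[OF s(1,2)] by auto
    moreover have "norm (\<gamma> s - p) < d'" using curve(3)[OF s(1,2)] s(3) by linarith
    moreover have "C / M * norm (\<gamma> s - p) \<le> C / M * (M * s)"
      using curve(3)[OF s(1,2)] assms(3,4) by (intro mult_left_mono) auto
    then have "C / M * norm (\<gamma> s - p) \<le> m \<bullet> (\<gamma> s - p)"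
      using curve(2)[OF s(1,2)] assms(4) by simp
    ultimately show ?thesis using curve(1)[OF s(1,2)] by (intro bexI[of _ "\<gamma> s"]) auto
  qed
qed (use assms in auto)

lemma front_difference: "front \<zeta> - front \<zeta>' = (\<zeta>' - \<zeta>) * (\<zeta>' + \<zeta> + 2 * c) / 2"
  by (simp add: front_def power2_eq_square field_simps)

lemma front_lipschitz:
  assumes "2 \<le> \<zeta>" "\<zeta> \<le> 3" "2 \<le> \<zeta>'" "\<zeta>' \<le> 3"
  shows "\<bar>front \<zeta> - front \<zeta>'\<bar> \<le> 4 * \<bar>\<zeta> - \<zeta>'\<bar>"
proof -
  have "\<bar>\<zeta>' - \<zeta>\<bar> * \<bar>\<zeta>' + \<zeta> + 2 * c\<bar> \<le> \<bar>\<zeta>' - \<zeta>\<bar> * 8"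
    using assms c by (intro mult_left_mono) auto
  then show ?thesis unfolding front_difference by (simp add: abs_mult abs_minus_commute)
qed

lemma pt_front_mem_frontier:
  assumes "0 \<le> y" "y \<le> 1" "2 \<le> \<zeta>" "\<zeta> \<le> 3" "\<bar>z\<bar> = \<zeta>"
  shows "pt (front \<zeta>) y z \<in> frontier device"
proof -
  have 1: "\<bar>front \<zeta> - 0\<bar> \<le> 8" using front_bounds[OF assms(3,4)] by simp
  show ?thesis
    unfolding pt_mem_frontier pt_mem_device pt_mem_interior
    using only_near_piece[OF D(2) 1 assms(3,4)] front_bounds[OF assms(3,4)] rear_bounds[OF assms(3,4)] assms
    by auto
qed

text \<open>
  The body lies in \<open>0 \<le> y \<le> 1\<close>, which makes the edges \<open>y = 0\<close> and \<open>y = 1\<close> one-sided. Near the edges at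
  \<open>\<bar>z\<bar> = 2\<close> and \<open>\<bar>z\<bar> = 3\<close> with \<open>0 < y < 1\<close>, only a solid is present, and it lies on one side of a plane
  \<open>z = const\<close>. For \<open>\<bar>z\<bar> < 2\<close> the contact is with the front edge of the plate, and the plate extends in
  the direction of \<open>e\<close> only.
\<close>

lemma exceptional_not_scattering_defined:
  assumes "exceptional y z" shows "\<not> scattering_defined device (pt a y z) e"
proof -
  have first_hit: "\<not> scattering_defined device (pt a y z) e"
    if "\<And>x. x < b \<Longrightarrow> pt x y z \<notin> device" "pt b y z \<in> frontier device"
      "\<And>n. \<not> unit_normal (frontier device) (pt b y z) n" for b
    using that by (intro not_scattering_defined_if_singular_hit[where \<tau> = "b - a"]) (simp_all add: pt_add_e)
  have before_front: "pt x y z \<notin> device" if "x < front \<bar>z\<bar>" "2 \<le> \<bar>z\<bar>" "\<bar>z\<bar> \<le> 3" for x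
    using that front_bounds(1)[OF that(2,3)] D(3) unfolding pt_mem_device by force
  have side: "0 \<le> q \<bullet> f" "q \<bullet> f \<le> 1" if "q \<in> device" for q
    using that unfolding device_def by (auto simp: solid_def plate_def)
  consider (low) "y = 0" "2 \<le> \<bar>z\<bar>" "\<bar>z\<bar> \<le> 3" | (high) "y = 1" "2 \<le> \<bar>z\<bar>" "\<bar>z\<bar> \<le> 3"
    | (plate) "y = 0" "\<bar>z\<bar> < 2" | (inner) "0 < y" "y < 1" "\<bar>z\<bar> = 2" | (outer) "0 < y" "y < 1" "\<bar>z\<bar> = 3"
    using assms unfolding exceptional_def by linarith
  then show ?thesis
  proof cases
    case low
    show ?thesis
    proof (rule first_hit[OF before_front pt_front_mem_frontier])
      show "\<not> unit_normal (frontier device) (pt (front \<bar>z\<bar>) y z) n" for n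
        using low side
        by (intro singular_if_leaves_to_one_side[where r = 1 and m = f and C = 1 and M = 1
              and \<gamma> = "\<lambda>s. pt (front \<bar>z\<bar>) s z"] pt_front_mem_frontier)
           (auto simp: pt_diff inner_commute[of f] inner_diff_left norm_pt)
    qed (use low in auto)
  next
    case high
    show ?thesis
    proof (rule first_hit[OF before_front pt_front_mem_frontier])
      show "\<not> unit_normal (frontier device) (pt (front \<bar>z\<bar>) y z) n" for n
        using high side
        by (intro singular_if_leaves_to_one_side[where r = 1 and m = "- f" and C = 1 and M = 1
              and \<gamma> = "\<lambda>s. pt (front \<bar>z\<bar>) (1 - s) z"] pt_front_mem_frontier)
           (auto simp: pt_diff inner_commute[of f] inner_diff_left norm_pt)
    qed (use high in auto)
  next
    case plate
    have mem: "pt x 0 z \<in> frontier device" if "- 1 \<le> x" "x \<le> 20" for x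
      using that plate unfolding pt_mem_frontier pt_mem_device pt_mem_interior by auto
    show ?thesis
    proof (rule first_hit[of "- 1"])
      show "pt x y z \<notin> device" if "x < - 1" for x
        using that plate unfolding pt_mem_device by auto
      show "pt (- 1) y z \<in> frontier device" using mem plate by simp
      show "\<not> unit_normal (frontier device) (pt (- 1) y z) n" for n
      proof (rule singular_if_leaves_to_one_side[where r = "2 - \<bar>z\<bar>" and m = e and C = 1 and M = 1
              and \<gamma> = "\<lambda>s. pt (- 1 + s) 0 z"])
        show "0 \<le> e \<bullet> (q - pt (- 1) y z)" if "q \<in> device" "norm (q - pt (- 1) y z) < 2 - \<bar>z\<bar>" for q
        proof -
          have "\<bar>(q - pt (- 1) y z) \<bullet> k\<bar> < 2 - \<bar>z\<bar>" using coord_le_norm(3) that(2) by (rule le_less_trans)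
          then have "\<bar>q \<bullet> k\<bar> < 2" by (simp add: inner_diff_left)
          then have "- 1 \<le> q \<bullet> e" using that(1) pt_mem_device[of "q \<bullet> e" "q \<bullet> f" "q \<bullet> k"] by auto
          then show ?thesis by (simp add: inner_commute[of e] inner_diff_left)
        qed
      qed (use plate mem in \<open>auto simp: pt_diff inner_commute[of e] norm_pt\<close>)
    qed
  next
    case inner
    define \<sigma> where "\<sigma> = sgn z"
    have \<sigma>: "\<sigma> = 1 \<or> \<sigma> = - 1" "z = \<sigma> * 2" using inner by (auto simp: \<sigma>_def sgn_if abs_if split: if_splits)
    show ?thesis
    proof (rule first_hit[OF before_front pt_front_mem_frontier])
      show "\<not> unit_normal (frontier device) (pt (front \<bar>z\<bar>) y z) n" for n
      proof (rule singular_if_leaves_to_one_side[where r = "min y 1" and m = "\<sigma> *\<^sub>R k" and C = 1 and M = 5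
              and \<gamma> = "\<lambda>s. pt (front (2 + s)) y (\<sigma> * (2 + s))"])
        show "0 \<le> (\<sigma> *\<^sub>R k) \<bullet> (q - pt (front \<bar>z\<bar>) y z)"
          if "q \<in> device" "norm (q - pt (front \<bar>z\<bar>) y z) < min y 1" for q
        proof -
          have "\<bar>q \<bullet> f - y\<bar> < min y 1" "\<bar>q \<bullet> k - z\<bar> < min y 1"
            using le_less_trans[OF coord_le_norm(2) that(2)] le_less_trans[OF coord_le_norm(3) that(2)]
            by (simp_all add: inner_diff_left)
          then have q: "q \<bullet> f > 0" "\<bar>q \<bullet> k - z\<bar> < 1" by auto
          then have "2 \<le> \<bar>q \<bullet> k\<bar>" using that(1) pt_mem_device[of "q \<bullet> e" "q \<bullet> f" "q \<bullet> k"] by auto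
          then have "2 \<le> \<sigma> * (q \<bullet> k)" using \<sigma> q(2) by auto
          then show ?thesis using \<sigma> by (auto simp: inner_commute[of k] inner_diff_left)
        qed
        show "norm (pt (front (2 + s)) y (\<sigma> * (2 + s)) - pt (front \<bar>z\<bar>) y z) \<le> 5 * s" if "0 < s" "s < 1" for s
        proof -
          have "\<bar>\<sigma> * (2 + s) - z\<bar> = s" using \<sigma> that by auto
          then show ?thesis
            using norm_pt_le[of "front (2 + s) - front \<bar>z\<bar>" "y - y" "\<sigma> * (2 + s) - z"]
              front_lipschitz[of "2 + s" 2] that inner(3) by (simp add: pt_diff)
        qed
        show "pt (front (2 + s)) y (\<sigma> * (2 + s)) \<in> frontier device" if "0 < s" "s < 1" for s
          using that inner \<sigma> by (intro pt_front_mem_frontier) auto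
        show "1 * s \<le> (\<sigma> *\<^sub>R k) \<bullet> (pt (front (2 + s)) y (\<sigma> * (2 + s)) - pt (front \<bar>z\<bar>) y z)" if "0 < s" "s < 1" for s
          using \<sigma> by (auto simp: pt_diff inner_commute[of k])
      qed (use inner in auto)
    qed (use inner in auto)
  next
    case outer
    define \<sigma> where "\<sigma> = sgn z"
    have \<sigma>: "\<sigma> = 1 \<or> \<sigma> = - 1" "z = \<sigma> * 3" using outer by (auto simp: \<sigma>_def sgn_if abs_if split: if_splits)
    show ?thesis
    proof (rule first_hit[OF before_front pt_front_mem_frontier])
      show "\<not> unit_normal (frontier device) (pt (front \<bar>z\<bar>) y z) n" for n
      proof (rule singular_if_leaves_to_one_side[where r = 1 and m = "- (\<sigma> *\<^sub>R k)" and C = 1 and M = 5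
              and \<gamma> = "\<lambda>s. pt (front (3 - s)) y (\<sigma> * (3 - s))"])
        show "0 \<le> (- (\<sigma> *\<^sub>R k)) \<bullet> (q - pt (front \<bar>z\<bar>) y z)"
          if "q \<in> device" "norm (q - pt (front \<bar>z\<bar>) y z) < 1" for q
        proof -
          have "\<bar>q \<bullet> k\<bar> \<le> 3" using that(1) pt_mem_device[of "q \<bullet> e" "q \<bullet> f" "q \<bullet> k"] by auto
          then show ?thesis using \<sigma> by (auto simp: inner_commute[of k] inner_diff_left)
        qed
        show "norm (pt (front (3 - s)) y (\<sigma> * (3 - s)) - pt (front \<bar>z\<bar>) y z) \<le> 5 * s" if "0 < s" "s < 1" for s
        proof -
          have "\<bar>\<sigma> * (3 - s) - z\<bar> = s" using \<sigma> that by auto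
          then show ?thesis
            using norm_pt_le[of "front (3 - s) - front \<bar>z\<bar>" "y - y" "\<sigma> * (3 - s) - z"]
              front_lipschitz[of "3 - s" 3] that outer(3) by (simp add: pt_diff)
        qed
        show "pt (front (3 - s)) y (\<sigma> * (3 - s)) \<in> frontier device" if "0 < s" "s < 1" for s
          using that outer \<sigma> by (intro pt_front_mem_frontier) auto
        show "1 * s \<le> (- (\<sigma> *\<^sub>R k)) \<bullet> (pt (front (3 - s)) y (\<sigma> * (3 - s)) - pt (front \<bar>z\<bar>) y z)" if "0 < s" "s < 1" for s
          using \<sigma> by (auto simp: pt_diff inner_commute[of k])
      qed (use outer in auto)
    qed (use outer in auto)
  qed
qed

end

section \<open>Measure in the plane of incoming particles\<close>

lemma plane_chart_isometry:
  assumes "v \<noteq> 0"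
  shows "linear (plane_chart v)" "norm (plane_chart v z) = norm z" "range (plane_chart v) = {v}\<^sup>\<bottom>"
    "inj (plane_chart v)"
proof -
  let ?P = "\<lambda>L :: real^2 \<Rightarrow> real^3. linear L \<and> (\<forall>z. norm (L z) = norm z) \<and> range L = {v}\<^sup>\<bottom>"
  have *: "?P (plane_chart v)"
    unfolding plane_chart_def using someI_ex[OF plane_chart_exists[OF assms]] .
  then show "linear (plane_chart v)" "norm (plane_chart v z) = norm z" "range (plane_chart v) = {v}\<^sup>\<bottom>"
    by auto
  show "inj (plane_chart v)"
    using * by (metis linear_injective_0 norm_eq_zero)
qed

lemma lebesgue_sets_cong_negligible:
  fixes S A N :: "'a::euclidean_space set"
  assumes A: "A \<in> sets lebesgue" and N: "negligible N" and eq: "\<And>w. w \<notin> N \<Longrightarrow> w \<in> S \<longleftrightarrow> w \<in> A"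
  shows "S \<in> sets lebesgue" "emeasure lebesgue S = emeasure lebesgue A"
proof -
  have "S = (A - N) \<union> (S \<inter> N)" using eq by blast
  moreover have "negligible (S \<inter> N)" using N negligible_subset by blast
  ultimately show S: "S \<in> sets lebesgue" using A N negligible_imp_sets by (metis sets.Diff sets.Un)
  have "AE w in lebesgue. w \<in> S \<longleftrightarrow> w \<in> A"
    by (rule AE_I'[of N]) (use N eq in \<open>auto simp: negligible_iff_null_sets\<close>)
  then show "emeasure lebesgue S = emeasure lebesgue A" by (rule emeasure_eq_AE) (use S A in auto)
qed

text \<open>
  In the coordinates of the plane chart, a scattering map that coincides almost everywhere with a
  measure-preserving map \<open>\<tau>\<close> leaves no trace; completeness of Lebesgue measure takes care of the null set.
\<close>

lemma leaves_no_trace_if_planar_map: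
  fixes \<tau> :: "real^2 \<Rightarrow> real^2"
  assumes v: "v \<noteq> 0" and zr: "zero_resistance B v" and N: "negligible N"
    and out: "\<And>w. w \<notin> N \<Longrightarrow> scattering_defined B (plane_chart v w) v \<and>
      x_tilde_plus B (plane_chart v w) v = plane_chart v (\<tau> w)"
    and \<tau>: "\<And>A. A \<in> sets lebesgue \<Longrightarrow> \<tau> -` A \<in> sets lebesgue \<and> emeasure lebesgue (\<tau> -` A) = emeasure lebesgue A"
  shows "leaves_no_trace B v"
  unfolding leaves_no_trace_def
proof (intro conjI ballI zr)
  let ?L = "plane_chart v"
  note L = plane_chart_isometry[OF v]
  have "AE w in lebesgue. scattering_defined B (?L w) v \<and> x_tilde_plus B (?L w) v \<in> {v}\<^sup>\<bottom>"
  proof (rule AE_I'[of N])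
    show "N \<in> null_sets lebesgue" using N by (simp add: negligible_iff_null_sets)
    have "scattering_defined B (?L w) v \<and> x_tilde_plus B (?L w) v \<in> {v}\<^sup>\<bottom>" if "w \<notin> N" for w
      using out[OF that] L(3) by auto
    then show "{w \<in> space lebesgue. \<not> (scattering_defined B (?L w) v \<and> x_tilde_plus B (?L w) v \<in> {v}\<^sup>\<bottom>)} \<subseteq> N"
      by blast
  qed
  then show "AE x in plane_lebesgue v. scattering_defined B x v \<and> x_tilde_plus B x v \<in> {v}\<^sup>\<bottom>"
    unfolding plane_lebesgue_def by (simp add: AE_embed_measure[OF L(4)])
  fix A assume "A \<in> sets (plane_lebesgue v)"
  then obtain A' where A': "A' \<in> sets lebesgue" "A = ?L ` A'"
    unfolding plane_lebesgue_def using L(4) by (auto simp: sets_embed_measure)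
  define S' where "S' = {w. scattering_defined B (?L w) v \<and> x_tilde_plus B (?L w) v \<in> A}"
  have S: "{x \<in> {v}\<^sup>\<bottom>. scattering_defined B x v \<and> x_tilde_plus B x v \<in> A} = ?L ` S'"
    unfolding S'_def L(3)[symmetric] by auto
  have "w \<in> S' \<longleftrightarrow> w \<in> \<tau> -` A'" if "w \<notin> N" for w
    using out[OF that] by (simp add: S'_def A'(2) inj_image_mem_iff[OF L(4)])
  then have S': "S' \<in> sets lebesgue" "emeasure lebesgue S' = emeasure lebesgue A'"
    using lebesgue_sets_cong_negligible[of "\<tau> -` A'" N S'] \<tau>[OF A'(1)] N by simp_all
  show "{x \<in> {v}\<^sup>\<bottom>. scattering_defined B x v \<and> x_tilde_plus B x v \<in> A} \<in> sets (plane_lebesgue v)"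
    unfolding S plane_lebesgue_def by (rule in_sets_embed_measure[OF S'(1)])
  show "emeasure (plane_lebesgue v) {x \<in> {v}\<^sup>\<bottom>. scattering_defined B x v \<and> x_tilde_plus B x v \<in> A} =
      emeasure (plane_lebesgue v) A"
    unfolding S unfolding A'(2) plane_lebesgue_def emeasure_embed_measure_image[OF L(4) S'(1)]
      emeasure_embed_measure_image[OF L(4) A'(1)] by (rule S'(2))
qed

text \<open>
  As the involution \<open>\<rho>\<close> maps \<open>R\<close> to itself, the preimage of \<open>A\<close> consists of \<open>A - R\<close> and of the isometric
  image of \<open>A \<inter> R\<close>.
\<close>

lemma piecewise_isometry_preserves_lebesgue:
  fixes R :: "(real^2) set"
  assumes \<rho>: "orthogonal_transformation \<rho>" "\<And>w. \<rho> (\<rho> w) = w"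
    and R: "R \<in> sets lebesgue" "bounded R" "\<rho> ` R \<subseteq> R" and A: "A \<in> sets lebesgue"
  shows "(\<lambda>w. if w \<in> R then \<rho> w else w) -` A \<in> sets lebesgue \<and>
    emeasure lebesgue ((\<lambda>w. if w \<in> R then \<rho> w else w) -` A) = emeasure lebesgue A"
proof -
  let ?C = "A \<inter> R"
  have C: "?C \<in> lmeasurable"
    using R A by (intro bounded_set_imp_lmeasurable) (auto intro: bounded_subset)
  have \<rho>C: "\<rho> ` ?C \<in> lmeasurable" "measure lebesgue (\<rho> ` ?C) = measure lebesgue ?C"
    using measurable_orthogonal_image[OF \<rho>(1) C] measure_orthogonal_image[OF \<rho>(1) C] by auto
  have split: "(\<lambda>w. if w \<in> R then \<rho> w else w) -` A = (A - R) \<union> \<rho> ` ?C" (is "?L = ?R")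
  proof
    show "?L \<subseteq> ?R"
    proof
      fix w assume w: "w \<in> ?L"
      show "w \<in> ?R"
      proof (cases "w \<in> R")
        case True
        then have "\<rho> w \<in> ?C" using w R(3) by auto
        then show ?thesis using \<rho>(2)[of w] by (metis UnI2 imageI)
      qed (use w in auto)
    qed
    show "?R \<subseteq> ?L" using R(3) \<rho>(2) by auto
  qed
  have sets: "A - R \<in> sets lebesgue" "\<rho> ` ?C \<in> sets lebesgue" "?C \<in> sets lebesgue"
    using A R(1) \<rho>C(1) C by auto
  have "emeasure lebesgue (\<rho> ` ?C) = emeasure lebesgue ?C"
    using C \<rho>C by (simp add: emeasure_eq_measure2)
  moreover have "emeasure lebesgue ((A - R) \<union> \<rho> ` ?C) = emeasure lebesgue (A - R) + emeasure lebesgue (\<rho> ` ?C)"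
    using sets R(3) by (intro plus_emeasure[symmetric]) auto
  moreover have "emeasure lebesgue ((A - R) \<union> ?C) = emeasure lebesgue (A - R) + emeasure lebesgue ?C"
    using sets by (intro plus_emeasure[symmetric]) auto
  moreover have "(A - R) \<union> ?C = A" by auto
  ultimately show ?thesis unfolding split using sets by auto
qed

context mirror_device
begin

section \<open>Three choices of the parameters\<close>

lemma zero_resistance_if_passes:
  assumes "\<And>y z. \<not> exceptional y z \<Longrightarrow> \<exists>z'. passes y z z'"
  shows "zero_resistance device e"
proof -
  let ?N = "{x. f \<bullet> x = 0} \<union> {x. f \<bullet> x = 1} \<union> {x. k \<bullet> x = 2} \<union> {x. k \<bullet> x = - 2} \<union> {x. k \<bullet> x = 3} \<union> {x. k \<bullet> x = - 3}"
  have "f \<noteq> 0" "k \<noteq> 0" using unit by (metis inner_zero_left zero_neq_one)+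
  then have "negligible ?N" by (intro negligible_Un negligible_hyperplane) auto
  moreover have "scattering_defined device x e \<and> v_plus device x e = e" if "x \<notin> ?N" for x
  proof -
    have "\<not> exceptional (x \<bullet> f) (x \<bullet> k)"
      using that by (auto simp: exceptional_def inner_commute)
    then obtain z' where "passes (x \<bullet> f) (x \<bullet> k) z'" using assms by blast
    from passes_outcome(1,2)[OF this, of "x \<bullet> e"] show ?thesis by simp
  qed
  ultimately show ?thesis
    unfolding zero_resistance_def negligible_iff_null_sets by (intro AE_I'[of ?N]) auto
qed

lemma negligible_exceptional: "negligible {w :: real^2. exceptional (w $ 1) (w $ 2)}"
proof -
  have "negligible {w :: real^2. w \<bullet> axis i 1 = a}" for i a
    using negligible_hyperplane[of "axis i 1 :: real^2" a] by (simp add: inner_commute axis_eq_0_iff)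
  then have "negligible {w :: real^2. w $ i = a}" for i a
    by (simp add: inner_axis)
  then have "negligible ({w :: real^2. w $ 1 = 0} \<union> {w. w $ 1 = 1} \<union> {w. w $ 2 = 2} \<union> {w. w $ 2 = - 2} \<union>
      {w. w $ 2 = 3} \<union> {w. w $ 2 = - 3})"
    by (intro negligible_Un) auto
  then show ?thesis by (rule negligible_subset) (auto simp: exceptional_def)
qed

text \<open>
  The outgoing height for a single device.
\<close>

definition shifted :: "real \<Rightarrow> real \<Rightarrow> real" where
  "shifted y z = (if 0 < y \<and> y < 1 \<and> 2 < \<bar>z\<bar> \<and> \<bar>z\<bar> < 3 then - sgn z * (c + l * (\<bar>z\<bar> + c)) else z)"

lemma passes_shifted:
  assumes "D = {0}" "\<not> exceptional y z" shows "passes y z (shifted y z)"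
  using assms(2)
proof (cases rule: not_exceptional_cases)
  case 1
  then have "shifted y z = z" by (auto simp: shifted_def)
  then show ?thesis using passes_straight[OF 1] by simp
next
  case (2 \<sigma> \<zeta>)
  then have "\<bar>z\<bar> = \<zeta>" "sgn z = \<sigma>" by auto
  then have "shifted y z = - \<sigma> * (c + l * (\<zeta> + c))" using 2 by (simp add: shifted_def)
  then show ?thesis using passes_one_piece[OF assms(1) 2(1,3-6)] 2(2) by simp
qed

lemma passes_unchanged:
  assumes "D = {0, 16}" "c = 0" "l = 1" "\<not> exceptional y z" shows "passes y z z"
  using assms(4)
  by (cases rule: not_exceptional_cases) (use passes_straight passes_two_pieces assms in auto)

text \<open>
  If the outgoing beams leave a strip free, the preimage of this strip is a null set although the strip has
  positive area.
\<close>

lemma leaves_trace_if_gap: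
  assumes chart: "\<And>w. plane_chart e w = pt 0 (w $ 1) (w $ 2)" and D0: "D = {0}" and gap: "2 < c + l * (2 + c)"
  shows "\<not> leaves_no_trace device e"
proof
  assume no_trace: "leaves_no_trace device e"
  let ?L = "plane_chart e"
  have "e \<noteq> 0" using unit by (metis inner_zero_left zero_neq_one)
  note L = plane_chart_isometry[OF this]
  (* The height of every reflected particle has absolute value at least b. *)
  define b where "b = min 3 (c + l * (2 + c))"
  define G :: "(real^2) set" where "G = {w. 0 < w $ 1 \<and> w $ 1 < 1 \<and> 2 < w $ 2 \<and> w $ 2 < b}"
  define S where "S = {x \<in> {e}\<^sup>\<bottom>. scattering_defined device x e \<and> x_tilde_plus device x e \<in> ?L ` G}"
  have "open G" unfolding G_def by (intro open_Collect_conj open_Collect_less continuous_intros)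
  then have "?L ` G \<in> sets (plane_lebesgue e)"
    unfolding plane_lebesgue_def by (intro in_sets_embed_measure) auto
  then have S: "S \<in> sets (plane_lebesgue e)" "emeasure (plane_lebesgue e) S = emeasure (plane_lebesgue e) (?L ` G)"
    using no_trace unfolding leaves_no_trace_def S_def by auto
  then obtain S' where S': "S' \<in> sets lebesgue" "S = ?L ` S'"
    unfolding plane_lebesgue_def using L(4) by (auto simp: sets_embed_measure)
  have "S' \<subseteq> {w. exceptional (w $ 1) (w $ 2)}"
  proof (rule ccontr)
    assume "\<not> S' \<subseteq> {w. exceptional (w $ 1) (w $ 2)}"
    then obtain w where w: "w \<in> S'" "\<not> exceptional (w $ 1) (w $ 2)" by blast
    let ?y = "w $ 1" and ?z = "w $ 2"
    have "x_tilde_plus device (?L w) e = pt 0 ?y (shifted ?y ?z)"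
      unfolding chart by (rule passes_outcome(3)[OF passes_shifted[OF D0 w(2)]])
    moreover have "x_tilde_plus device (?L w) e \<in> ?L ` G"
      using w(1) S'(2) unfolding S_def by blast
    ultimately obtain g where "g \<in> G" "pt 0 ?y (shifted ?y ?z) = ?L g" by (metis imageE)
    then have *: "0 < ?y" "?y < 1" "2 < shifted ?y ?z" "shifted ?y ?z < b"
      unfolding chart pt_eq_iff by (auto simp: G_def)
    show False
    proof (cases "2 < \<bar>?z\<bar> \<and> \<bar>?z\<bar> < 3")
      case True
      have "c + l * (2 + c) \<le> c + l * (\<bar>?z\<bar> + c)" using True l by simp
      moreover have "0 \<le> l * (\<bar>?z\<bar> + c)" using c l by simp
      then have "\<bar>shifted ?y ?z\<bar> = c + l * (\<bar>?z\<bar> + c)"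
        using True *(1,2) c by (auto simp: shifted_def abs_mult abs_sgn_eq)
      moreover have "b \<le> c + l * (2 + c)" by (simp add: b_def)
      ultimately show False using *(3,4) by linarith
    next
      case False
      then have "shifted ?y ?z = ?z" by (auto simp: shifted_def)
      then show False using *(3,4) False by (auto simp: b_def)
    qed
  qed
  then have "emeasure lebesgue S' = 0"
    using negligible_subset[OF negligible_exceptional] by (metis negligible_iff_null_sets null_setsD1)
  moreover have "emeasure (plane_lebesgue e) S = emeasure lebesgue S'"
    unfolding S'(2) plane_lebesgue_def by (rule emeasure_embed_measure_image[OF L(4) S'(1)])
  moreover have "emeasure (plane_lebesgue e) (?L ` G) = emeasure lebesgue G"
    unfolding plane_lebesgue_def using \<open>open G\<close> by (intro emeasure_embed_measure_image[OF L(4)]) auto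
  ultimately have "G \<in> null_sets lebesgue" using S(2) \<open>open G\<close> by (intro null_setsI) auto
  moreover have "vector [1/2, (2 + b) / 2] \<in> G" using gap by (auto simp: G_def b_def)
  ultimately show False
    using open_not_negligible[OF \<open>open G\<close>] by (auto simp: negligible_iff_null_sets)
qed

end

text \<open>
  With the axes taken from the plane chart, its values are points with vanishing first coordinate.
\<close>

lemma frame_of_plane_chart:
  assumes "norm v = 1"
  defines "f \<equiv> plane_chart v (axis 1 1)" and "k \<equiv> plane_chart v (axis 2 1)"
  shows "frame v f k" and "plane_chart v w = frame.pt v f k 0 (w $ 1) (w $ 2)"
proof -
  let ?L = "plane_chart v"
  have "v \<noteq> 0" using assms by auto
  note L = plane_chart_isometry[OF this]
  have vv: "v \<bullet> v = 1" using assms(1) by (simp add: norm_eq_1)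
  have inner: "?L x \<bullet> ?L y = x \<bullet> y" for x y
    by (simp add: dot_norm linear_add[OF L(1), symmetric] L(2))
  have perp: "v \<bullet> ?L x = 0" "?L x \<bullet> v = 0" for x
  proof -
    have "?L x \<in> {v}\<^sup>\<bottom>" using L(3) by blast
    then show "v \<bullet> ?L x = 0" "?L x \<bullet> v = 0"
      by (auto simp: orthogonal_comp_def orthogonal_def inner_commute)
  qed
  have L_eq: "?L w = (w $ 1) *\<^sub>R f + (w $ 2) *\<^sub>R k" for w
  proof -
    have "w = (w $ 1) *\<^sub>R axis 1 1 + (w $ 2) *\<^sub>R axis 2 1"
      by (simp add: vec_eq_iff forall_2 axis_def)
    then have "?L w = ?L ((w $ 1) *\<^sub>R axis 1 1 + (w $ 2) *\<^sub>R axis 2 1)" by simp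
    then show ?thesis by (simp add: linear_add[OF L(1)] linear_scale[OF L(1)] f_def k_def)
  qed
  have fk: "f \<bullet> f = 1" "k \<bullet> k = 1" "f \<bullet> k = 0" "k \<bullet> f = 0"
    by (simp_all add: f_def k_def inner inner_axis_axis)
  show frame: "frame v f k"
  proof
    show "p = (p \<bullet> v) *\<^sub>R v + (p \<bullet> f) *\<^sub>R f + (p \<bullet> k) *\<^sub>R k" for p
    proof -
      define q where "q = p - (p \<bullet> v) *\<^sub>R v"
      have "v \<bullet> q = 0" using vv by (simp add: q_def inner_diff_right inner_commute)
      then have "q \<in> {v}\<^sup>\<bottom>" by (auto simp: orthogonal_comp_def orthogonal_def)
      then obtain w where w: "q = ?L w" using L(3) by blast
      have "v \<bullet> f = 0" "v \<bullet> k = 0" by (simp_all add: f_def k_def perp)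
      then have "p \<bullet> f = q \<bullet> f" "p \<bullet> k = q \<bullet> k" by (simp_all add: q_def inner_diff_left)
      then have "p \<bullet> f = w $ 1" "p \<bullet> k = w $ 2"
        using fk by (simp_all add: w L_eq inner_add_left)
      then show ?thesis using L_eq[of w] w by (simp add: q_def algebra_simps)
    qed
  qed (use vv fk perp in \<open>auto simp: f_def k_def\<close>)
  show "?L w = frame.pt v f k 0 (w $ 1) (w $ 2)"
    by (simp add: frame.pt_def[OF frame] L_eq)
qed

lemma planar_reflection: "orthogonal_transformation (\<lambda>w :: real^2. vector [w $ 1, - w $ 2] :: real^2)"
  unfolding orthogonal_transformation
  by (intro conjI allI linearI) (simp_all add: vec_eq_iff forall_2 norm_eq_sqrt_inner inner_vec_def sum_2)

theorem theorem1:
  fixes v0 :: "real^3"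
  assumes "norm v0 = 1"
  shows "(\<exists>B. body B \<and> zero_resistance B v0 \<and> \<not> leaves_no_trace B v0) \<and>
         (\<exists>B. body B \<and> leaves_no_trace B v0 \<and> \<not> invisible B v0) \<and>
         (\<exists>B. body B \<and> invisible B v0)"
proof -
  define f where "f = plane_chart v0 (axis 1 1)"
  define k where "k = plane_chart v0 (axis 2 1)"
  interpret frame v0 f k
    unfolding f_def k_def by (rule frame_of_plane_chart(1)[OF assms])
  have chart: "plane_chart v0 w = pt 0 (w $ 1) (w $ 2)" for w
    unfolding f_def k_def by (rule frame_of_plane_chart(2)[OF assms])
  have v0: "v0 \<noteq> 0" using assms by auto
  (* A compresses the beams, B interchanges them, C interchanges them twice. *)
  interpret A: mirror_device v0 f k 1 "1/2" "{0}"
    by unfold_locales (auto simp: power2_eq_square)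
  interpret B: mirror_device v0 f k 0 1 "{0}"
    by unfold_locales (auto simp: power2_eq_square)
  interpret C: mirror_device v0 f k 0 1 "{0, 16}"
    by unfold_locales (auto simp: power2_eq_square)
  have a: "body A.device" "zero_resistance A.device v0" "\<not> leaves_no_trace A.device v0"
    using A.body_device A.zero_resistance_if_passes A.passes_shifted A.leaves_trace_if_gap[OF chart]
    by auto
  have b: "body B.device" "leaves_no_trace B.device v0" "\<not> invisible B.device v0"
  proof -
    show "body B.device" by (rule B.body_device)
    define \<rho> :: "real^2 \<Rightarrow> real^2" where "\<rho> w = vector [w $ 1, - w $ 2]" for w
    define R :: "(real^2) set" where "R = {w. 0 < w $ 1 \<and> w $ 1 < 1 \<and> 2 < \<bar>w $ 2\<bar> \<and> \<bar>w $ 2\<bar> < 3}"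
    define \<tau> where "\<tau> = (\<lambda>w. if w \<in> R then \<rho> w else w)"
    have \<tau>_shifted: "plane_chart v0 (\<tau> w) = pt 0 (w $ 1) (B.shifted (w $ 1) (w $ 2))" for w
      unfolding chart pt_eq_iff by (auto simp: \<tau>_def R_def \<rho>_def B.shifted_def sgn_if)
    show "leaves_no_trace B.device v0"
    proof (rule leaves_no_trace_if_planar_map[OF v0 _ B.negligible_exceptional, where \<tau> = \<tau>])
      show "zero_resistance B.device v0"
        using B.zero_resistance_if_passes B.passes_shifted by auto
      show "scattering_defined B.device (plane_chart v0 w) v0 \<and>
          x_tilde_plus B.device (plane_chart v0 w) v0 = plane_chart v0 (\<tau> w)"
        if "w \<notin> {w. B.exceptional (w $ 1) (w $ 2)}" for w
      proof -
        have "B.passes (w $ 1) (w $ 2) (B.shifted (w $ 1) (w $ 2))" using that by (intro B.passes_shifted) auto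
        from B.passes_outcome(1,3)[OF this, of 0] \<tau>_shifted[of w] show ?thesis
          by (simp add: chart[of w])
      qed
      have "open R" unfolding R_def by (intro open_Collect_conj open_Collect_less continuous_intros)
      moreover have "bounded R"
      proof (rule bounded_subset[OF bounded_cbox])
        show "R \<subseteq> cbox (vector [0, - 3]) (vector [1, 3])"
          by (auto simp: R_def mem_box_cart forall_2)
      qed
      moreover have "\<rho> (\<rho> w) = w" for w by (simp add: \<rho>_def vec_eq_iff forall_2)
      moreover have "\<rho> ` R \<subseteq> R" by (auto simp: \<rho>_def R_def)
      moreover have "orthogonal_transformation \<rho>" unfolding \<rho>_def by (rule planar_reflection)
      ultimately show "\<tau> -` A \<in> sets lebesgue \<and> emeasure lebesgue (\<tau> -` A) = emeasure lebesgue A"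
        if "A \<in> sets lebesgue" for A
        unfolding \<tau>_def using that by (intro piecewise_isometry_preserves_lebesgue) auto
    qed
    show "\<not> invisible B.device v0"
    proof
      assume inv: "invisible B.device v0"
      have "\<not> B.exceptional (1/2) (5/2)" by (simp add: B.exceptional_def)
      then have "B.passes (1/2) (5/2) (B.shifted (1/2) (5/2))" by (intro B.passes_shifted) auto
      note out = B.passes_outcome[OF this, of 0]
      have "pt 0 (1/2) (5/2) \<in> {v0}\<^sup>\<bottom>"
        by (simp add: orthogonal_comp_def orthogonal_def inner_commute[of v0])
      then have "x_tilde_plus B.device (pt 0 (1/2) (5/2)) v0 = pt 0 (1/2) (5/2)"
        using inv out(1) unfolding invisible_def by blast
      then show False using out(3) by (simp add: B.shifted_def)
    qed
  qed
  have c: "body C.device" "invisible C.device v0"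
  proof -
    show "body C.device" by (rule C.body_device)
    show "invisible C.device v0"
      unfolding invisible_def
    proof (intro conjI ballI impI)
      show "leaves_no_trace C.device v0"
      proof (rule leaves_no_trace_if_planar_map[OF v0 _ C.negligible_exceptional, where \<tau> = "\<lambda>w. w"])
        show "zero_resistance C.device v0"
          using C.zero_resistance_if_passes C.passes_unchanged by blast
        show "scattering_defined C.device (plane_chart v0 w) v0 \<and>
            x_tilde_plus C.device (plane_chart v0 w) v0 = plane_chart v0 w"
          if "w \<notin> {w. C.exceptional (w $ 1) (w $ 2)}" for w
        proof -
          have "C.passes (w $ 1) (w $ 2) (w $ 2)" using that by (intro C.passes_unchanged) auto
          from C.passes_outcome(1,3)[OF this, of 0] show ?thesis by (simp add: chart)
        qed
      qed auto
      fix x assume x: "x \<in> {v0}\<^sup>\<bottom>" "scattering_defined C.device x v0"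
      obtain w where w: "x = plane_chart v0 w" using x(1) plane_chart_isometry(3)[OF v0] by blast
      have "\<not> C.exceptional (w $ 1) (w $ 2)"
        using C.exceptional_not_scattering_defined x(2) unfolding w chart by blast
      then have "C.passes (w $ 1) (w $ 2) (w $ 2)" by (intro C.passes_unchanged) auto
      from C.passes_outcome(3)[OF this, of 0] show "x_tilde_plus C.device x v0 = x" by (simp add: w chart)
    qed
  qed
  show ?thesis using a b c by blast
qed

end
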